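(* Let $n\ge 2$, $G=SL(n,\mathbb{C})$, $B\subset G$ the Borel subgroup of upper triangular matrices, and $Z=G/B$. Let $D\subset Z$ be an open $SL(n,\mathbb{R})$-orbit with base cycle $C_0$. The number of Schubert varieties $S_w\subset Z$ with $\dim S_w+\dim C_0=\dim Z$ and $S_w\cap C_0\neq\emptyset$ equals the product $(n-1)\cdot(n-3)\cdot(n-5)\cdots$ over all positive integers of the form $n-1-2j$, $j\ge 0$.
   Context: $Z=G/B$ is the manifold of complete flags $0\subset V_1\subset\dots\subset V_n=\mathbb{C}^n$, $\dim V_i=i$. Let $G_0=SL(n,\mathbb{R})$, $K_0=SO(n,\mathbb{R})$ and $m=[n/2]$. An open $G_0$-orbit $D$ in $Z$ contains a unique $K_0$-orbit $C_0$ which is a complex submanifold of $D$, called the base cycle. Let $b(v,w)=v^t w$ be the standard complex bilinear form on $\mathbb{C}^n$ and $\perp$ the orthogonal complement with respect to $b$; $C_0$ is the set of isotropic flags in $D$, i.e. flags in $D$ with $V_i\subset V_i^\perp$ and $V_{n-i}=V_i^\perp$ for all $1\le i\le m$. If $n=2m+1$ there is exactly one open orbit; if $n=2m$ there are two (positively and negatively oriented flags), interchanged by an orientation-reversing map, and $D$ is a fixed one of them. Schubert varieties: for a permutation $w$ of $\{1,\dots,n\}$, $V_w$ is the coordinate flag with $i$-th subspace $\langle e_{w(1)},\dots,e_{w(i)}\rangle$, and $S_w$ is the closure of the orbit $B\cdot V_w$. *)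

theory Defs
  imports "HOL-Analysis.Analysis"
begin

text \<open>
  A finite linearly ordered type \<^typ>\<open>'n\<close> plays the role of the index set \<open>{1..n}\<close>, with \<open>n = CARD('n)\<close>.
  The flag \<open>0 \<subset> V\<^sub>1 \<subset> \<dots> \<subset> V\<^sub>n\<close> is represented by the family of its nonzero members. All linear
  notions with prefix \<open>vec\<close> are over the complex numbers.
\<close>

type_synonym 'n flag = "'n \<Rightarrow> (complex^'n) set"
type_synonym 'n cmat = "complex^'n^'n"

definition flags :: "('n::{finite,linorder}) flag set" where
  "flags = {V. mono V \<and> (\<forall>i. vec.subspace (V i) \<and> vec.dim (V i) = card {..i})}"

definition act :: "'n cmat \<Rightarrow> ('n::{finite,linorder}) flag \<Rightarrow> 'n flag" where
  "act g V = (\<lambda>i. (\<lambda>x. g *v x) ` V i)"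

definition orbit :: "'n cmat set \<Rightarrow> ('n::{finite,linorder}) flag \<Rightarrow> 'n flag set" where
  "orbit H V = (\<lambda>h. act h V) ` H"

definition SL_C :: "('n::finite) cmat set" where
  "SL_C = {g. det g = 1}"

definition SL_R :: "('n::finite) cmat set" where
  "SL_R = {g \<in> SL_C. \<forall>i j. g $ i $ j \<in> \<real>}"

definition SO_R :: "('n::finite) cmat set" where
  "SO_R = {g \<in> SL_R. transpose g ** g = mat 1}"

definition Borel :: "('n::{finite,linorder}) cmat set" where
  "Borel = {g \<in> SL_C. \<forall>i j. j < i \<longrightarrow> g $ i $ j = 0}"

definition coord_flag :: "('n \<Rightarrow> 'n) \<Rightarrow> ('n::{finite,linorder}) flag" where
  "coord_flag w = (\<lambda>i. vec.span ((\<lambda>j. axis (w j) 1) ` {..i}))"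

text \<open>
  The stabilizer of \<open>coord_flag id\<close> in \<^const>\<open>SL_C\<close> is \<^const>\<open>Borel\<close>, so \<open>g \<mapsto> act g (coord_flag id)\<close>
  identifies \<open>G/B\<close> with \<^const>\<open>flags\<close>; the flag manifold carries the resulting quotient topology.
\<close>

definition flag_topology :: "('n::{finite,linorder}) flag topology" where
  "flag_topology = topology (\<lambda>S. S \<subseteq> flags \<and>
     openin (top_of_set SL_C) {g \<in> SL_C. act g (coord_flag id) \<in> S})"

lemma openin_flag_topology:
  fixes S :: "('n::{finite,linorder}) flag set"
  shows "openin flag_topology S \<longleftrightarrow> S \<subseteq> flags \<and>
     openin (top_of_set SL_C) {g \<in> SL_C. act g (coord_flag id) \<in> S}"
proof -
  let ?P = "\<lambda>S :: 'n flag set. {g \<in> SL_C. act g (coord_flag id) \<in> S}"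
  let ?O = "\<lambda>S. S \<subseteq> flags \<and> openin (top_of_set SL_C) (?P S)"
  have "?O (S \<inter> T)" if "?O S" "?O T" for S T
  proof -
    have "?P (S \<inter> T) = ?P S \<inter> ?P T" by blast
    then show ?thesis using that by (auto intro: openin_Int)
  qed
  moreover have "?O (\<Union>\<K>)" if "\<forall>S\<in>\<K>. ?O S" for \<K>
  proof -
    have "?P (\<Union>\<K>) = \<Union>(?P ` \<K>)" by blast
    moreover have "openin (top_of_set SL_C) (\<Union>(?P ` \<K>))" using that by (intro openin_Union) blast
    ultimately show ?thesis using that by auto
  qed
  ultimately have "istopology ?O"
    unfolding istopology_def by blast
  then show ?thesis
    unfolding flag_topology_def by (simp add: topology_inverse')
qed

text \<open>
  The holomorphic charts of the flag manifold: for each \<open>g\<close> in \<^const>\<open>SL_C\<close>, the space of lower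
  unitriangular matrices (an affine space of dimension \<open>n(n-1)/2\<close>) parametrizes an open
  neighbourhood of the flag \<open>act g (coord_flag id)\<close> via \<open>chart g\<close>.
\<close>

definition lower_unitriangular :: "('n::{finite,linorder}) cmat set" where
  "lower_unitriangular = {u. (\<forall>i. u $ i $ i = 1) \<and> (\<forall>i j. i < j \<longrightarrow> u $ i $ j = 0)}"

definition chart :: "'n cmat \<Rightarrow> 'n cmat \<Rightarrow> ('n::{finite,linorder}) flag" where
  "chart g u = act (g ** u) (coord_flag id)"

text \<open>
  Holomorphic immersions from a relatively open subset \<open>U\<close> of a complex linear space \<open>W\<close> into the
  space of matrices: the real derivative along \<open>W\<close> exists, is complex linear and is injective.
\<close>

definition holomorphic_immersion_on ::
    "(complex^'d) set \<Rightarrow> (complex^'d) set \<Rightarrow> (complex^'d \<Rightarrow> complex^'n^'m) \<Rightarrow> bool" where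
  "holomorphic_immersion_on W U f \<longleftrightarrow>
     (\<forall>x\<in>U. \<exists>f'. (f has_derivative f') (at x within W) \<and>
        (\<forall>c. \<forall>v\<in>W. \<forall>i j. f' (c *s v) $ i $ j = c * f' v $ i $ j) \<and> inj_on f' W)"

text \<open>
  \<open>M\<close> is a (locally closed) complex submanifold of pure dimension \<open>d\<close>: near each of its points it
  is, in some chart, the image of a holomorphic embedding of an open subset of a \<open>d\<close>-dimensional
  complex vector space \<open>W\<close>. Taking \<open>W\<close> inside \<open>\<complex>\<^bsup>n\<times>n\<^esup>\<close> is no restriction, as \<open>d \<le> n(n-1)/2\<close> for
  nonempty \<open>M\<close>.
\<close>

definition complex_submanifold :: "nat \<Rightarrow> ('n::{finite,linorder}) flag set \<Rightarrow> bool" where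
  "complex_submanifold d M \<longleftrightarrow> M \<subseteq> flags \<and>
     (\<forall>V\<in>M. \<exists>g\<in>SL_C. \<exists>(W :: (complex^('n \<times> 'n)) set) U f.
        vec.subspace W \<and> vec.dim W = d \<and> openin (top_of_set W) U \<and>
        f ` U \<subseteq> lower_unitriangular \<and> holomorphic_immersion_on W U f \<and>
        embedding_map (top_of_set U) flag_topology (chart g \<circ> f) \<and>
        V \<in> (chart g \<circ> f) ` U \<and>
        openin (subtopology flag_topology M) ((chart g \<circ> f) ` U))"

text \<open>
  The complex dimension of a subset of the flag manifold: the largest dimension of a nonempty
  complex submanifold contained in it. For analytic subsets, such as Schubert varieties, this is
  the dimension of the manifold of regular points.
\<close>

definition cdim :: "('n::{finite,linorder}) flag set \<Rightarrow> nat" where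
  "cdim S = Max {d. \<exists>M. M \<noteq> {} \<and> M \<subseteq> S \<and> complex_submanifold d M}"

definition schubert :: "('n \<Rightarrow> 'n) \<Rightarrow> ('n::{finite,linorder}) flag set" where
  "schubert w = flag_topology closure_of orbit Borel (coord_flag w)"

definition open_orbit :: "('n::{finite,linorder}) flag set \<Rightarrow> bool" where
  "open_orbit D \<longleftrightarrow> (\<exists>V\<in>flags. D = orbit SL_R V) \<and> openin flag_topology D"

definition base_cycle :: "('n::{finite,linorder}) flag set \<Rightarrow> 'n flag set \<Rightarrow> bool" where
  "base_cycle D C \<longleftrightarrow> (\<exists>V\<in>D. C = orbit SO_R V) \<and> C \<subseteq> D \<and> (\<exists>d. complex_submanifold d C)"

end

theory Submission
  imports Defs
begin

text \<open>
  The dimension of a Schubert variety \<open>S\<^sub>w\<close> is the number of inversions of \<open>w\<close>, and distinct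
  permutations have distinct Schubert varieties (\<open>cdim_schubert\<close>, \<open>schubert_inject\<close>). Indeed, the Bruhat cell
  of \<open>w\<close> is a coordinate slice of a chart with one coordinate for each inversion (\<open>cell_eq\<close>), and every flag
  in its closure lies in the cell of some \<open>v\<close> whose rank function dominates that of \<open>w\<close>, so that \<open>v\<close> has no more
  inversions than \<open>w\<close> (\<open>schubert_rk\<close>, \<open>ninv_mono\<close>). Upper bounds for the dimension of submanifolds come from
  invariance of domain.

  The base cycle is an orbit \<open>C = SO(n,\<real>) V\<close> that is a complex submanifold. Its tangent space at \<open>V\<close>, the image
  of \<open>so(n,\<real>)\<close>, is then closed under multiplication by \<open>\<i>\<close>, which means that \<open>so(n,\<complex>)\<close> is the sum of
  \<open>so(n,\<real>)\<close> and the stabilizer of \<open>V\<close>. Testing this on skew matrices of rank two shows that \<open>V\<close> is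
  isotropic (\<open>cycle_isotropic\<close>). Conversely \<open>O(n,\<real>)\<close> is transitive on isotropic flags (\<open>isotropic_transitive\<close>),
  so the stabilizer in \<open>so(n,\<real>)\<close> can be computed for one model flag. It consists of rotations in \<open>\<lfloor>n/2\<rfloor>\<close>
  orthogonal planes, whence \<open>2 dim C + \<lfloor>n/2\<rfloor> = n(n-1)/2\<close> (\<open>cycle_dim\<close>). Hence \<open>S\<^sub>w\<close> has the complementary
  dimension if and only if \<open>w\<close> has \<open>\<lfloor>n\<^sup>2/4\<rfloor>\<close> inversions.

  Let \<open>V\<close> be an isotropic flag in \<open>S\<^sub>w\<close>. The spaces \<open>V\<^sub>t\<close> and \<open>V\<^bsub>n-t\<^esub>\<close> meet \<open>\<langle>e\<^sub>1, \<dots>, e\<^sub>x\<rangle>\<close> in orthogonal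
  subspaces, and semicontinuity turns this into a condition on the word \<open>w(1) \<dots> w(n)\<close>: for each \<open>t \<le> n/2\<close>, at
  most as many of its first \<open>t\<close> letters as of its last \<open>t\<close> letters are bounded by \<open>x\<close> (\<open>isotropic_rank_le\<close>).
  Removing outermost pairs of letters one sees that such a word has at least \<open>\<lfloor>n\<^sup>2/4\<rfloor>\<close> inversions, with
  equality if and only if each outermost pair \<open>(k, l)\<close> is descending and encloses no letter with a value between
  \<open>l\<close> and \<open>k\<close> (\<open>quarter_square_le_invs\<close>). To write down such a word, take for \<open>k\<close> any letter but the least one;
  then \<open>l\<close> must be the predecessor of \<open>k\<close>, and the remaining \<open>n - 2\<close> letters are arranged in the same way. This
  gives \<open>(n-1)(n-3)(n-5)\<dots>\<close> words (\<open>card_special_orders\<close>).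

  Each of these words is realized: the vectors \<open>e\<^bsub>w(p)\<^esub> + \<i> e\<^bsub>w(n+1-p)\<^esub>\<close> for \<open>p \<le> n/2\<close> start an isotropic flag, which
  lies in the Bruhat cell of \<open>w\<close> because \<open>w(n+1-p) < w(p)\<close>. By transitivity this flag or its mirror image under
  a coordinate reflection, which preserves all Bruhat cells, lies in \<open>C\<close> (\<open>signed_iso_flag_in_orbit\<close>).
\<close>

section \<open>Words with few inversions\<close>

lemma outer_pair_induct [case_names Nil single pair]:
  assumes "P []" "\<And>x. P [x]" "\<And>k ws l. P ws \<Longrightarrow> P (k # ws @ [l])"
  shows "P xs"
proof (induction "length xs" arbitrary: xs rule: less_induct)
  case less
  show ?case
  proof (cases xs)
    case (Cons k ys)
    then show ?thesis
      using assms less by (cases ys rule: rev_cases) auto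
  qed (use assms in auto)
qed

fun invs :: "'a::linorder list \<Rightarrow> nat" where
  "invs [] = 0"
| "invs (x # xs) = length (filter (\<lambda>y. y < x) xs) + invs xs"

lemma invs_snoc: "invs (xs @ [l]) = invs xs + length (filter (\<lambda>x. l < x) xs)"
  by (induction xs) auto

text \<open>
  Every letter of \<open>ws\<close> forms at least one inversion with a descending pair \<open>k, l\<close> around \<open>ws\<close>, and exactly one if its
  value does not lie between \<open>l\<close> and \<open>k\<close>. The special words, built from such pairs, will be the ballot words with the
  least number of inversions.
\<close>

fun special :: "'a::linorder list \<Rightarrow> bool" where
  "special xs = (2 \<le> length xs \<longrightarrow>
     last xs < hd xs \<and> (\<forall>x\<in>set (butlast (tl xs)). \<not> (last xs < x \<and> x < hd xs)) \<and>
     special (butlast (tl xs)))"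

declare special.simps [simp del]

lemma special_simps [simp]:
  "special []" "special [x]"
  "special (k # ws @ [l]) \<longleftrightarrow> l < k \<and> (\<forall>x\<in>set ws. \<not> (l < x \<and> x < k)) \<and> special ws"
  by (subst special.simps; simp)+

lemma quarter_square_Suc_Suc: "(Suc (Suc s))\<^sup>2 div 4 = s\<^sup>2 div 4 + s + 1"
proof -
  have "(Suc (Suc s))\<^sup>2 = s\<^sup>2 + 4 * (s + 1)" by (simp add: power2_eq_square algebra_simps)
  then show ?thesis by simp
qed

definition cnt :: "'a set \<Rightarrow> 'a list \<Rightarrow> int" where
  "cnt J xs = int (length (filter (\<lambda>x. x \<in> J) xs))"

lemma cnt_simps [simp]:
  "cnt J [] = 0" "cnt J (x # xs) = of_bool (x \<in> J) + cnt J xs" "cnt J (xs @ ys) = cnt J xs + cnt J ys"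
  by (auto simp: cnt_def)

text \<open>
  For \<open>d = 0\<close> the condition says that, among the letters in an initial segment \<open>J\<close>, the last \<open>i\<close> letters are at least as
  numerous as the first \<open>i\<close> letters. The offset \<open>d\<close> remembers outer letters that have been removed, which makes the
  condition stable under the removal of outermost pairs. Open segments are listed separately because \<open>{..<x}\<close> need not have a
  largest element in an arbitrary linear order.
\<close>

definition ballot :: "('a::linorder set \<Rightarrow> int) \<Rightarrow> 'a list \<Rightarrow> bool" where
  "ballot d xs \<longleftrightarrow> (\<forall>i\<le>length xs div 2. \<forall>J. (\<exists>x. J = {..x} \<or> J = {..<x}) \<longrightarrow>
      cnt J (take i xs) \<le> d J + cnt J (drop (length xs - i) xs))"

lemma ballot_nonneg:
  assumes "ballot d xs" "\<exists>x. J = {..x} \<or> J = {..<x}"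
  shows "0 \<le> d J"
proof -
  have "cnt J (take 0 xs) \<le> d J + cnt J (drop (length xs - 0) xs)"
    using assms unfolding ballot_def by blast
  then show ?thesis by simp
qed

lemma length_filter_sum_list: "int (length (filter P xs)) = (\<Sum>x\<leftarrow>xs. of_bool (P x))"
  by (induction xs) auto

lemma ballot_outer_pair:
  assumes "ballot d (k # ws @ [l])"
  shows "ballot (\<lambda>J. d J + of_bool (l \<in> J) - of_bool (k \<in> J)) ws"
  unfolding ballot_def
proof (intro allI impI)
  fix i and J :: "'a set" assume "i \<le> length ws div 2" "\<exists>x. J = {..x} \<or> J = {..<x}"
  then have "Suc i \<le> length (k # ws @ [l]) div 2" "i \<le> length ws" by auto
  with assms \<open>\<exists>x. _\<close> have "cnt J (take (Suc i) (k # ws @ [l])) \<le>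
      d J + cnt J (drop (length (k # ws @ [l]) - Suc i) (k # ws @ [l]))"
    unfolding ballot_def by blast
  with \<open>i \<le> length ws\<close>
  show "cnt J (take i ws) \<le> d J + of_bool (l \<in> J) - of_bool (k \<in> J) + cnt J (drop (length ws - i) ws)"
    by (simp add: Suc_diff_le)
qed

text \<open>
  Induction on the outermost pairs. Removing \<open>k\<close> and \<open>l\<close> replaces \<open>d\<close> by an offset \<open>d'\<close>, and the inversions of the pair
  with an inner letter \<open>x\<close> account for the change of the offset:
  \<open>[x < k] + [l < x] + d {..x} = 1 + d' {..x}\<close>. So the quantity \<open>invs xs + (\<Sum>x\<leftarrow>xs. d {..x})\<close> decreases by the length of
  the inner word plus \<open>[l < k] + d {..k} + d {..l}\<close>, and the latter is at least 1: for \<open>k < l\<close> both values of \<open>d\<close> are positive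
  by the ballot condition for the segments \<open>{..k}\<close> and \<open>{..<l}\<close>. The hypothesis that \<open>d\<close> does not jump at the letters
  of \<open>xs\<close> holds because each letter is removed only once.
\<close>

lemma quarter_square_le_invs:
  assumes "ballot d xs" "distinct xs" "\<And>x. x \<in> set xs \<Longrightarrow> d {..x} = d {..<x}"
  shows "int ((length xs)\<^sup>2 div 4) \<le> int (invs xs) + (\<Sum>x\<leftarrow>xs. d {..x}) \<and>
    (int ((length xs)\<^sup>2 div 4) = int (invs xs) + (\<Sum>x\<leftarrow>xs. d {..x}) \<longrightarrow>
      special xs \<and> (\<forall>x\<in>set xs. d {..x} = 0))"
  using assms
proof (induction xs arbitrary: d rule: outer_pair_induct)
  case Nil
  then show ?case by simp
next
  case (single x)
  have "0 \<le> d {..x}" by (rule ballot_nonneg[OF single.prems(1)]) blast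
  then show ?case by auto
next
  case (pair k ws l)
  let ?d = "\<lambda>J. d J + of_bool (l \<in> J) - of_bool (k \<in> J)"
  have kl: "k \<noteq> l" "k \<notin> set ws" "l \<notin> set ws" "distinct ws" using pair.prems by auto
  have b: "ballot ?d ws" by (rule ballot_outer_pair) fact
  have d_eq: "?d {..x} = ?d {..<x}" if "x \<in> set ws" for x
  proof -
    have "d {..x} = d {..<x}" using pair.prems(3)[of x] that by simp
    moreover have "x \<noteq> k" "x \<noteq> l" using that kl by blast+
    then have "l \<le> x \<longleftrightarrow> l < x" "k \<le> x \<longleftrightarrow> k < x" by auto
    ultimately show ?thesis by simp
  qed
  note IH = pair.IH[OF b \<open>distinct ws\<close> d_eq]
  have nonneg: "0 \<le> d J" if "\<exists>x. J = {..x} \<or> J = {..<x}" for J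
    using ballot_nonneg[OF pair.prems(1) that] .
  have first: "of_bool (k \<in> J) \<le> d J + of_bool (l \<in> J)" if "\<exists>x. J = {..x} \<or> J = {..<x}" for J
  proof -
    have "0 \<le> ?d J" by (rule ballot_nonneg[OF b that])
    then show ?thesis by simp
  qed
  have count: "int (length (filter (\<lambda>x. x < k) ws)) + int (length (filter (\<lambda>x. l < x) ws)) +
      (\<Sum>x\<leftarrow>ws. d {..x}) = int (length ws) + (\<Sum>x\<leftarrow>ws. ?d {..x})"
  proof -
    have "(\<Sum>x\<leftarrow>ws. of_bool (x < k) + of_bool (l < x) + d {..x}) = (\<Sum>x\<leftarrow>ws. 1 + ?d {..x})"
      using kl by (intro arg_cong[of _ _ sum_list] map_cong) (auto simp: of_bool_def)
    then show ?thesis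
      by (simp add: length_filter_sum_list sum_list_addf sum_list_triv)
  qed
  have total: "int (invs (k # ws @ [l])) + (\<Sum>x\<leftarrow>k # ws @ [l]. d {..x}) =
     int (invs ws) + (\<Sum>x\<leftarrow>ws. ?d {..x}) + int (length ws) + of_bool (l < k) + d {..k} + d {..l}"
    using count by (simp add: invs_snoc)
  have dk: "0 \<le> d {..k}" "0 \<le> d {..l}" by (rule nonneg; blast)+
  define q where "q = int ((length ws)\<^sup>2 div 4)"
  define T where "T = int (invs ws) + (\<Sum>x\<leftarrow>ws. ?d {..x})"
  have len: "int ((length (k # ws @ [l]))\<^sup>2 div 4) = q + int (length ws) + 1"
    unfolding q_def by (simp add: quarter_square_Suc_Suc)
  have total': "int (invs (k # ws @ [l])) + (\<Sum>x\<leftarrow>k # ws @ [l]. d {..x}) =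
      T + int (length ws) + of_bool (l < k) + d {..k} + d {..l}"
    unfolding total T_def ..
  from IH have IH1: "q \<le> T"
    and IH2: "q = T \<Longrightarrow> special ws" "\<And>x. q = T \<Longrightarrow> x \<in> set ws \<Longrightarrow> ?d {..x} = 0"
    unfolding q_def T_def by blast+
  show ?case
    unfolding len total'
  proof (intro conjI impI)
    \<comment> \<open>An ascending pair is compensated by the offset, even with one unit to spare.\<close>
    have big: "1 \<le> d {..k} \<and> 1 \<le> d {..l}" if "\<not> l < k"
    proof -
      have "k < l" using that kl by simp
      moreover have "of_bool (k \<in> {..k}) \<le> d {..k} + of_bool (l \<in> {..k})" by (rule first) blast
      moreover have "of_bool (k \<in> {..<l}) \<le> d {..<l} + of_bool (l \<in> {..<l})" by (rule first) blast
      moreover have "d {..l} = d {..<l}" by (rule pair.prems(3)) simp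
      moreover have "\<not> l \<le> k" using \<open>k < l\<close> by simp
      ultimately show ?thesis by simp
    qed
    show "q + int (length ws) + 1 \<le> T + int (length ws) + of_bool (l < k) + d {..k} + d {..l}"
      using IH1 dk big by (cases "l < k") auto
    assume eq: "q + int (length ws) + 1 = T + int (length ws) + of_bool (l < k) + d {..k} + d {..l}"
    have lk: "l < k" using eq IH1 big by (cases "l < k") auto
    have z: "d {..k} = 0" "d {..l} = 0" "q = T" using eq IH1 dk lk by auto
    have ws: "d {..x} = 0 \<and> \<not> (l < x \<and> x < k)" if "x \<in> set ws" for x
    proof -
      have "?d {..x} = 0" by (rule IH2(2)[OF z(3) that])
      moreover have "0 \<le> d {..x}" by (rule nonneg) blast
      ultimately show ?thesis using lk by (cases "l \<le> x"; cases "k \<le> x") auto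
    qed
    then show "special (k # ws @ [l])" using lk IH2(1)[OF z(3)] by simp
    show "\<forall>x\<in>set (k # ws @ [l]). d {..x} = 0" using ws z by simp
  qed
qed

lemma invs_special:
  "special xs \<Longrightarrow> distinct xs \<Longrightarrow> invs xs = (length xs)\<^sup>2 div 4"
proof (induction xs rule: outer_pair_induct)
  case (pair k ws l)
  have "int (length (filter (\<lambda>x. x < k) ws)) + int (length (filter (\<lambda>x. l < x) ws)) = int (length ws)"
  proof -
    have "(\<Sum>x\<leftarrow>ws. of_bool (x < k) + of_bool (l < x)) = (\<Sum>x\<leftarrow>ws. 1 :: int)"
      using pair.prems by (intro arg_cong[of _ _ sum_list] map_cong) (auto simp: of_bool_def)
    then show ?thesis
      by (simp add: length_filter_sum_list sum_list_addf sum_list_triv)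
  qed
  then show ?case using pair by (simp add: invs_snoc quarter_square_Suc_Suc)
qed auto

lemma invs_eq_quarter_square_iff:
  assumes "ballot (\<lambda>_. 0) xs" "distinct xs"
  shows "invs xs = (length xs)\<^sup>2 div 4 \<longleftrightarrow> special xs"
  using quarter_square_le_invs[of "\<lambda>_. 0" xs] invs_special[of xs] assms
  by (auto simp: sum_list_triv)

definition special_orders :: "'a::linorder set \<Rightarrow> 'a list set" where
  "special_orders S = {xs. distinct xs \<and> set xs = S \<and> special xs}"

lemma Max_below:
  fixes S :: "'a::linorder set"
  assumes "finite S" "k \<in> S - {Min S}"
  defines "p \<equiv> Max {x\<in>S. x < k}"
  shows "p \<in> S" "p < k" "\<And>x. x \<in> S \<Longrightarrow> x < k \<Longrightarrow> x \<le> p"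
proof -
  have fin: "finite {x\<in>S. x < k}" using assms(1) by simp
  have "Min S \<in> S" "Min S \<le> k" using assms(1,2) by (auto intro: Min_in)
  then have "Min S \<in> {x\<in>S. x < k}" using assms(2) by auto
  then have "p \<in> {x\<in>S. x < k}" unfolding p_def using Max_in[OF fin] by blast
  then show "p \<in> S" "p < k" by auto
  show "x \<le> p" if "x \<in> S" "x < k" for x unfolding p_def using that by (intro Max_ge[OF fin]) simp
qed

text \<open>
  The last letter is determined by the first letter \<open>k\<close>: no value lies between them, so it is the predecessor of \<open>k\<close>.
  The first letter has a predecessor if and only if it is not the least one.
\<close>

lemma special_orders_decomp:
  fixes S :: "'a::linorder set"
  assumes fin: "finite S" and card: "2 \<le> card S"
  defines "p \<equiv> \<lambda>k. Max {x\<in>S. x < k}"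
  shows "special_orders S = (\<Union>k\<in>S - {Min S}. (\<lambda>ws. k # ws @ [p k]) ` special_orders (S - {k, p k}))"
proof (intro equalityI subsetI)
  have p_eq: "p k = Max {x\<in>S. x < k}" for k by (simp add: p_def)
  note p = Max_below[OF fin, folded p_eq]
  {
    fix xs assume xs: "xs \<in> special_orders S"
    then have "2 \<le> length xs" using card distinct_card[of xs] by (simp add: special_orders_def)
    then obtain k ys where xs1: "xs = k # ys" "ys \<noteq> []" by (cases xs) force+
    then obtain ws l where "ys = ws @ [l]" by (meson rev_exhaust)
    with xs1 have eq: "xs = k # ws @ [l]" by simp
    have l: "l < k" "\<And>x. x \<in> set ws \<Longrightarrow> l < x \<Longrightarrow> x < k \<Longrightarrow> False" "special ws" "distinct (k # ws @ [l])"
      and S: "S = {k, l} \<union> set ws"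
      using xs unfolding special_orders_def eq by auto
    have "Min S \<le> l" using S fin by (intro Min_le) auto
    then have k: "k \<in> S - {Min S}" using l(1) S by auto
    moreover have "l = p k"
    proof (rule antisym)
      show "l \<le> p k" using p(3)[OF k, of l] l S by blast
      show "p k \<le> l"
      proof (rule ccontr)
        assume "\<not> p k \<le> l"
        then have "l < p k" "p k \<in> set ws" using p(1,2)[OF k] S by auto
        then show False using l(2) p(2)[OF k] by blast
      qed
    qed
    moreover have "ws \<in> special_orders (S - {k, l})"
      using l(3,4) S unfolding special_orders_def by auto
    ultimately show "xs \<in> (\<Union>k\<in>S - {Min S}. (\<lambda>ws. k # ws @ [p k]) ` special_orders (S - {k, p k}))"
      unfolding eq by blast
  }
  {
    fix xs assume "xs \<in> (\<Union>k\<in>S - {Min S}. (\<lambda>ws. k # ws @ [p k]) ` special_orders (S - {k, p k}))"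
    then obtain k ws where k: "k \<in> S - {Min S}" and xs: "xs = k # ws @ [p k]"
      and ws: "distinct ws" "set ws = S - {k, p k}" "special ws" unfolding special_orders_def by blast
    have "\<not> (p k < x \<and> x < k)" if "x \<in> set ws" for x
    proof -
      have "x \<in> S" using that ws(2) by blast
      then show ?thesis using p(3)[OF k, of x] by (meson leD)
    qed
    moreover have "set xs = S" using p(1)[OF k] k ws(2) unfolding xs by auto
    moreover have "distinct xs" using p(2)[OF k] ws(1,2) unfolding xs by simp
    ultimately show "xs \<in> special_orders S"
      using p(2)[OF k] ws(3) unfolding special_orders_def xs by simp
  }
qed

lemma prod_odd_step:
  assumes "2 \<le> s"
  shows "(\<Prod>j\<in>{j::nat. 2 * j < s - 1}. s - 1 - 2 * j) =
    (s - 1) * (\<Prod>j\<in>{j::nat. 2 * j < s - 2 - 1}. s - 2 - 1 - 2 * j)"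
proof -
  have fin: "finite {j::nat. 2 * j < t}" for t
    by (rule finite_subset[of _ "{..t}"]) auto
  have "{j::nat. 2 * j < s - 1} = insert 0 (Suc ` {j. 2 * j < s - 2 - 1})"
  proof -
    have "j \<in> insert 0 (Suc ` {j. 2 * j < s - 2 - 1})" if "2 * j < s - 1" for j :: nat
      using that by (cases j) auto
    then show ?thesis using assms by auto
  qed
  then have "(\<Prod>j\<in>{j::nat. 2 * j < s - 1}. s - 1 - 2 * j) =
      (s - 1) * (\<Prod>j\<in>Suc ` {j. 2 * j < s - 2 - 1}. s - 1 - 2 * j)"
    using fin by (simp add: prod.insert)
  also have "(\<Prod>j\<in>Suc ` {j. 2 * j < s - 2 - 1}. s - 1 - 2 * j) =
      (\<Prod>j\<in>{j::nat. 2 * j < s - 2 - 1}. s - 2 - 1 - 2 * j)"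
    by (subst prod.reindex) (auto intro!: prod.cong)
  finally show ?thesis .
qed

lemma card_special_orders:
  assumes "finite S"
  shows "card (special_orders S) = (\<Prod>j\<in>{j::nat. 2 * j < card S - 1}. card S - 1 - 2 * j)"
  using assms
proof (induction "card S" arbitrary: S rule: less_induct)
  case less
  consider "card S = 0" | "card S = 1" | "2 \<le> card S" by linarith
  then show ?case
  proof cases
    case 1
    then have "S = {}" using less.prems by simp
    then have "special_orders S = {[]}" by (auto simp: special_orders_def)
    then show ?thesis using 1 by simp
  next
    case 2
    then obtain x where "S = {x}" using card_1_singletonE by blast
    then have "xs = [x]" if "xs \<in> special_orders S" for xs
    proof -
      have "distinct xs" "set xs = {x}" using that \<open>S = {x}\<close> by (auto simp: special_orders_def)
      then have "length xs = 1" using distinct_card[of xs] by simp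
      then obtain y where "xs = [y]" by (metis One_nat_def length_0_conv length_Suc_conv)
      then show ?thesis using \<open>set xs = {x}\<close> by simp
    qed
    then have "special_orders S = {[x]}"
      using \<open>S = {x}\<close> by (auto simp: special_orders_def)
    then show ?thesis using 2 by simp
  next
    case 3
    define p where "p = (\<lambda>k. Max {x\<in>S. x < k})"
    have ne: "S \<noteq> {}" using 3 by auto
    have p_eq: "p k = Max {x\<in>S. x < k}" for k by (simp add: p_def)
    note p = Max_below(1,2)[OF less.prems, folded p_eq]
    let ?F = "\<lambda>k. (\<lambda>ws. k # ws @ [p k]) ` special_orders (S - {k, p k})"
    have fin: "finite (special_orders T)" if "finite T" for T :: "'a set"
    proof (rule finite_subset[OF _ finite_lists_length_le[OF that]])
      show "special_orders T \<subseteq> {xs. set xs \<subseteq> T \<and> length xs \<le> card T}"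
        using distinct_card by (fastforce simp: special_orders_def)
    qed
    have card2: "card (S - {k, p k}) = card S - 2" if "k \<in> S - {Min S}" for k
    proof -
      have "{k, p k} \<subseteq> S" "k \<noteq> p k" using p[OF that] that by auto
      then show ?thesis using less.prems by (simp add: card_Diff_subset)
    qed
    let ?P = "\<Prod>j\<in>{j::nat. 2 * j < card S - 2 - 1}. card S - 2 - 1 - 2 * j"
    have "card (special_orders S) = card (\<Union>k\<in>S - {Min S}. ?F k)"
      using special_orders_decomp[OF less.prems 3] by (simp add: p_def)
    also have "\<dots> = (\<Sum>k\<in>S - {Min S}. card (?F k))"
      using less.prems fin by (intro card_UN_disjoint) auto
    also have "\<dots> = (\<Sum>k\<in>S - {Min S}. ?P)"
    proof (rule sum.cong)
      fix k assume k: "k \<in> S - {Min S}"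
      have "card (?F k) = card (special_orders (S - {k, p k}))"
        by (intro card_image) (auto simp: inj_on_def)
      also have "\<dots> = ?P" using less.hyps[of "S - {k, p k}"] card2[OF k] less.prems 3 by simp
      finally show "card (?F k) = ?P" .
    qed simp
    also have "\<dots> = (card S - 1) * ?P" using less.prems ne by (simp add: card_Diff_singleton)
    finally show ?thesis using prod_odd_step[OF 3] by simp
  qed
qed

section \<open>Permutations of a finite linear order\<close>

definition pos :: "'n::{finite,linorder} \<Rightarrow> nat" where "pos i = card {..i}"

lemma pos_less: "(pos i < pos k) = (i < k)" for i k :: "'n::{finite,linorder}"
proof -
  have "pos i < pos k" if "i < k" for i k :: 'n
    unfolding pos_def using that by (intro psubset_card_mono) (auto simp: psubset_eq intro: order.strict_implies_order)
  then show ?thesis by (metis less_irrefl less_linear not_less_iff_gr_or_eq)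
qed

lemma pos_le: "(pos i \<le> pos k) = (i \<le> k)" for i k :: "'n::{finite,linorder}"
  using pos_less[of k i] by (metis not_less)

lemma pos_eq: "(pos i = pos k) = (i = k)" for i k :: "'n::{finite,linorder}"
  using pos_le[of k i] pos_le[of i k] by (metis order.antisym order_refl)

lemma pos_range: "1 \<le> pos i" "pos i \<le> CARD('n)" for i :: "'n::{finite,linorder}"
proof -
  have "{..i} \<noteq> {}" by blast
  then have "card {..i} \<noteq> 0" by (simp only: card_0_eq[OF finite] not_False_eq_True)
  then show "1 \<le> pos i" unfolding pos_def by linarith
  show "pos i \<le> CARD('n)" unfolding pos_def by (rule card_mono) auto
qed

lemma bij_betw_pos: "bij_betw pos (UNIV :: 'n::{finite,linorder} set) {1..CARD('n)}"
proof -
  have "inj (pos :: 'n \<Rightarrow> nat)" by (simp add: inj_def pos_eq)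
  moreover from this have "range (pos :: 'n \<Rightarrow> nat) = {1..CARD('n)}"
    using pos_range by (intro card_subset_eq) (auto simp: card_image)
  ultimately show ?thesis by (simp add: bij_betw_def)
qed

lemma ex_pos: "1 \<le> t \<Longrightarrow> t \<le> CARD('n::{finite,linorder}) \<Longrightarrow> \<exists>i::'n. pos i = t"
  using bij_betw_pos[where 'n='n] by (metis atLeastAtMost_iff bij_betw_iff_bijections)

text \<open>
  The order-reversing involution, \<open>i \<mapsto> n + 1 - i\<close> in terms of positions.
\<close>

definition opp :: "'n \<Rightarrow> 'n::{finite,linorder}" where
  "opp i = (SOME k. pos k = CARD('n) + 1 - pos i)"

lemma pos_opp: "pos (opp i) = CARD('n) + 1 - pos i" for i :: "'n::{finite,linorder}"
proof -
  have "\<exists>k::'n. pos k = CARD('n) + 1 - pos i"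
    using pos_range[of i] by (intro ex_pos) auto
  then show ?thesis unfolding opp_def by (rule someI_ex)
qed

lemma opp_opp [simp]: "opp (opp i) = i" for i :: "'n::{finite,linorder}"
proof -
  have "pos (opp (opp i)) = pos i" using pos_range[of i] by (simp add: pos_opp)
  then show ?thesis by (simp only: pos_eq)
qed

lemma opp_less: "(opp i < opp k) = (k < i)" for i k :: "'n::{finite,linorder}"
  using pos_range[of i] pos_range[of k] by (subst (1 2) pos_less[symmetric]) (auto simp: pos_opp)

lemma bij_opp: "bij (opp :: 'n \<Rightarrow> 'n::{finite,linorder})"
  by (rule o_bij[of opp]) auto

lemma card_less_opp: "card {i::'n::{finite,linorder}. i < opp i} = CARD('n) div 2"
proof -
  have "i < opp i \<longleftrightarrow> pos i \<in> {1..CARD('n) div 2}" for i :: 'n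
    using pos_range[of i] by (subst pos_less[symmetric]) (auto simp: pos_opp)
  then have "{i::'n. i < opp i} = {i. pos i \<in> {1..CARD('n) div 2}}" by simp
  moreover have "bij_betw pos {i::'n. pos i \<in> {1..CARD('n) div 2}} {1..CARD('n) div 2}"
    unfolding bij_betw_def
  proof
    show "inj_on pos {i::'n. pos i \<in> {1..CARD('n) div 2}}" by (simp add: inj_on_def pos_eq)
    show "pos ` {i::'n. pos i \<in> {1..CARD('n) div 2}} = {1..CARD('n) div 2}"
    proof (intro equalityI subsetI)
      fix t assume t: "t \<in> {1..CARD('n) div 2}"
      then have "1 \<le> t" "t \<le> CARD('n)" by auto
      then obtain i :: 'n where "pos i = t" using ex_pos by blast
      then show "t \<in> pos ` {i::'n. pos i \<in> {1..CARD('n) div 2}}" using t by blast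
    qed blast
  qed
  ultimately show ?thesis by (simp add: bij_betw_same_card)
qed

definition index_list :: "'n::{finite,linorder} list" where "index_list = sorted_list_of_set UNIV"

lemma index_list: "set (index_list :: 'n::{finite,linorder} list) = UNIV"
  "distinct (index_list :: 'n list)" "sorted (index_list :: 'n list)" "length (index_list :: 'n list) = CARD('n)"
  by (simp_all add: index_list_def)

lemma nth_index_list: "index_list ! (pos i - 1) = i" for i :: "'n::{finite,linorder}"
proof -
  let ?L = "index_list :: 'n list"
  note idx = index_list[where 'n='n]
  obtain t where t: "t < length ?L" "?L ! t = i" using idx(1) by (metis UNIV_I in_set_conv_nth)
  have le: "?L ! s \<le> i \<longleftrightarrow> s \<le> t" if "s < length ?L" for s
  proof
    show "?L ! s \<le> i" if "s \<le> t" using sorted_nth_mono[OF idx(3) that t(1)] t by simp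
    show "s \<le> t" if "?L ! s \<le> i"
    proof (rule ccontr)
      assume "\<not> s \<le> t"
      then have "i \<le> ?L ! s" using sorted_nth_mono[OF idx(3), of t s] t \<open>s < _\<close> by simp
      with that have "?L ! s = ?L ! t" using t by simp
      then show False using idx(2) \<open>s < _\<close> t \<open>\<not> s \<le> t\<close> by (auto simp: nth_eq_iff_index_eq)
    qed
  qed
  have "{..i} = (!) ?L ` {..t}"
  proof (intro equalityI subsetI)
    fix x assume "x \<in> {..i}"
    moreover obtain s where "s < length ?L" "?L ! s = x" using idx(1) by (metis UNIV_I in_set_conv_nth)
    ultimately show "x \<in> (!) ?L ` {..t}" using le by auto
  next
    fix x assume "x \<in> (!) ?L ` {..t}"
    then show "x \<in> {..i}" using le t(1) by auto
  qed
  moreover have "inj_on ((!) ?L) {..t}"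
    using idx(2) t(1) by (auto simp: inj_on_def nth_eq_iff_index_eq)
  ultimately have "pos i = Suc t" by (simp add: pos_def card_image)
  then show ?thesis using t by simp
qed

lemma set_take_index_list: "set (take t index_list) = {i::'n::{finite,linorder}. pos i \<le> t}"
proof (intro equalityI subsetI)
  fix i :: 'n assume "i \<in> {i. pos i \<le> t}"
  then have "pos i - 1 < t" "pos i - 1 < CARD('n)" using pos_range[of i] by auto
  then show "i \<in> set (take t index_list)"
    by (metis in_set_conv_nth index_list(4) length_take min_less_iff_conj nth_index_list nth_take)
next
  fix i :: 'n assume "i \<in> set (take t index_list)"
  then obtain s where s: "s < t" "s < CARD('n)" "index_list ! s = i"
    by (auto simp: in_set_conv_nth index_list)
  have "pos i - 1 < CARD('n)" using pos_range[of i] by auto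
  moreover have "index_list ! (pos i - 1) = (index_list ! s :: 'n)" using s nth_index_list[of i] by simp
  ultimately have "pos i - 1 = s"
    using s index_list(2)[where 'n='n] by (metis index_list(4) nth_eq_iff_index_eq)
  then show "i \<in> {i. pos i \<le> t}" using s by auto
qed

text \<open>
  The dimension of the intersection of the \<open>t\<close>-th member of the coordinate flag of \<open>w\<close> with the span of the \<open>e\<^sub>j\<close> with
  \<open>j \<in> J\<close>; see \<open>cell_dim\<close>.
\<close>

definition rk :: "('n \<Rightarrow> 'n) \<Rightarrow> nat \<Rightarrow> 'n::{finite,linorder} set \<Rightarrow> nat" where
  "rk w t J = card {a. pos a \<le> t \<and> w a \<in> J}"

definition word :: "('n \<Rightarrow> 'n) \<Rightarrow> 'n::{finite,linorder} list" where
  "word w = map w index_list"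

lemma cnt_take_word: "cnt J (take t (word w)) = int (rk w t J)"
proof -
  have "length (filter (\<lambda>x. x \<in> J) (take t (word w))) =
      length (filter (\<lambda>a. w a \<in> J) (take t index_list))"
    by (simp add: word_def take_map filter_map o_def)
  also have "\<dots> = card {a \<in> set (take t index_list). w a \<in> J}"
    by (subst distinct_card[symmetric]) (auto simp: index_list(2) intro!: arg_cong[of _ _ card])
  finally show ?thesis by (simp add: cnt_def rk_def set_take_index_list)
qed

lemma rk_top: "t \<ge> CARD('n) \<Longrightarrow> bij w \<Longrightarrow> rk w t J = card J" for w :: "'n::{finite,linorder} \<Rightarrow> 'n"
proof -
  assume t: "t \<ge> CARD('n)" and w: "bij w"
  have "pos a \<le> t" for a :: 'n using pos_range(2)[of a] t by linarith
  then have "{a. pos a \<le> t \<and> w a \<in> J} = w -` J" by auto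
  then show "rk w t J = card J" using w by (simp add: rk_def card_vimage_inj bij_def)
qed

lemma cnt_drop_word:
  assumes "bij w"
  shows "cnt J (drop t (word w)) = int (card J) - int (rk w t J)"
proof -
  have "cnt J (word w) = cnt J (take t (word w)) + cnt J (drop t (word w))"
    by (metis append_take_drop_id cnt_simps(3))
  moreover have "cnt J (word w) = int (card J)"
    using cnt_take_word[of J "length (word w)" w] rk_top[OF _ assms] by (simp add: word_def index_list)
  ultimately show ?thesis by (simp add: cnt_take_word)
qed

lemma rk_lessThan_cases:
  fixes x :: "'n::{finite,linorder}"
  obtains "{..<x} = {}" | y where "{..<x} = {..y}"
proof (cases "{..<x} = {}")
  case False
  have "{..<x} = {..Max {..<x}}"
  proof (intro equalityI subsetI)
    have "Max {..<x} \<in> {..<x}" using False by (intro Max_in) auto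
    then show "y \<in> {..<x}" if "y \<in> {..Max {..<x}}" for y using that by auto
  qed auto
  then show ?thesis using that by blast
qed (use that in blast)

definition ninv :: "('n::{finite,linorder} \<Rightarrow> 'n) \<Rightarrow> nat" where
  "ninv w = card {(i, k). i < k \<and> w k < w i}"

lemma invs_map_sorted:
  assumes "sorted ys" "distinct ys"
  shows "invs (map f ys) = card {(i, k). i \<in> set ys \<and> k \<in> set ys \<and> i < k \<and> f k < f i}"
  using assms
proof (induction ys)
  case (Cons y ys)
  let ?A = "Pair y ` {k \<in> set ys. f k < f y}"
  let ?B = "{(i, k). i \<in> set ys \<and> k \<in> set ys \<and> i < k \<and> f k < f i}"
  have y: "y < z" if "z \<in> set ys" for z using Cons.prems that by (metis distinct.simps(2) order.not_eq_order_implies_strict sorted_simps(2))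
  have "{(i, k). i \<in> set (y # ys) \<and> k \<in> set (y # ys) \<and> i < k \<and> f k < f i} = ?A \<union> ?B"
    using y by (auto dest: order.asym)
  moreover have "?A \<inter> ?B = {}" using y by blast
  moreover have "finite ?B" by (rule finite_subset[of _ "set ys \<times> set ys"]) auto
  ultimately have "card {(i, k). i \<in> set (y # ys) \<and> k \<in> set (y # ys) \<and> i < k \<and> f k < f i} = card ?A + card ?B"
    by (simp add: card_Un_disjoint)
  moreover have "card ?A = card {k \<in> set ys. f k < f y}" by (rule card_image) (simp add: inj_on_def)
  moreover have "card {k \<in> set ys. f k < f y} = length (filter (\<lambda>z. z < f y) (map f ys))"
  proof -
    have "length (filter (\<lambda>z. z < f y) (map f ys)) = length (filter (\<lambda>k. f k < f y) ys)"
      by (simp add: filter_map o_def)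
    also have "\<dots> = card (set (filter (\<lambda>k. f k < f y) ys))"
      using Cons.prems by (intro distinct_card[symmetric]) simp
    finally show ?thesis by simp
  qed
  ultimately show ?case using Cons by simp
qed simp

lemma invs_word: "invs (word w) = ninv w"
  unfolding word_def ninv_def using invs_map_sorted[OF index_list(3,2), of w] by (simp add: index_list)

lemma distinct_word: "inj w \<Longrightarrow> distinct (word w)"
  by (simp add: word_def distinct_map index_list)

text \<open>
  The letters among the last \<open>t\<close> ones are those not among the first \<open>n - t\<close>, so the rank inequalities are the ballot condition
  for the word of \<open>w\<close>.
\<close>

lemma ninv_quarter_square_iff:
  fixes w :: "'n::{finite,linorder} \<Rightarrow> 'n"
  assumes "bij w"
    and isotropic: "\<And>t x. t \<le> CARD('n) div 2 \<Longrightarrow> rk w t {..x} + rk w (CARD('n) - t) {..x} \<le> card {..x}"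
  shows "ninv w = (CARD('n))\<^sup>2 div 4 \<longleftrightarrow> special (word w)"
proof -
  have "ballot (\<lambda>_. 0) (word w)"
    unfolding ballot_def
  proof (intro allI impI)
    fix t and J :: "'n set"
    assume t: "t \<le> length (word w) div 2" and J: "\<exists>x. J = {..x} \<or> J = {..<x}"
    then have t: "t \<le> CARD('n) div 2" by (simp add: word_def index_list)
    have "rk w t J + rk w (CARD('n) - t) J \<le> card J"
    proof -
      obtain x where "J = {..x} \<or> J = {..<x}" using J by blast
      then consider "J = {}" | y where "J = {..y}" by (metis rk_lessThan_cases)
      then show ?thesis using isotropic[OF t] by cases (auto simp: rk_def)
    qed
    then show "cnt J (take t (word w)) \<le> 0 + cnt J (drop (length (word w) - t) (word w))"
      by (simp add: cnt_take_word cnt_drop_word[OF assms(1)]) (simp add: word_def index_list)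
  qed
  from invs_eq_quarter_square_iff[OF this distinct_word[OF bij_is_inj[OF assms(1)]]]
  show ?thesis by (simp add: invs_word) (simp add: word_def index_list)
qed

lemma special_nth: "special xs \<Longrightarrow> i < length xs div 2 \<Longrightarrow> xs ! (length xs - 1 - i) < xs ! i"
proof (induction xs arbitrary: i rule: outer_pair_induct)
  case (pair k ws l)
  show ?case
  proof (cases i)
    case 0
    then show ?thesis using pair.prems by (simp add: nth_append)
  next
    case (Suc i')
    then have "ws ! (length ws - 1 - i') < ws ! i'" using pair by simp
    moreover have i: "i' < length ws" "length ws - 1 - i' < length ws" using Suc pair.prems by auto
    moreover have "length (k # ws @ [l]) - 1 - i = Suc (length ws - 1 - i')" using Suc i by simp
    ultimately show ?thesis unfolding Suc
      by (metis nth_Cons_Suc nth_append)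
  qed
qed auto

lemma special_word_less:
  fixes w :: "'n::{finite,linorder} \<Rightarrow> 'n"
  assumes "special (word w)" "p < opp p"
  shows "w (opp p) < w p"
proof -
  have len: "length (word w) = CARD('n)" by (simp add: word_def index_list)
  have nth: "word w ! (pos i - 1) = w i" for i
    using pos_range[of i] by (simp add: word_def index_list nth_index_list del: One_nat_def)
  have "pos p < pos (opp p)" using assms by (simp add: pos_less)
  then have "pos p - 1 < CARD('n) div 2" "pos (opp p) - 1 = CARD('n) - 1 - (pos p - 1)"
    using pos_range[of p] by (auto simp: pos_opp)
  then show ?thesis using special_nth[OF assms(1), of "pos p - 1"] len nth by metis
qed

lemma card_special_perms:
  "card {w :: 'n::{finite,linorder} \<Rightarrow> 'n. w permutes UNIV \<and> special (word w)} =
     (\<Prod>j\<in>{j::nat. 2 * j < CARD('n) - 1}. CARD('n) - 1 - 2 * j)"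
proof -
  have "bij_betw word {w :: 'n \<Rightarrow> 'n. w permutes UNIV \<and> special (word w)} (special_orders UNIV)"
    unfolding bij_betw_def
  proof (intro conjI equalityI subsetI)
    show "inj_on word {w :: 'n \<Rightarrow> 'n. w permutes UNIV \<and> special (word w)}"
    proof (rule inj_onI)
      fix v w :: "'n \<Rightarrow> 'n" assume "word v = word w"
      then have "v i = w i" for i using index_list(1)[where 'n='n] by (simp add: word_def)
      then show "v = w" by (rule ext)
    qed
    fix xs :: "'n list"
    {
      assume "xs \<in> word ` {w. w permutes UNIV \<and> special (word w)}"
      then obtain w where w: "xs = word w" "w permutes UNIV" "special xs" by blast
      then have "bij w" by (simp add: permutes_bij)
      then have "distinct xs" "set xs = UNIV"
        using w distinct_word[OF bij_is_inj[OF \<open>bij w\<close>]] by (simp_all add: word_def index_list bij_is_surj)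
      then show "xs \<in> special_orders UNIV" using w by (simp add: special_orders_def)
    }
    assume xs: "xs \<in> special_orders UNIV"
    then have d: "distinct xs" "set xs = UNIV" "special xs" by (auto simp: special_orders_def)
    then have len: "length xs = CARD('n)" using distinct_card by fastforce
    define w where "w i = xs ! (pos i - 1)" for i :: 'n
    have "word w = xs"
    proof (rule nth_equalityI)
      show "length (word w) = length xs" by (simp add: word_def index_list len)
      fix t assume "t < length (word w)"
      then have "1 \<le> Suc t" "Suc t \<le> CARD('n)" by (auto simp: word_def index_list)
      then obtain i :: 'n where i: "pos i = Suc t" using ex_pos by blast
      then have "index_list ! t = i" using nth_index_list[of i] by simp
      then show "word w ! t = xs ! t" using i \<open>Suc t \<le> CARD('n)\<close> by (simp add: word_def index_list w_def)
    qed
    moreover have "bij w"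
    proof -
      have "surj w" using d(2) \<open>word w = xs\<close> unfolding word_def by (metis list.set_map index_list(1))
      then show ?thesis by (simp add: bij_def finite_UNIV_surj_inj)
    qed
    ultimately show "xs \<in> word ` {w. w permutes UNIV \<and> special (word w)}"
      using d(3) bij_imp_permutes[of w UNIV] by auto
  qed
  then show ?thesis using card_special_orders[of "UNIV :: 'n set"] by (simp add: bij_betw_same_card)
qed

lemma rk_step: "rk w (pos i) J = rk w (pos i - 1) J + of_bool (w i \<in> J)"
proof -
  have "pos a \<le> pos i \<longleftrightarrow> pos a \<le> pos i - 1 \<or> a = i" for a
    using pos_range[of i] pos_eq[of a i] by linarith
  moreover have "\<not> pos i \<le> pos i - 1" using pos_range[of i] by linarith
  ultimately have "{a. pos a \<le> pos i \<and> w a \<in> J} =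
      (if w i \<in> J then insert i {a. pos a \<le> pos i - 1 \<and> w a \<in> J} else {a. pos a \<le> pos i - 1 \<and> w a \<in> J})"
    "i \<notin> {a. pos a \<le> pos i - 1 \<and> w a \<in> J}" by auto
  then show ?thesis unfolding rk_def by (simp del: One_nat_def mem_Collect_eq)
qed

lemma rk_inject:
  assumes "\<And>t x. rk v t {..x} = rk w t {..x}"
  shows "v = w"
proof
  fix i
  have "v i \<le> x \<longleftrightarrow> w i \<le> x" for x
  proof -
    have "of_bool (v i \<in> {..x}) = (of_bool (w i \<in> {..x}) :: nat)"
      using rk_step[of v i "{..x}"] rk_step[of w i "{..x}"] assms by simp
    then show ?thesis by (simp add: of_bool_eq_iff)
  qed
  then show "v i = w i" by (metis order.antisym order_refl)
qed

text \<open>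
  The number \<open>A u u'\<close> of pairs \<open>a \<le> i\<close> with \<open>u a \<le> u' i\<close> is a monotone function of the rank function of \<open>u\<close>, when summed
  over \<open>i\<close>, and of that of \<open>u'\<close>, when summed over \<open>a\<close>. Hence \<open>A w w \<le> A w v \<le> A v v\<close>, while \<open>A u u\<close> counts
  the pairs that are not inversions of \<open>u\<close>.
\<close>

lemma ninv_mono:
  fixes v w :: "'n::{finite,linorder} \<Rightarrow> 'n"
  assumes v: "bij v" and w: "bij w" and le: "\<And>t x. rk w t {..x} \<le> rk v t {..x}"
  shows "ninv v \<le> ninv w"
proof -
  define A where "A u u' = card {(a, i). a \<le> i \<and> u a \<le> u' i}" for u u' :: "'n \<Rightarrow> 'n"
  have sum1: "A u u' = (\<Sum>i\<in>UNIV. rk u (pos i) {..u' i})" for u u'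
  proof -
    have "{(a, i). a \<le> i \<and> u a \<le> u' i} = prod.swap ` (SIGMA i:UNIV. {a. pos a \<le> pos i \<and> u a \<in> {..u' i}})"
      by (auto simp: pos_le image_iff)
    then have "A u u' = card (SIGMA i:UNIV. {a. pos a \<le> pos i \<and> u a \<in> {..u' i}})"
      unfolding A_def by (simp add: card_image)
    then show ?thesis by (simp add: rk_def)
  qed
  have sum2: "int (A u u') =
      (\<Sum>a\<in>UNIV. int CARD('n) - int (pos a - 1) - int (card {..<u a}) + int (rk u' (pos a - 1) {..<u a}))"
    if u': "bij u'" for u u'
  proof -
    have "{(a, i). a \<le> i \<and> u a \<le> u' i} = (SIGMA a:UNIV. {i. a \<le> i \<and> u a \<le> u' i})" by auto
    then have "A u u' = (\<Sum>a\<in>UNIV. card {i. a \<le> i \<and> u a \<le> u' i})" unfolding A_def by simp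
    moreover have "int (card {i. a \<le> i \<and> c \<le> u' i}) =
        int CARD('n) - int (pos a - 1) - int (card {..<c}) + int (rk u' (pos a - 1) {..<c})" for a c
    proof -
      let ?P = "{i :: 'n. pos i \<le> pos a - 1}" and ?Q = "u' -` {..<c}"
      have P: "pos i \<le> pos a - 1 \<longleftrightarrow> i < a" for i :: 'n
        using pos_range[of a] pos_less[of i a] by linarith
      have "card ?P = pos a - 1"
        using set_take_index_list[of "pos a - 1", where 'n='n] distinct_card[of "take (pos a - 1) (index_list :: 'n list)"]
          pos_range[of a] by (simp add: index_list)
      moreover have "card ?Q = card {..<c}" using u' by (simp add: card_vimage_inj bij_def)
      moreover have "rk u' (pos a - 1) {..<c} = card (?P \<inter> ?Q)"
        unfolding rk_def by (rule arg_cong[of _ _ card]) auto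
      moreover have "card (?P \<union> ?Q) + card (?P \<inter> ?Q) = card ?P + card ?Q"
        using card_Un_Int[of ?P ?Q] by simp
      moreover have "{i. a \<le> i \<and> c \<le> u' i} = - (?P \<union> ?Q)" by (auto simp: P not_less simp del: One_nat_def)
      then have "card {i. a \<le> i \<and> c \<le> u' i} = CARD('n) - card (?P \<union> ?Q)"
        by (simp add: Compl_eq_Diff_UNIV card_Diff_subset)
      moreover have "card (?P \<union> ?Q) \<le> CARD('n)" by (rule card_mono) auto
      ultimately show ?thesis by linarith
    qed
    ultimately show ?thesis by simp
  qed
  have 1: "A w v \<le> A v v" unfolding sum1 by (intro sum_mono le)
  have "rk w t {..<x} \<le> rk v t {..<x}" for t x
    by (rule rk_lessThan_cases[of x]) (simp_all add: le rk_def[of _ _ "{}"])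
  then have 2: "int (A w w) \<le> int (A w v)" unfolding sum2[OF v] sum2[OF w] by (intro sum_mono add_left_mono) simp
  have 3: "ninv u + A u u = card {(a, i :: 'n). a \<le> i}" for u :: "'n \<Rightarrow> 'n"
  proof -
    let ?I = "{(i, k). i < k \<and> u k < u i}" and ?J = "{(a, i). a \<le> i \<and> u a \<le> u i}"
    have "(i < k \<and> u k < u i) \<or> (i \<le> k \<and> u i \<le> u k) \<longleftrightarrow> i \<le> k" for i k
      by (metis linorder_not_le order.order_iff_strict order_refl)
    then have "?I \<union> ?J = {(a, i). a \<le> i}" by (simp add: set_eq_iff)
    moreover have "?I \<inter> ?J = {}" by (auto dest: leD)
    ultimately have "card ?I + card ?J = card {(a, i :: 'n). a \<le> i}"
      using card_Un_disjoint[of ?I ?J] by simp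
    then show ?thesis unfolding A_def ninv_def .
  qed
  show ?thesis using 1 2 3[of v] 3[of w] by linarith
qed

lemma card_strict_pairs: "2 * card {(k, i :: 'n::{finite,linorder}). i < k} = CARD('n) * (CARD('n) - 1)"
proof -
  let ?A = "{(k, i :: 'n). i < k}" and ?B = "{(k, i :: 'n). k < i}" and ?D = "range (\<lambda>i::'n. (i, i))"
  have "?B = prod.swap ` ?A" by auto
  then have B: "card ?B = card ?A" by (simp add: card_image)
  have D: "card ?D = CARD('n)" by (rule card_image) (simp add: inj_def)
  have "?A \<inter> (?B \<union> ?D) = {}" by (auto dest: order.asym)
  then have "card (?A \<union> (?B \<union> ?D)) = card ?A + card (?B \<union> ?D)" by (intro card_Un_disjoint) auto
  moreover have "?A \<union> (?B \<union> ?D) = (UNIV :: ('n \<times> 'n) set)"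
    using not_less_iff_gr_or_eq by blast
  ultimately have "CARD('n \<times> 'n) = card ?A + card (?B \<union> ?D)" by simp
  also have "card (?B \<union> ?D) = card ?B + card ?D" by (rule card_Un_disjoint) auto
  finally show ?thesis using B D by (simp add: algebra_simps diff_mult_distrib2)
qed

section \<open>The flag manifold and its charts\<close>

lemma perm_le_imp_id:
  fixes p :: "'n::{finite,linorder} \<Rightarrow> 'n"
  assumes "inj p" "\<And>i. p i \<le> i"
  shows "p = id"
proof
  fix i
  show "p i = id i"
  proof (induction "pos i" arbitrary: i rule: less_induct)
    case less
    show ?case
    proof (rule ccontr)
      assume "p i \<noteq> id i"
      then have "p i < i" using assms(2)[of i] by (simp add: order.not_eq_order_implies_strict)
      then have "p (p i) = p i" using less[of "p i"] by (simp add: pos_less)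
      then show False using assms(1) \<open>p i \<noteq> id i\<close> by (simp add: inj_eq)
    qed
  qed
qed

text \<open>
  A permutation \<open>p\<close> that contributes to the determinant satisfies \<open>i \<le> p i\<close> for all \<open>i\<close>, so it is the identity.
\<close>

lemma det_upper_triangular:
  fixes A :: "('a::comm_ring_1)^('n::{finite,linorder})^('n::{finite,linorder})"
  assumes "\<And>i j. j < i \<Longrightarrow> A $ i $ j = 0"
  shows "det A = (\<Prod>i\<in>UNIV. A $ i $ i)"
proof -
  let ?pp = "\<lambda>p. of_int (sign p) * (\<Prod>i\<in>UNIV. A $ i $ p i)"
  have "?pp p = 0" if "p \<in> {p. p permutes UNIV} - {id}" for p
  proof -
    have "inj (inv p)" "p \<noteq> id" "bij p" using that by (auto intro: permutes_bij bij_is_inj permutes_inv)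
    have "\<exists>i. \<not> inv p i \<le> i"
    proof (rule ccontr)
      assume "\<not> ?thesis"
      then have "inv p = id" using perm_le_imp_id[OF \<open>inj (inv p)\<close>] by blast
      then show False using \<open>p \<noteq> id\<close> \<open>bij p\<close> by (metis inv_id inv_inv_eq)
    qed
    then obtain i where "i < inv p i" using not_le by blast
    then have "A $ (inv p i) $ p (inv p i) = 0"
      using assms \<open>bij p\<close> by (simp add: bij_is_surj surj_f_inv_f)
    then have "(\<Prod>i\<in>UNIV. A $ i $ p i) = 0" by (metis UNIV_I finite prod_zero)
    then show ?thesis by simp
  qed
  then have "det A = sum ?pp {id}"
    unfolding det_def by (intro sum.mono_neutral_right) (auto simp: permutes_id finite_permutations)
  then show ?thesis by (simp add: sign_id)
qed

definition upper_tri :: "('n::{finite,linorder}) cmat set" where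
  "upper_tri = {p. \<forall>i j. j < i \<longrightarrow> p $ i $ j = 0}"

lemma det_upper_tri: "p \<in> upper_tri \<Longrightarrow> det p = (\<Prod>i\<in>UNIV. p $ i $ i)"
  by (rule det_upper_triangular) (simp add: upper_tri_def)

lemma det_lower_unitriangular: "u \<in> lower_unitriangular \<Longrightarrow> det u = 1"
proof -
  assume u: "u \<in> lower_unitriangular"
  have "det (transpose u) = (\<Prod>i\<in>UNIV. transpose u $ i $ i)"
    by (rule det_upper_triangular) (use u in \<open>simp add: lower_unitriangular_def transpose_def\<close>)
  then show "det u = 1" using u by (simp add: lower_unitriangular_def transpose_def det_transpose[unfolded transpose_def])
qed

lemma matrix_inv_right: "det g \<noteq> 0 \<Longrightarrow> g ** matrix_inv g = mat 1"
  and matrix_inv_left: "det g \<noteq> 0 \<Longrightarrow> matrix_inv g ** g = mat 1" for g :: "'n::finite cmat"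
proof -
  assume "det g \<noteq> 0"
  then have "\<exists>h. g ** h = mat 1 \<and> h ** g = mat 1" by (simp add: invertible_det_nz[symmetric] invertible_def)
  then have "g ** matrix_inv g = mat 1 \<and> matrix_inv g ** g = mat 1"
    unfolding matrix_inv_def by (rule someI_ex)
  then show "g ** matrix_inv g = mat 1" "matrix_inv g ** g = mat 1" by auto
qed

lemma det_matrix_inv: "det g \<noteq> 0 \<Longrightarrow> det (matrix_inv g) * det g = 1" for g :: "'n::finite cmat"
  using arg_cong[OF matrix_inv_left, of g det] by (simp add: det_mul)

lemma det_matrix_inv_nz: "det g \<noteq> 0 \<Longrightarrow> det (matrix_inv g) \<noteq> 0" for g :: "'n::finite cmat"
  using det_matrix_inv[of g] by auto

lemma inj_matrix: "det g \<noteq> 0 \<Longrightarrow> inj_on (\<lambda>x. g *v x) S" for g :: "'n::finite cmat"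
  by (rule inj_onI) (metis matrix_inv_left matrix_vector_mul_assoc matrix_vector_mul_lid)

lemma vec_subspace_image: "vec.subspace S \<Longrightarrow> vec.subspace ((\<lambda>x. g *v x) ` S)" for g :: "'n::finite cmat"
  by (rule vec.linear_subspace_image[OF matrix_vector_mul_linear_gen])

lemma vec_dim_image: "det g \<noteq> 0 \<Longrightarrow> vec.dim ((\<lambda>x. g *v x) ` S) = vec.dim S" for g :: "'n::finite cmat"
  by (rule vec.dim_image_eq[OF matrix_vector_mul_linear_gen inj_matrix])

text \<open>An invertible map that sends a subspace into itself is onto it, by dimension.\<close>

lemma invariant_subspace_image:
  fixes g :: "'n::finite cmat"
  assumes "det g \<noteq> 0" "vec.subspace S" "\<And>x. x \<in> S \<Longrightarrow> g *v x \<in> S"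
  shows "(\<lambda>x. g *v x) ` S = S"
  using assms by (intro vec.subspace_dim_equal vec_subspace_image) (auto simp: vec_dim_image)

definition coords :: "'n set \<Rightarrow> (complex^'n) set" where
  "coords J = {x. \<forall>j. j \<notin> J \<longrightarrow> x $ j = 0}"

lemma subspace_coords: "vec.subspace (coords J)"
  by (simp add: coords_def vec.subspace_def)

lemma dim_coords: "vec.dim (coords J) = card J"
  unfolding coords_def by (rule dim_substandard_cart)

lemma coords_mono: "J \<subseteq> K \<Longrightarrow> coords J \<subseteq> coords K"
  by (auto simp: coords_def)

lemma span_axis_coords: "vec.span ((\<lambda>j. axis j 1) ` J) = coords J"
proof
  show "vec.span ((\<lambda>j. axis j 1) ` J) \<subseteq> coords J"
    by (rule vec.span_minimal[OF _ subspace_coords]) (auto simp: coords_def axis_def)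
  have "x \<in> vec.span ((\<lambda>j. axis j 1) ` J)" if x: "x \<in> coords J" for x :: "complex^'a"
  proof -
    have "x = (\<Sum>j\<in>UNIV. x $ j *s axis j 1)" by (simp add: vec_eq_iff axis_def if_distrib cong: if_cong)
    also have "\<dots> = (\<Sum>j\<in>J. x $ j *s axis j 1)"
      using x by (intro sum.mono_neutral_right) (auto simp: coords_def)
    also have "\<dots> \<in> vec.span ((\<lambda>j. axis j 1) ` J)"
      by (intro vec.span_sum vec.span_scale vec.span_base) auto
    finally show ?thesis .
  qed
  then show "coords J \<subseteq> vec.span ((\<lambda>j. axis j 1) ` J)" by blast
qed

lemma coord_flag_eq: "coord_flag w i = coords (w ` {..i})"
proof -
  have "(\<lambda>j. axis (w j) (1::complex)) ` {..i} = (\<lambda>j. axis j 1) ` (w ` {..i})" by (simp add: image_image)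
  then show ?thesis unfolding coord_flag_def by (simp only: span_axis_coords)
qed

lemma coord_flag_in_flags:
  assumes "inj w"
  shows "coord_flag w \<in> flags"
proof -
  have "coords (w ` {..i}) \<subseteq> coords (w ` {..k})" if "i \<le> k" for i k
    using that by (intro coords_mono image_mono) simp
  moreover have "card (w ` {..i}) = card {..i}" for i
    by (rule card_image) (rule inj_on_subset[OF assms subset_UNIV])
  ultimately show ?thesis
    by (simp add: flags_def mono_def coord_flag_eq subspace_coords dim_coords)
qed

lemma act_act: "act g (act h V) = act (g ** h) V"
  by (simp add: act_def image_image matrix_vector_mul_assoc)

lemma act_one [simp]: "act (mat 1) V = V"
  by (simp add: act_def)

lemma act_flags:
  assumes "V \<in> flags" "det g \<noteq> 0"
  shows "act g V \<in> flags"
proof -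
  have V: "mono V" "\<And>i. vec.subspace (V i)" "\<And>i. vec.dim (V i) = card {..i}"
    using assms(1) unfolding flags_def by blast+
  have "mono (act g V)" unfolding act_def by (intro monoI image_mono monoD[OF V(1)])
  moreover have "vec.subspace (act g V i) \<and> vec.dim (act g V i) = card {..i}" for i
    unfolding act_def using vec_subspace_image[OF V(2)] vec_dim_image[OF assms(2)] V(3) by metis
  ultimately show ?thesis unfolding flags_def by blast
qed

lemma act_inv: "det g \<noteq> 0 \<Longrightarrow> act g V = V' \<longleftrightarrow> V = act (matrix_inv g) V'"
  by (metis act_act act_one matrix_inv_left matrix_inv_right)

abbreviation "std_flag \<equiv> coord_flag id"

lemma std_flag_eq: "std_flag i = coords {..i}"
  by (simp add: coord_flag_eq)

lemma std_flag_in_flags: "std_flag \<in> flags"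
  by (rule coord_flag_in_flags) simp

lemma upper_tri_preserves:
  assumes "p \<in> upper_tri" "x \<in> coords {..i}"
  shows "p *v x \<in> coords {..i}"
proof -
  have "p $ j $ k * x $ k = 0" if "\<not> j \<le> i" for j k
  proof (cases "k \<le> i")
    case True
    then have "k < j" using that by simp
    then show ?thesis using assms(1) by (simp add: upper_tri_def)
  next
    case False
    then show ?thesis using assms(2) by (simp add: coords_def)
  qed
  then have "(p *v x) $ j = 0" if "\<not> j \<le> i" for j
    unfolding matrix_vector_mult_def using that by (simp only: vec_lambda_beta) (intro sum.neutral ballI)
  then show ?thesis by (simp add: coords_def)
qed

lemma matrix_vector_axis: "(p *v axis j 1) $ i = p $ i $ j" for p :: "'n::finite cmat"
  by (simp add: matrix_vector_mult_def axis_def if_distrib cong: if_cong)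

lemma act_std_flag_iff:
  assumes "det p \<noteq> 0"
  shows "act p std_flag = std_flag \<longleftrightarrow> p \<in> upper_tri"
proof
  assume "p \<in> upper_tri"
  then have "(\<lambda>x. p *v x) ` coords {..i} = coords {..i}" for i
    by (intro invariant_subspace_image assms subspace_coords upper_tri_preserves)
  then show "act p std_flag = std_flag" by (intro ext) (simp add: act_def std_flag_eq)
next
  assume eq: "act p std_flag = std_flag"
  have "p $ i $ j = 0" if "j < i" for i j
  proof -
    have "axis j 1 \<in> coords {..j}" by (simp add: coords_def axis_def)
    then have "p *v axis j 1 \<in> coords {..j}"
      using fun_cong[OF eq, of j] by (auto simp: act_def std_flag_eq)
    then show ?thesis using that by (simp add: coords_def matrix_vector_axis[symmetric] not_le)
  qed
  then show "p \<in> upper_tri" by (simp add: upper_tri_def)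
qed

lemma act_std_flag_eq_iff:
  assumes "det g \<noteq> 0" "det h \<noteq> 0"
  shows "act g std_flag = act h std_flag \<longleftrightarrow> matrix_inv h ** g \<in> upper_tri"
proof -
  have "act g std_flag = act h std_flag \<longleftrightarrow> act (matrix_inv h ** g) std_flag = std_flag"
    using act_inv[OF assms(2), of std_flag "act g std_flag"] by (simp add: act_act) (metis act_act)
  then show ?thesis
    using act_std_flag_iff[of "matrix_inv h ** g"] assms det_matrix_inv_nz[of h] by (simp add: det_mul)
qed

text \<open>
  The \<open>i\<close>-th row of \<open>u' ** r\<close> only involves rows \<open>k \<le> i\<close> of \<open>r\<close>, and the rows with \<open>k < i\<close> are known by induction.
\<close>

lemma lower_upper_unique:
  assumes u: "u \<in> lower_unitriangular" and u': "u' \<in> lower_unitriangular"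
    and r: "r \<in> upper_tri" and eq: "u' ** r = u"
  shows "u = u'" "r = mat 1"
proof -
  have "\<forall>j. r $ i $ j = (if i = j then 1 else 0)" for i
  proof (induction "pos i" arbitrary: i rule: less_induct)
    case less
    show ?case
    proof
      fix j
      have "u $ i $ j = (\<Sum>k\<in>UNIV. u' $ i $ k * r $ k $ j)"
        using eq by (auto simp: matrix_matrix_mult_def)
      also have "\<dots> = (\<Sum>k\<in>UNIV. (if k = i then r $ i $ j else 0) + (if k = j \<and> j < i then u' $ i $ j else 0))"
      proof (intro sum.cong refl)
        fix k
        consider "k < i" | "k = i" | "i < k" by (rule linorder_cases)
        then show "u' $ i $ k * r $ k $ j =
            (if k = i then r $ i $ j else 0) + (if k = j \<and> j < i then u' $ i $ j else 0)"
        proof cases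
          case 1
          then have "r $ k $ j = (if k = j then 1 else 0)" using less[of k] by (simp add: pos_less)
          then show ?thesis using 1 by auto
        next
          case 2
          then show ?thesis using u' by (auto simp: lower_unitriangular_def)
        next
          case 3
          then show ?thesis using u' by (auto simp: lower_unitriangular_def)
        qed
      qed
      also have "\<dots> = r $ i $ j + (if j < i then u' $ i $ j else 0)"
        by (simp add: sum.distrib)
      finally have *: "u $ i $ j = r $ i $ j + (if j < i then u' $ i $ j else 0)" .
      consider "j < i" | "j = i" | "i < j" by (rule linorder_cases)
      then show "r $ i $ j = (if i = j then 1 else 0)"
      proof cases
        case 1
        then show ?thesis using r by (auto simp: upper_tri_def)
      next
        case 2
        then show ?thesis using * u by (simp add: lower_unitriangular_def)
      next
        case 3
        then have "\<not> j < i" "i \<noteq> j" by auto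
        then show ?thesis using * u 3 by (simp add: lower_unitriangular_def)
      qed
    qed
  qed
  then show "r = mat 1" by (simp add: mat_def vec_eq_iff)
  with eq show "u = u'" by simp
qed

lemma chart_inject:
  assumes "det g \<noteq> 0" "u \<in> lower_unitriangular" "u' \<in> lower_unitriangular" "chart g u = chart g u'"
  shows "u = u'"
proof -
  have d: "det u \<noteq> 0" "det u' \<noteq> 0" using det_lower_unitriangular[OF assms(2)] det_lower_unitriangular[OF assms(3)] by auto
  have "act g (act u std_flag) = act g (act u' std_flag)" using assms(4) by (simp add: chart_def act_act)
  then have "act u std_flag = act u' std_flag"
    using act_inv[OF assms(1)] by metis
  then have "matrix_inv u' ** u \<in> upper_tri" using act_std_flag_eq_iff d by blast
  moreover have "u' ** (matrix_inv u' ** u) = u" by (simp add: matrix_mul_assoc matrix_inv_right d)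
  ultimately show ?thesis using lower_upper_unique assms(2,3) by blast
qed

lemma continuous_on_matrix_mult [continuous_intros]:
  fixes f g :: "'a::topological_space \<Rightarrow> 'n::finite cmat"
  shows "continuous_on S f \<Longrightarrow> continuous_on S g \<Longrightarrow> continuous_on S (\<lambda>x. f x ** g x)"
  unfolding matrix_matrix_mult_def by (intro continuous_intros)

lemma continuous_on_det [continuous_intros]:
  fixes f :: "'a::topological_space \<Rightarrow> 'n::finite cmat"
  shows "continuous_on S f \<Longrightarrow> continuous_on S (\<lambda>x. det (f x))"
  unfolding det_def by (intro continuous_intros)

text \<open>
  A matrix \<open>X\<close> encodes the pair of triangular matrices \<open>lo X\<close> and \<open>up X\<close>, so that pairs of triangular factors are
  parametrized by a space of the same dimension as the space of all matrices.
\<close>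

definition lo :: "('n::{finite,linorder}) cmat \<Rightarrow> 'n cmat" where
  "lo X = (\<chi> i j. if i = j then 1 else if j < i then X $ i $ j else 0)"

definition up :: "('n::{finite,linorder}) cmat \<Rightarrow> 'n cmat" where
  "up X = (\<chi> i j. if j < i then 0 else X $ i $ j)"

lemma lo_lower: "lo X \<in> lower_unitriangular" and up_upper: "up X \<in> upper_tri"
  by (auto simp: lo_def up_def lower_unitriangular_def upper_tri_def)

lemma continuous_on_lo [continuous_intros]: "continuous_on S lo"
proof -
  have "continuous_on S (\<lambda>X::'a cmat. if i = j then 1 else if j < i then X $ i $ j else 0)" for i j :: 'a
    by (cases "i = j"; cases "j < i") (auto intro!: continuous_intros)
  then show ?thesis unfolding lo_def by (intro continuous_on_vec_lambda)
qed

lemma continuous_on_up [continuous_intros]: "continuous_on S up"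
proof -
  have "continuous_on S (\<lambda>X::'a cmat. if j < i then 0 else X $ i $ j)" for i j :: 'a
    by (cases "j < i") (auto intro!: continuous_intros)
  then show ?thesis unfolding up_def by (intro continuous_on_vec_lambda)
qed

lemma upper_tri_mult_inv:
  assumes "p \<in> upper_tri" "q \<in> upper_tri" "det p \<noteq> 0" "det q \<noteq> 0"
  shows "p ** matrix_inv q \<in> upper_tri"
proof -
  have "act q std_flag = std_flag" "act p std_flag = std_flag" using assms by (simp_all add: act_std_flag_iff)
  then have "act (p ** matrix_inv q) std_flag = std_flag"
    using act_inv[OF assms(4), of std_flag std_flag] by (metis act_act)
  then show ?thesis using assms det_matrix_inv_nz[of q] by (simp add: act_std_flag_iff det_mul)
qed

text \<open>
  Multiplication of a lower unitriangular by an invertible upper triangular matrix is a continuous injection from an open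
  subset of the space of matrices into that space. By invariance of domain it is open, so explicit formulas for the
  triangular factors are unnecessary.
\<close>

lemma open_chart_image:
  fixes g :: "('n::{finite,linorder}) cmat"
  assumes g: "g \<in> SL_C" and T: "open T"
  shows "openin flag_topology (chart g ` (lower_unitriangular \<inter> T))"
proof -
  define \<Omega> where "\<Omega> = {X :: 'n cmat. det (up X) \<noteq> 0 \<and> lo X \<in> T}"
  define \<phi> where "\<phi> = (\<lambda>X :: 'n cmat. g ** (lo X ** up X))"
  have dg: "det g = 1" using g by (simp add: SL_C_def)
  have "open \<Omega>"
  proof -
    have "open {X :: 'n cmat. det (up X) \<noteq> 0}"
      by (intro open_Collect_neq continuous_intros)
    moreover have "open {X :: 'n cmat. lo X \<in> T}"
      using continuous_open_vimage[OF T, of lo] continuous_on_lo[of "UNIV :: 'n cmat set"]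
      by (simp add: vimage_def continuous_on_eq_continuous_at)
    ultimately show ?thesis unfolding \<Omega>_def by (auto simp: Collect_conj_eq)
  qed
  moreover have "continuous_on \<Omega> \<phi>" unfolding \<phi>_def by (intro continuous_intros)
  moreover have "inj_on \<phi> \<Omega>"
  proof (rule inj_onI)
    fix X Y assume XY: "X \<in> \<Omega>" "Y \<in> \<Omega>" "\<phi> X = \<phi> Y"
    have d: "det (up X) \<noteq> 0" "det (up Y) \<noteq> 0" using XY by (auto simp: \<Omega>_def)
    have "matrix_inv g ** \<phi> X = matrix_inv g ** \<phi> Y" using XY by simp
    then have e: "lo X ** up X = lo Y ** up Y"
      unfolding \<phi>_def by (simp add: matrix_mul_assoc matrix_inv_left dg)
    then have "lo X ** (up X ** matrix_inv (up Y)) = lo Y ** (up Y ** matrix_inv (up Y))"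
      by (simp add: matrix_mul_assoc)
    then have e2: "lo X ** (up X ** matrix_inv (up Y)) = lo Y" by (simp add: matrix_inv_right d)
    have r: "up X ** matrix_inv (up Y) \<in> upper_tri" by (intro upper_tri_mult_inv up_upper d)
    have l: "lo Y = lo X" "up X ** matrix_inv (up Y) = mat 1"
      by (rule lower_upper_unique[OF lo_lower lo_lower r e2])+
    have "up X = up X ** (matrix_inv (up Y) ** up Y)" by (simp add: matrix_inv_left d)
    then have u: "up X = up Y" by (simp add: matrix_mul_assoc l)
    have "X $ i $ j = Y $ i $ j" for i j
    proof (cases "j < i")
      case True
      then have "X $ i $ j = lo X $ i $ j" "Y $ i $ j = lo Y $ i $ j" by (auto simp: lo_def)
      then show ?thesis using l by simp
    next
      case False
      then have "X $ i $ j = up X $ i $ j" "Y $ i $ j = up Y $ i $ j" by (auto simp: up_def)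
      then show ?thesis using u by simp
    qed
    then show "X = Y" by (simp add: vec_eq_iff)
  qed
  ultimately have "open (\<phi> ` \<Omega>)" by (intro invariance_of_domain)
  moreover have "{h \<in> SL_C. act h std_flag \<in> chart g ` (lower_unitriangular \<inter> T)} = SL_C \<inter> \<phi> ` \<Omega>"
  proof (intro equalityI subsetI)
    fix h assume "h \<in> {h \<in> SL_C. act h std_flag \<in> chart g ` (lower_unitriangular \<inter> T)}"
    then obtain u where h: "h \<in> SL_C" and u: "u \<in> lower_unitriangular" "u \<in> T"
      and e: "act h std_flag = act (g ** u) std_flag" by (auto simp: chart_def)
    have d: "det h = 1" "det (g ** u) = 1"
      using h dg det_lower_unitriangular[OF u(1)] by (auto simp: SL_C_def det_mul)
    define p where "p = matrix_inv (g ** u) ** h"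
    have p: "p \<in> upper_tri" using e d unfolding p_def by (subst act_std_flag_eq_iff[symmetric]) auto
    have h2: "h = g ** (u ** p)"
      using d unfolding p_def by (metis matrix_inv_right matrix_mul_assoc matrix_mul_lid zero_neq_one)
    have dp: "det p \<noteq> 0" using d dg h2 by (auto simp: det_mul)
    define X where "X = (\<chi> i j. if j < i then u $ i $ j else p $ i $ j)"
    have "lo X = u" using u(1) by (auto simp: lo_def X_def vec_eq_iff lower_unitriangular_def)
    moreover have "up X = p" using p by (auto simp: up_def X_def vec_eq_iff upper_tri_def)
    ultimately show "h \<in> SL_C \<inter> \<phi> ` \<Omega>"
      using h h2 u dp unfolding \<phi>_def \<Omega>_def by blast
  next
    fix h assume "h \<in> SL_C \<inter> \<phi> ` \<Omega>"
    then obtain X where X: "h \<in> SL_C" "det (up X) \<noteq> 0" "lo X \<in> T" "h = g ** (lo X ** up X)"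
      unfolding \<phi>_def \<Omega>_def by blast
    have "act (up X) std_flag = std_flag" using X up_upper by (simp add: act_std_flag_iff)
    then have "act h std_flag = chart g (lo X)" unfolding X(4) chart_def by (metis act_act matrix_mul_assoc)
    then show "h \<in> {h \<in> SL_C. act h std_flag \<in> chart g ` (lower_unitriangular \<inter> T)}"
      using X lo_lower by blast
  qed
  moreover have "chart g ` (lower_unitriangular \<inter> T) \<subseteq> flags"
    using dg by (auto simp: chart_def det_mul det_lower_unitriangular intro!: act_flags std_flag_in_flags)
  ultimately show ?thesis by (simp add: openin_flag_topology openin_open_Int)
qed

lemma topspace_flag_topology: "topspace flag_topology = (flags :: ('n::{finite,linorder}) flag set)"
proof
  show "topspace flag_topology \<subseteq> flags" unfolding topspace_def by (auto simp: openin_flag_topology)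
  have "{g \<in> SL_C. act g std_flag \<in> flags} = (SL_C :: 'n cmat set)"
    by (auto simp: SL_C_def intro!: act_flags std_flag_in_flags)
  then have "openin flag_topology (flags :: 'n flag set)" by (simp only: openin_flag_topology) simp
  then show "(flags :: 'n flag set) \<subseteq> topspace flag_topology" by (rule openin_subset)
qed

lemma continuous_map_act: "continuous_map (top_of_set SL_C) flag_topology (\<lambda>g. act g std_flag)"
proof -
  have "act g std_flag \<in> flags" if "g \<in> SL_C" for g :: "'a cmat"
    using that by (intro act_flags std_flag_in_flags) (simp add: SL_C_def)
  then show ?thesis
    by (simp add: continuous_map_def topspace_flag_topology openin_flag_topology)
qed

lemma chart_mem_SL: "g \<in> SL_C \<Longrightarrow> u \<in> lower_unitriangular \<Longrightarrow> g ** u \<in> SL_C"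
  by (simp add: SL_C_def det_mul det_lower_unitriangular)

lemma embedding_chart:
  assumes "g \<in> SL_C"
  shows "embedding_map (top_of_set lower_unitriangular) flag_topology (chart g)"
proof (rule injective_open_imp_embedding_map)
  have "continuous_map (top_of_set lower_unitriangular) (top_of_set SL_C) (\<lambda>u. g ** u)"
  proof -
    have "continuous_on lower_unitriangular (\<lambda>u. g ** u)" by (intro continuous_intros)
    moreover have "(\<lambda>u. g ** u) ` lower_unitriangular \<subseteq> SL_C" using chart_mem_SL[OF assms] by blast
    ultimately show ?thesis by (simp add: continuous_map_in_subtopology image_subset_iff_funcset)
  qed
  from continuous_map_compose[OF this continuous_map_act]
  show "continuous_map (top_of_set lower_unitriangular) flag_topology (chart g)"
    by (simp add: chart_def[abs_def] o_def)
  show "open_map (top_of_set lower_unitriangular) flag_topology (chart g)"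
    unfolding open_map_def using open_chart_image[OF assms] by (auto simp: openin_open)
  show "inj_on (chart g) (topspace (top_of_set lower_unitriangular))"
  proof (rule inj_onI)
    fix u u' assume "u \<in> topspace (top_of_set lower_unitriangular)"
      "u' \<in> topspace (top_of_set lower_unitriangular)" "chart g u = chart g u'"
    then show "u = u'" using assms by (intro chart_inject[of g]) (auto simp: SL_C_def)
  qed
qed

section \<open>Coordinate slices of charts\<close>

lemma scaleR_vec: "c *\<^sub>R x = complex_of_real c *s x" for x :: "complex^'k::finite"
  by (simp add: vec_eq_iff scaleR_conv_of_real[where 'a=complex])

lemma real_subspace: "vec.subspace W \<Longrightarrow> subspace W" for W :: "(complex^'k::finite) set"
  by (auto simp: subspace_def vec.subspace_def scaleR_vec)

text \<open>
  Adding a vector \<open>a\<close> to a complex basis adds the real plane of complex multiples of \<open>a\<close> to the span.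
\<close>

lemma real_dim_vec_span:
  fixes B :: "(complex^'k::finite) set"
  assumes "finite B" "vec.independent B"
  shows "dim (vec.span B) = 2 * card B"
  using assms
proof (induction B rule: finite_induct)
  case empty
  then show ?case by simp
next
  case (insert a B)
  have ind: "vec.independent B" "a \<notin> vec.span B"
    using insert.prems insert.hyps by (auto simp: vec.independent_insert)
  let ?l = "range (\<lambda>c. c *s a)"
  have l: "vec.subspace ?l"
    unfolding vec.subspace_def
  proof (intro conjI ballI allI)
    show "0 \<in> ?l" by (rule range_eqI[of _ _ 0]) simp
    fix x y assume "x \<in> ?l" "y \<in> ?l"
    then obtain c d where "x = c *s a" "y = d *s a" by blast
    then show "x + y \<in> ?l" by (intro range_eqI[of _ _ "c + d"]) (simp add: vec.scale_left_distrib)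
  next
    fix c x assume "x \<in> ?l"
    then obtain d where "x = d *s a" by blast
    then show "c *s x \<in> ?l" by (intro range_eqI[of _ _ "c * d"]) simp
  qed
  have "a \<noteq> 0" using ind vec.span_zero by blast
  then have "inj (\<lambda>c. c *s a)" by (auto simp: inj_def)
  moreover have lin: "linear (\<lambda>c. c *s a)"
    by (rule linearI) (simp_all add: vec.scale_left_distrib vec_eq_iff scaleR_conv_of_real[where 'a=complex])
  ultimately have "dim ?l = dim (UNIV :: complex set)"
    by (intro dim_image_eq) (auto simp: inj_on_def inj_def)
  then have dl: "dim ?l = 2" by simp
  have "vec.span (insert a B) = {x + y |x y. x \<in> ?l \<and> y \<in> vec.span B}"
  proof (intro equalityI subsetI)
    fix z assume "z \<in> vec.span (insert a B)"
    then obtain k where "z - k *s a \<in> vec.span B" by (auto simp: vec.span_insert)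
    then show "z \<in> {x + y |x y. x \<in> ?l \<and> y \<in> vec.span B}"
      by (intro CollectI exI[of _ "k *s a"] exI[of _ "z - k *s a"]) auto
  next
    fix z assume "z \<in> {x + y |x y. x \<in> ?l \<and> y \<in> vec.span B}"
    then obtain k y where "z = k *s a + y" "y \<in> vec.span B" by blast
    then show "z \<in> vec.span (insert a B)"
      by (auto simp: vec.span_insert intro!: exI[of _ k])
  qed
  moreover have "?l \<inter> vec.span B = {0}"
  proof -
    have "k = 0" if "k *s a \<in> vec.span B" for k
    proof (rule ccontr)
      assume "k \<noteq> 0"
      then have "a = inverse k *s (k *s a)" by simp
      then have "a \<in> vec.span B" using that by (metis vec.span_scale)
      then show False using ind by blast
    qed
    then show ?thesis using vec.span_zero[of B] l by (auto simp: vec.subspace_def)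
  qed
  moreover have "dim {x + y |x y. x \<in> ?l \<and> y \<in> vec.span B} + dim (?l \<inter> vec.span B) = dim ?l + dim (vec.span B)"
    by (intro dim_sums_Int real_subspace l vec.subspace_span)
  ultimately have "dim (vec.span (insert a B)) = 2 + dim (vec.span B)" using dl by simp
  then show ?case using insert.IH[OF ind(1)] insert.hyps by simp
qed

lemma real_dim_eq: "vec.subspace W \<Longrightarrow> dim W = 2 * vec.dim W" for W :: "(complex^'k::finite) set"
proof -
  assume W: "vec.subspace W"
  obtain B where B: "B \<subseteq> W" "vec.independent B" "W \<subseteq> vec.span B" "card B = vec.dim W"
    by (rule vec.basis_exists)
  have "vec.span B = W" using B W by (intro subset_antisym vec.span_minimal) auto
  then show "dim W = 2 * vec.dim W" using real_dim_vec_span[of B] B vec.finiteI_independent by metis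
qed

text \<open>
  Lower unitriangular matrices whose entries below the diagonal are free at the places in \<open>P\<close> and vanish elsewhere.
  \<open>fill\<close> and \<open>unfill\<close> identify them with a linear coordinate space, of the type that the definition of
  submanifolds requires.
\<close>

definition slots :: "('n::{finite,linorder} \<times> 'n) set \<Rightarrow> 'n cmat set" where
  "slots P = {u. (\<forall>i. u $ i $ i = 1) \<and> (\<forall>i j. i \<noteq> j \<longrightarrow> (i, j) \<notin> P \<longrightarrow> u $ i $ j = 0)}"

definition slot_space :: "('n::finite \<times> 'n) set \<Rightarrow> (complex^('n \<times> 'n)) set" where
  "slot_space P = {x. \<forall>p. p \<notin> P \<longrightarrow> x $ p = 0}"

definition fill :: "complex^('n \<times> 'n) \<Rightarrow> ('n::finite) cmat" where
  "fill x = (\<chi> i j. (if i = j then 1 else 0) + x $ (i, j))"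

definition unfill :: "('n \<times> 'n) set \<Rightarrow> ('n::finite) cmat \<Rightarrow> complex^('n \<times> 'n)" where
  "unfill P u = (\<chi> p. if p \<in> P then u $ fst p $ snd p else 0)"

lemma slot_space: "vec.subspace (slot_space P)" "vec.dim (slot_space P) = card P"
  unfolding slot_space_def by (simp add: vec.subspace_def) (rule dim_substandard_cart)

lemma unfill_mem: "unfill P u \<in> slot_space P"
  by (simp add: unfill_def slot_space_def)

context
  fixes P :: "('n::{finite,linorder} \<times> 'n) set"
  assumes below: "P \<subseteq> {(i, j). j < i}"
begin

lemma slots_lower: "slots P \<subseteq> lower_unitriangular"
proof
  fix u assume u: "u \<in> slots P"
  have "u $ i $ j = 0" if "i < j" for i j
  proof -
    have "i \<noteq> j" "(i, j) \<notin> P" using that below by (auto dest: order.asym)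
    then show ?thesis using u by (simp add: slots_def)
  qed
  then show "u \<in> lower_unitriangular" using u by (simp add: slots_def lower_unitriangular_def)
qed

lemma fill_mem: "x \<in> slot_space P \<Longrightarrow> fill x \<in> slots P"
  using below by (auto simp: fill_def slots_def slot_space_def)

lemma unfill_fill: "x \<in> slot_space P \<Longrightarrow> unfill P (fill x) = x"
  using below by (auto simp: vec_eq_iff fill_def unfill_def slot_space_def)

lemma fill_unfill: "u \<in> slots P \<Longrightarrow> fill (unfill P u) = u"
  using below by (auto simp: vec_eq_iff fill_def unfill_def slots_def)

lemma fill_image: "fill ` slot_space P = slots P"
proof
  show "fill ` slot_space P \<subseteq> slots P" using fill_mem by blast
  show "slots P \<subseteq> fill ` slot_space P"
  proof
    fix u assume "u \<in> slots P"
    then have "u = fill (unfill P u)" by (simp add: fill_unfill)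
    then show "u \<in> fill ` slot_space P" using unfill_mem by blast
  qed
qed

end

lemma continuous_on_unfill: "continuous_on S (unfill P)"
proof -
  have "continuous_on S (\<lambda>u::'a cmat. if p \<in> P then u $ fst p $ snd p else 0)" for p
    by (cases "p \<in> P") (auto intro!: continuous_intros)
  then show ?thesis unfolding unfill_def by (intro continuous_on_vec_lambda)
qed

lemma continuous_on_fill: "continuous_on S fill"
  unfolding fill_def by (intro continuous_intros)

definition to_mat :: "complex^('n \<times> 'n) \<Rightarrow> ('n::finite) cmat" where
  "to_mat x = (\<chi> i j. x $ (i, j))"

lemma linear_to_mat: "linear to_mat"
  by (rule linearI) (simp_all add: vec_eq_iff to_mat_def)

lemma chart_in_flags: "g \<in> SL_C \<Longrightarrow> u \<in> lower_unitriangular \<Longrightarrow> chart g u \<in> flags"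
  unfolding chart_def by (intro act_flags std_flag_in_flags) (simp add: SL_C_def det_mul det_lower_unitriangular)

text \<open>
  The parametrization \<open>fill\<close> is affine with the continuous left inverse \<open>unfill P\<close>, so it is an embedding.
\<close>

lemma complex_submanifold_slots:
  assumes g: "g \<in> SL_C" and P: "P \<subseteq> {(i, j :: 'n::{finite,linorder}). j < i}"
  shows "complex_submanifold (card P) (chart g ` slots P)"
proof -
  have im: "(chart g \<circ> fill) ` slot_space P = chart g ` slots P"
    by (simp only: image_comp[symmetric] fill_image[OF P])
  have sub: "chart g ` slots P \<subseteq> flags"
    using chart_in_flags[OF g] slots_lower[OF P] by blast
  have "\<exists>ga\<in>SL_C. \<exists>(W :: (complex^('n \<times> 'n)) set) U f.
        vec.subspace W \<and> vec.dim W = card P \<and> openin (top_of_set W) U \<and>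
        f ` U \<subseteq> lower_unitriangular \<and> holomorphic_immersion_on W U f \<and>
        embedding_map (top_of_set U) flag_topology (chart ga \<circ> f) \<and>
        V \<in> (chart ga \<circ> f) ` U \<and>
        openin (subtopology flag_topology (chart g ` slots P)) ((chart ga \<circ> f) ` U)"
    if V: "V \<in> chart g ` slots P" for V
  proof (intro bexI[OF _ g] exI[of _ "slot_space P"] exI[of _ fill] conjI)
    show "vec.subspace (slot_space P)" "vec.dim (slot_space P) = card P" by (rule slot_space)+
    show "openin (top_of_set (slot_space P)) (slot_space P)" by simp
    show "fill ` slot_space P \<subseteq> lower_unitriangular"
      using slots_lower[OF P] by (simp only: fill_image[OF P])
    show "holomorphic_immersion_on (slot_space P) (slot_space P) fill"
      unfolding holomorphic_immersion_on_def
    proof (intro ballI exI conjI allI)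
      fix x :: "complex^('n \<times> 'n)"
      have "(\<lambda>x :: complex^('n \<times> 'n). mat 1 + to_mat x) = fill"
        by (simp add: fun_eq_iff fill_def vec_eq_iff mat_def to_mat_def)
      moreover have "((\<lambda>x. mat 1 + to_mat x) has_derivative to_mat) (at x within slot_space P)"
        using has_derivative_add[OF has_derivative_const[of "mat 1"]
            bounded_linear_imp_has_derivative[OF linear_to_mat[unfolded linear_conv_bounded_linear]]] by simp
      ultimately show "(fill has_derivative to_mat) (at x within slot_space P)" by simp
      show "to_mat (c *s v) $ i $ j = c * to_mat v $ i $ j" for c v i j by (simp add: to_mat_def)
      show "inj_on to_mat (slot_space P)" by (auto simp: inj_on_def vec_eq_iff to_mat_def)
    qed
    have "retraction_maps (top_of_set lower_unitriangular) (top_of_set (slot_space P)) (unfill P) fill"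
      unfolding retraction_maps_def
      using fill_mem[OF P] slots_lower[OF P] unfill_mem unfill_fill[OF P] continuous_on_unfill continuous_on_fill
      by (auto simp: continuous_map_in_subtopology)
    then have "embedding_map (top_of_set (slot_space P)) (top_of_set lower_unitriangular) fill"
      by (intro section_imp_embedding_map) (auto simp: section_map_def)
    then show "embedding_map (top_of_set (slot_space P)) flag_topology (chart g \<circ> fill)"
      by (rule embedding_map_compose) (rule embedding_chart[OF g])
    show "V \<in> (chart g \<circ> fill) ` slot_space P" unfolding im by (rule V)
    have "topspace (subtopology flag_topology (chart g ` slots P)) = chart g ` slots P"
      using sub by (simp add: topspace_flag_topology Int_absorb1)
    then have "openin (subtopology flag_topology (chart g ` slots P)) (chart g ` slots P)"
      by (metis openin_topspace)
    then show "openin (subtopology flag_topology (chart g ` slots P)) ((chart g \<circ> fill) ` slot_space P)"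
      unfolding im .
  qed
  with sub show ?thesis unfolding complex_submanifold_def by blast
qed

text \<open>Invariance of domain bounds the dimension of anything that maps injectively into a slice.\<close>

lemma dim_le_slots:
  fixes W :: "(complex^'k::finite) set" and f :: "complex^'k \<Rightarrow> 'n::{finite,linorder} cmat"
  assumes W: "vec.subspace W" "openin (top_of_set W) U" "U \<noteq> {}"
    and f: "continuous_on U f" "inj_on f U" "f ` U \<subseteq> slots P" and P: "P \<subseteq> {(i, j). j < i}"
  shows "vec.dim W \<le> card P"
proof -
  have "dim W \<le> dim (slot_space P)"
  proof (rule invariance_of_dimension_subspaces[OF W(2)])
    show "subspace W" "subspace (slot_space P)" by (intro real_subspace W slot_space)+
    show "continuous_on U (unfill P \<circ> f)" by (intro continuous_on_compose f(1) continuous_on_unfill)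
    show "unfill P \<circ> f \<in> U \<rightarrow> slot_space P" using unfill_mem by auto
    show "inj_on (unfill P \<circ> f) U"
    proof (rule comp_inj_on[OF f(2)])
      have "inj_on (unfill P) (slots P)" by (rule inj_on_inverseI[of _ fill]) (rule fill_unfill[OF P])
      then show "inj_on (unfill P) (f ` U)" by (rule inj_on_subset) (rule f(3))
    qed
    show "U \<noteq> {}" by (rule W)
  qed
  then show ?thesis by (simp add: real_dim_eq W slot_space)
qed

text \<open>
  The maximum in the definition of \<open>cdim\<close> is meaningful only if the dimensions are bounded, which the last premise ensures.
\<close>

lemma cdim_eqI:
  assumes "M \<noteq> {}" "M \<subseteq> S" "complex_submanifold d M"
    and "\<And>M e. M \<noteq> {} \<Longrightarrow> M \<subseteq> S \<Longrightarrow> complex_submanifold e M \<Longrightarrow> e \<le> d"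
  shows "cdim S = d"
  unfolding cdim_def
proof (rule Max_eqI)
  show "finite {d. \<exists>M. M \<noteq> {} \<and> M \<subseteq> S \<and> complex_submanifold d M}"
    by (rule finite_subset[of _ "{..d}"]) (use assms(4) in auto)
qed (use assms in auto)

lemma complex_submanifold_chart:
  fixes M :: "('n::{finite,linorder}) flag set"
  assumes "complex_submanifold d M" "V \<in> M"
  obtains g and W :: "(complex^('n \<times> 'n)) set" and U f x where
    "g \<in> SL_C" "vec.subspace W" "vec.dim W = d" "openin (top_of_set W) U" "f ` U \<subseteq> lower_unitriangular"
    "holomorphic_immersion_on W U f" "embedding_map (top_of_set U) flag_topology (chart g \<circ> f)"
    "x \<in> U" "V = chart g (f x)" "openin (subtopology flag_topology M) ((chart g \<circ> f) ` U)"
  using assms(1) unfolding complex_submanifold_def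
  apply (elim conjE)
  apply (drule bspec[OF _ assms(2)])
  apply (elim bexE exE conjE imageE)
  subgoal for g W U f x
    by (rule that[of g W U f x]; (assumption | simp only: o_apply))
  done

lemma continuous_on_immersion:
  assumes "holomorphic_immersion_on W U f" "U \<subseteq> W"
  shows "continuous_on U f"
proof -
  have "continuous (at x within W) f" if "x \<in> U" for x
    using assms(1) that unfolding holomorphic_immersion_on_def by (meson has_derivative_continuous)
  then have "continuous (at x within U) f" if "x \<in> U" for x
    using that assms(2) by (meson continuous_within_subset)
  then show ?thesis by (simp add: continuous_on_eq_continuous_within)
qed

text \<open>
  In each chart, a submanifold of dimension \<open>e\<close> provides a continuous injection of an open subset of \<open>\<complex>\<^sup>e\<close> into the
  lower unitriangular matrices.
\<close>

lemma cdim_flags: "cdim (flags :: ('n::{finite,linorder}) flag set) = card {(i, j :: 'n). j < i}"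
proof (rule cdim_eqI)
  let ?P = "{(i, j :: 'n). j < i}"
  have one: "(mat 1 :: 'n cmat) \<in> SL_C" by (simp add: SL_C_def det_I)
  show sub: "complex_submanifold (card ?P) (chart (mat 1) ` slots ?P)"
    by (rule complex_submanifold_slots[OF one]) simp
  then show "chart (mat 1) ` slots ?P \<subseteq> flags" by (simp add: complex_submanifold_def)
  have "mat 1 \<in> slots ?P" by (simp add: slots_def mat_def)
  then show "chart (mat 1) ` slots ?P \<noteq> {}" by blast
  fix M e assume M: "(M :: 'n flag set) \<noteq> {}" "complex_submanifold e M"
  then obtain V where "V \<in> M" by blast
  then obtain g and W :: "(complex^('n \<times> 'n)) set" and U f x where
    c: "g \<in> SL_C" "vec.subspace W" "vec.dim W = e" "openin (top_of_set W) U" "f ` U \<subseteq> lower_unitriangular"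
    "holomorphic_immersion_on W U f" "embedding_map (top_of_set U) flag_topology (chart g \<circ> f)"
    "x \<in> U" "V = chart g (f x)" "openin (subtopology flag_topology M) ((chart g \<circ> f) ` U)"
    by (rule complex_submanifold_chart[OF M(2)]) blast
  have "vec.dim W \<le> card ?P"
  proof (rule dim_le_slots[OF c(2,4)])
    show "continuous_on U f" using continuous_on_immersion[OF c(6)] c(4) openin_imp_subset by blast
    have "inj_on (chart g \<circ> f) U"
      using c(7) by (auto simp: embedding_map_def dest: homeomorphic_imp_injective_map)
    then show "inj_on f U" by (rule inj_on_imageI2)
    show "U \<noteq> {}" using c(8) by blast
    show "?P \<subseteq> {(i, j). j < i}" by (rule subset_refl)
    have "lower_unitriangular \<subseteq> slots ?P"
    proof
      fix u :: "'n cmat" assume u: "u \<in> lower_unitriangular"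
      have "u $ i $ j = 0" if "i \<noteq> j" "\<not> j < i" for i j
        using u that linorder_neqE[of i j] unfolding lower_unitriangular_def by blast
      then show "u \<in> slots ?P" using u by (simp add: slots_def lower_unitriangular_def)
    qed
    then show "f ` U \<subseteq> slots ?P" using c(5) by blast
  qed
  then show "e \<le> card ?P" using c(3) by simp
qed

lemma flagsD:
  fixes V :: "('n::{finite,linorder}) flag"
  assumes "V \<in> flags"
  shows "mono V" "vec.subspace (V i)" "vec.dim (V i) = pos i"
  using assms unfolding flags_def pos_def by blast+

section \<open>Bruhat decomposition\<close>

definition top_index :: "complex^('n::{finite,linorder}) \<Rightarrow> 'n::{finite,linorder}" where
  "top_index x = Max {j. x $ j \<noteq> 0}"

lemma top_index:
  fixes x :: "complex^('n::{finite,linorder})"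
  assumes "x \<noteq> 0"
  shows "x $ top_index x \<noteq> 0" "top_index x < j \<Longrightarrow> x $ j = 0"
proof -
  have "{j. x $ j \<noteq> 0} \<noteq> {}" using assms by (auto simp: vec_eq_iff)
  then have "top_index x \<in> {j. x $ j \<noteq> 0}" unfolding top_index_def by (intro Max_in) simp
  then show "x $ top_index x \<noteq> 0" by simp
  show "x $ j = 0" if "top_index x < j"
  proof (rule ccontr)
    assume "x $ j \<noteq> 0"
    then have "j \<le> top_index x" unfolding top_index_def by (intro Max_ge) auto
    with that show False by simp
  qed
qed

lemma top_index_less:
  fixes x :: "complex^('n::{finite,linorder})"
  assumes "x \<noteq> 0" "\<And>k. j \<le> k \<Longrightarrow> x $ k = 0"
  shows "top_index x < j"
  using assms top_index(1)[OF assms(1)] by (meson not_le)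

definition unipotent :: "('n::{finite,linorder}) cmat set" where
  "unipotent = {b \<in> upper_tri. \<forall>i. b $ i $ i = 1}"

lemma unipotent_Borel: "unipotent \<subseteq> Borel"
  by (auto simp: unipotent_def Borel_def SL_C_def upper_tri_def det_upper_tri[unfolded upper_tri_def mem_Collect_eq])

lemma Borel_upper: "b \<in> Borel \<Longrightarrow> b \<in> upper_tri \<and> det b = 1"
  by (simp add: Borel_def upper_tri_def SL_C_def)

lemma act_coord_flag: "act b (coord_flag w) i = (\<lambda>x. b *v x) ` coords (w ` {..i})"
  by (simp add: act_def coord_flag_eq)

text \<open>
  For each \<open>i\<close> take a vector \<open>x i\<close> that lies in \<open>V i\<close> but in no smaller member, with the least possible last nonzero
  coordinate \<open>w i\<close>. If \<open>w i = w k\<close> for \<open>i < k\<close>, then subtracting a multiple of \<open>x i\<close> from \<open>x k\<close> would make that coordinate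
  smaller. So \<open>w\<close> is a permutation, and the normalized vectors \<open>x i\<close> are the columns of \<open>b\<close>.
\<close>

lemma bruhat_decomposition:
  fixes V :: "('n::{finite,linorder}) flag"
  assumes V: "V \<in> flags"
  obtains w b where "bij w" "b \<in> unipotent" "V = act b (coord_flag w)"
proof -
  define N where "N i = {x \<in> V i. x \<noteq> 0 \<and> (\<forall>k<i. x \<notin> V k)}" for i
  note mono = monoD[OF flagsD(1)[OF V]] and sub = flagsD(2)[OF V] and dim = flagsD(3)[OF V]
  have "N i \<noteq> {}" for i
  proof (cases "\<exists>k. k < i")
    case True
    then obtain k where k: "k < i" "pos k = pos i - 1"
    proof -
      have "pos i \<ge> 2" using True pos_range(1) pos_less
        by (metis One_nat_def Suc_1 Suc_leI le_less_trans)
      then have "1 \<le> pos i - 1" "pos i - 1 \<le> CARD('n)" using pos_range(2)[of i] by linarith+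
      then obtain k :: 'n where "pos k = pos i - 1" using ex_pos by blast
      then show ?thesis using that[of k] \<open>pos i \<ge> 2\<close> by (metis pos_less diff_less less_le_trans zero_less_numeral zero_less_one)
    qed
    have "V k \<noteq> V i" using dim[of k] dim[of i] pos_less[of k i] k(1) by (metis less_irrefl)
    then obtain x where x: "x \<in> V i" "x \<notin> V k" using mono[OF less_imp_le[OF k(1)]] by blast
    have "x \<notin> V l" if "l < i" for l
    proof -
      have "pos l \<le> pos k" using that k(2) pos_less[of l i] by linarith
      then have "l \<le> k" by (simp add: pos_le)
      then show ?thesis using mono[of l k] x(2) by blast
    qed
    moreover have "x \<noteq> 0" using x(2) vec.subspace_0[OF sub[of k]] by blast
    ultimately show ?thesis using x(1) unfolding N_def by blast
  next
    case False
    have "V i \<noteq> {0}" using dim[of i] pos_range(1)[of i] vec.dim_eq_0[of "V i"] by fastforce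
    then obtain x where "x \<in> V i" "x \<noteq> 0" using vec.subspace_0[OF sub[of i]] by blast
    then show ?thesis using False unfolding N_def by blast
  qed
  define w where "w i = Min (top_index ` N i)" for i
  have "\<exists>x\<in>N i. top_index x = w i" for i
    unfolding w_def using Min_in[of "top_index ` N i"] \<open>N i \<noteq> {}\<close> by fastforce
  then obtain x where xN: "\<And>i. x i \<in> N i" and xw: "\<And>i. top_index (x i) = w i" by metis
  have x0: "x i \<noteq> 0" and xV: "x i \<in> V i" for i using xN[of i] unfolding N_def by blast+
  have wmin: "w i \<le> top_index y" if "y \<in> N i" for i y unfolding w_def using that by (intro Min_le) auto
  have neq: "w i \<noteq> w k" if "i < k" for i k
  proof
    assume eq: "w i = w k"
    have a: "x i $ w i \<noteq> 0" "x k $ w k \<noteq> 0" using top_index(1)[OF x0] xw by metis+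
    define y where "y = x k - (x k $ w k / x i $ w i) *s x i"
    have "x i \<in> V k" using xV[of i] mono[OF less_imp_le[OF that]] by blast
    then have "y \<in> V k" unfolding y_def by (intro vec.subspace_diff vec.subspace_scale sub xV)
    moreover have "y \<notin> V l" if "l < k" for l
    proof
      assume "y \<in> V l"
      let ?m = "max i l"
      have "y \<in> V ?m" "x i \<in> V ?m" using \<open>y \<in> V l\<close> xV[of i] mono[OF max.cobounded2[where b=l and a=i]] mono[OF max.cobounded1[where a=i and b=l]] by blast+
      then have "y + (x k $ w k / x i $ w i) *s x i \<in> V ?m"
        by (intro vec.subspace_add vec.subspace_scale sub)
      then have "x k \<in> V ?m" by (simp add: y_def)
      moreover have "?m < k" using \<open>i < k\<close> \<open>l < k\<close> by simp
      ultimately show False using xN[of k] unfolding N_def by blast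
    qed
    moreover have "y \<noteq> 0"
    proof
      assume "y = 0"
      then have "x k = (x k $ w k / x i $ w i) *s x i" by (simp add: y_def)
      then have "x k \<in> V i" using xV[of i] vec.subspace_scale[OF sub[of i]] by metis
      then show False using xN[of k] \<open>i < k\<close> unfolding N_def by blast
    qed
    ultimately have yN: "y \<in> N k" unfolding N_def by blast
    have "y $ j = 0" if "w k \<le> j" for j
    proof (cases "j = w k")
      case True
      then show ?thesis using a eq by (simp add: y_def)
    next
      case False
      then have "w k < j" using that by simp
      then have "x k $ j = 0" "x i $ j = 0" using top_index(2)[OF x0] xw eq by metis+
      then show ?thesis by (simp add: y_def)
    qed
    then have "top_index y < w k" using \<open>y \<noteq> 0\<close> by (intro top_index_less)
    then show False using wmin[OF yN] by simp
  qed
  then have "inj w" unfolding inj_def by (metis linorder_neqE)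
  then have bij: "bij w" by (simp add: bij_def finite_UNIV_inj_surj)
  define b where "b = (\<chi> r c. x (inv w c) $ r / x (inv w c) $ c)"
  have wi: "w (inv w c) = c" for c using bij by (simp add: bij_is_surj surj_f_inv_f)
  have top: "x (inv w c) $ c \<noteq> 0" "c < r \<Longrightarrow> x (inv w c) $ r = 0" for c r
    using top_index[OF x0[of "inv w c"]] xw[of "inv w c"] wi[of c] by auto
  have bU: "b \<in> unipotent"
    by (auto simp: unipotent_def upper_tri_def b_def top)
  then have db: "det b = 1" using unipotent_Borel Borel_upper by blast
  have fl: "act b (coord_flag w) \<in> flags"
    by (intro act_flags coord_flag_in_flags \<open>inj w\<close>) (simp add: db)
  have "act b (coord_flag w) i = V i" for i
  proof (rule vec.subspace_dim_equal)
    show "vec.subspace (act b (coord_flag w) i)" "vec.subspace (V i)" by (intro flagsD(2) fl sub)+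
    show "vec.dim (V i) \<le> vec.dim (act b (coord_flag w) i)" by (simp add: flagsD(3)[OF fl] dim)
    have "b *v axis (w j) 1 = (1 / x j $ w j) *s x j" for j
      by (simp add: vec_eq_iff matrix_vector_axis b_def \<open>inj w\<close>)
    then have "b *v axis (w j) 1 \<in> V i" if "j \<le> i" for j
      using xV[of j] mono[OF that] by (auto intro: vec.subspace_scale[OF sub])
    then have "vec.span ((\<lambda>x. b *v x) ` ((\<lambda>j. axis j 1) ` (w ` {..i}))) \<subseteq> V i"
      by (intro vec.span_minimal sub) auto
    moreover have "act b (coord_flag w) i = (\<lambda>x. b *v x) ` vec.span ((\<lambda>j. axis j 1) ` (w ` {..i}))"
      by (simp only: act_coord_flag span_axis_coords)
    moreover have "\<dots> = vec.span ((\<lambda>x. b *v x) ` ((\<lambda>j. axis j 1) ` (w ` {..i})))"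
      by (rule vec.linear_span_image[symmetric, OF matrix_vector_mul_linear_gen])
    ultimately show "act b (coord_flag w) i \<subseteq> V i" by simp
  qed
  then have "V = act b (coord_flag w)" by (simp add: fun_eq_iff)
  with bij bU show ?thesis by (rule that)
qed

text \<open>
  The matrix \<open>b\<close> preserves the spans of the first coordinate vectors, so the dimension can be read off from the coordinate flag.
\<close>

lemma cell_dim:
  fixes w :: "'n::{finite,linorder} \<Rightarrow> 'n"
  assumes "b \<in> Borel" "inj w"
  shows "vec.dim (act b (coord_flag w) i \<inter> coords {..x}) = rk w (pos i) {..x}"
proof -
  have b: "b \<in> upper_tri" "det b \<noteq> 0" using Borel_upper[OF assms(1)] by auto
  have "coords {..x} = (\<lambda>y. b *v y) ` coords {..x}"
    by (rule invariant_subspace_image[OF b(2) subspace_coords upper_tri_preserves[OF b(1)], symmetric])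
  then have "act b (coord_flag w) i \<inter> coords {..x} = (\<lambda>y. b *v y) ` (coords (w ` {..i}) \<inter> coords {..x})"
    unfolding act_coord_flag using inj_matrix[OF b(2), of UNIV] by (metis image_Int)
  also have "coords (w ` {..i}) \<inter> coords {..x} = coords (w ` {..i} \<inter> {..x})" by (auto simp: coords_def)
  also have "vec.dim ((\<lambda>y. b *v y) ` coords (w ` {..i} \<inter> {..x})) = card (w ` {..i} \<inter> {..x})"
    by (simp add: vec_dim_image b dim_coords)
  also have "w ` {..i} \<inter> {..x} = w ` {a. pos a \<le> pos i \<and> w a \<in> {..x}}" by (auto simp: pos_le)
  also have "card \<dots> = rk w (pos i) {..x}"
    unfolding rk_def by (rule card_image) (rule inj_on_subset[OF assms(2) subset_UNIV])
  finally show ?thesis .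
qed

lemma rk_le_all:
  fixes v w :: "'n::{finite,linorder} \<Rightarrow> 'n"
  assumes "bij v" "bij w" "\<And>i :: 'n. rk w (pos i) J \<le> rk v (pos i) J"
  shows "rk w t J \<le> rk v t J"
proof -
  have p: "1 \<le> pos a" for a :: 'n by (rule pos_range)
  consider "t = 0" | "1 \<le> t" "t \<le> CARD('n)" | "CARD('n) \<le> t" by linarith
  then show ?thesis
  proof cases
    case 1
    have "{a. pos a \<le> 0 \<and> w a \<in> J} = {}"
      using p by (metis (mono_tags, lifting) Collect_empty_eq not_one_le_zero le_zero_eq)
    then have "rk w 0 J = 0" by (simp only: rk_def card.empty)
    then show ?thesis using 1 by simp
  next
    case 2
    then obtain i :: 'n where "pos i = t" using ex_pos by blast
    then show ?thesis using assms(3)[of i] by simp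
  next
    case 3
    then show ?thesis using assms by (simp add: rk_top)
  qed
qed

section \<open>Bruhat cells as coordinate slices\<close>

definition perm_mat :: "('n \<Rightarrow> 'n) \<Rightarrow> ('n::finite) cmat" where
  "perm_mat w = (\<chi> r c. if r = w c then 1 else 0)"

definition diag :: "('n \<Rightarrow> complex) \<Rightarrow> ('n::finite) cmat" where
  "diag d = (\<chi> i j. if i = j then d i else 0)"

lemma diag_mult_left: "(diag d ** u) $ i $ j = d i * u $ i $ j"
  and diag_mult_right: "(u ** diag d) $ i $ j = u $ i $ j * d j" for u :: "'n::finite cmat"
  by (simp_all add: diag_def matrix_matrix_mult_def if_distrib if_distribR sum.delta cong: if_cong)

lemma diag_upper: "diag d \<in> upper_tri"
  by (auto simp: diag_def upper_tri_def)

lemma det_diag: "det (diag d) = (\<Prod>i\<in>UNIV. d i)" for d :: "'n::{finite,linorder} \<Rightarrow> complex"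
  by (subst det_upper_tri[OF diag_upper]) (simp add: diag_def)

lemma det_perm_mat: 
  fixes w :: "'n::finite \<Rightarrow> 'n"
  assumes "bij w" 
  shows "det (perm_mat w) \<noteq> 0"
proof -
  have "(perm_mat w ** transpose (perm_mat w)) $ r $ c = mat 1 $ r $ c" for r c
  proof -
    have "(perm_mat w ** transpose (perm_mat w)) $ r $ c =
        (\<Sum>k\<in>UNIV. (\<lambda>m. (if r = m then 1 else 0) * (if c = m then 1 else 0)) (w k))"
      by (simp only: perm_mat_def matrix_matrix_mult_def transpose_def vec_lambda_beta)
    also have "\<dots> = (\<Sum>m\<in>UNIV. (if r = m then 1 else 0) * (if c = m then 1 else 0))"
      by (rule sum.reindex_bij_betw[OF assms])
    also have "\<dots> = (\<Sum>m\<in>UNIV. if r = m then (if c = r then 1 else 0) else 0)"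
      by (rule sum.cong) auto
    also have "\<dots> = mat 1 $ r $ c" by (auto simp: mat_def)
    finally show ?thesis .
  qed
  then have "perm_mat w ** transpose (perm_mat w) = mat 1" by (simp add: vec_eq_iff)
  then have "det (perm_mat w) * det (transpose (perm_mat w)) = 1" by (metis det_mul det_I)
  then show ?thesis by auto
qed

lemma perm_mat_mult: "bij w \<Longrightarrow> (perm_mat w ** u) $ (w k) $ i = u $ k $ i"
  and mult_perm_mat: "(u ** perm_mat w) $ r $ c = u $ r $ w c" for u :: "'n::finite cmat"
proof -
  assume w: "bij w"
  have "(perm_mat w ** u) $ (w k) $ i = (\<Sum>m\<in>UNIV. if k = m then u $ m $ i else 0)"
    unfolding perm_mat_def matrix_matrix_mult_def vec_lambda_beta
    using w by (intro sum.cong) (auto simp: bij_is_inj inj_eq)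
  then show "(perm_mat w ** u) $ (w k) $ i = u $ k $ i" by simp
next
  have "(u ** perm_mat w) $ r $ c = (\<Sum>m\<in>UNIV. if m = w c then u $ r $ m else 0)"
    unfolding perm_mat_def matrix_matrix_mult_def vec_lambda_beta by (intro sum.cong) auto
  then show "(u ** perm_mat w) $ r $ c = u $ r $ w c" by simp
qed

lemma coord_flag_perm_mat:
  fixes w :: "'n::{finite,linorder} \<Rightarrow> 'n"
  assumes "bij w"
  shows "coord_flag w = act (perm_mat w) std_flag"
proof
  fix i
  have "act (perm_mat w) std_flag i = (\<lambda>x. perm_mat w *v x) ` vec.span ((\<lambda>j. axis j 1) ` {..i})"
    by (simp only: act_def std_flag_eq span_axis_coords)
  also have "\<dots> = vec.span ((\<lambda>x. perm_mat w *v x) ` (\<lambda>j. axis j 1) ` {..i})"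
    by (rule vec.linear_span_image[symmetric, OF matrix_vector_mul_linear_gen])
  also have "(\<lambda>x. perm_mat w *v x) ` (\<lambda>j. axis j (1::complex)) ` {..i} = (\<lambda>j. axis (w j) 1) ` {..i}"
  proof -
    have "perm_mat w *v axis j 1 = axis (w j) 1" for j
      unfolding vec_eq_iff matrix_vector_axis by (simp add: perm_mat_def axis_def)
    then show ?thesis by (simp add: image_image)
  qed
  finally show "coord_flag w i = act (perm_mat w) std_flag i" by (simp add: coord_flag_def)
qed

lemma chart_diag_subset:
  fixes g :: "('n::{finite,linorder}) cmat"
  assumes "\<And>i. d i \<noteq> 0"
  shows "chart (g ** diag d) ` slots P \<subseteq> chart g ` slots P"
proof
  fix V assume "V \<in> chart (g ** diag d) ` slots P"
  then obtain u where u: "u \<in> slots P" "V = act (g ** diag d ** u) std_flag" by (auto simp: chart_def)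
  define u' where "u' = (\<chi> i j. d i * u $ i $ j / d j)"
  have "diag d ** u = u' ** diag d"
    using assms by (simp add: vec_eq_iff diag_mult_left diag_mult_right u'_def)
  then have "V = act (g ** u') (act (diag d) std_flag)"
    using u(2) by (simp add: act_act matrix_mul_assoc[symmetric])
  also have "act (diag d) std_flag = std_flag"
    using assms diag_upper by (subst act_std_flag_iff) (auto simp: det_diag)
  finally have "V = chart g u'" by (simp add: chart_def)
  moreover have "u' \<in> slots P" using u(1) assms by (simp add: slots_def u'_def)
  ultimately show "V \<in> chart g ` slots P" by blast
qed

text \<open>
  The permutation matrix, rescaled in one column so as to have determinant 1. The slices do not notice the change, since a
  diagonal matrix only rescales their coordinates.
\<close>

definition cell_rep :: "('n \<Rightarrow> 'n) \<Rightarrow> ('n::{finite,linorder}) cmat" where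
  "cell_rep w = perm_mat w ** diag (\<lambda>i. if i = Min UNIV then 1 / det (perm_mat w) else 1)"

lemma cell_rep:
  fixes w :: "'n::{finite,linorder} \<Rightarrow> 'n"
  assumes "bij w"
  shows "cell_rep w \<in> SL_C" "chart (cell_rep w) ` slots P = chart (perm_mat w) ` slots P"
proof -
  let ?d = "\<lambda>i :: 'n. if i = Min UNIV then 1 / det (perm_mat w) else 1"
  have d: "det (perm_mat w) \<noteq> 0" by (rule det_perm_mat[OF assms])
  then show "cell_rep w \<in> SL_C" by (simp add: cell_rep_def SL_C_def det_mul det_diag)
  have "diag ?d ** diag (\<lambda>i. 1 / ?d i) = mat 1"
    using d by (simp add: vec_eq_iff diag_mult_left) (simp add: diag_def mat_def)
  then have "cell_rep w ** diag (\<lambda>i. 1 / ?d i) = perm_mat w"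
    unfolding cell_rep_def by (simp only: matrix_mul_assoc[symmetric] matrix_mul_rid)
  moreover have nz: "?d i \<noteq> 0" "1 / ?d i \<noteq> 0" for i using d by simp_all
  have "chart (cell_rep w ** diag (\<lambda>i. 1 / ?d i)) ` slots P \<subseteq> chart (cell_rep w) ` slots P"
    by (rule chart_diag_subset) (rule nz)
  moreover have "chart (cell_rep w) ` slots P \<subseteq> chart (perm_mat w) ` slots P"
    unfolding cell_rep_def by (rule chart_diag_subset) (rule nz)
  ultimately show "chart (cell_rep w) ` slots P = chart (perm_mat w) ` slots P"
    by (metis subset_antisym)
qed

definition inversions :: "('n::{finite,linorder} \<Rightarrow> 'n) \<Rightarrow> ('n \<times> 'n) set" where
  "inversions w = {(k, i). i < k \<and> w k < w i}"

lemma card_inversions: "card (inversions w) = ninv w"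
proof -
  have "inversions w = prod.swap ` {(i, k). i < k \<and> w k < w i}" by (auto simp: inversions_def)
  then show ?thesis by (simp add: ninv_def card_image)
qed

lemma inversions_below: "inversions w \<subseteq> {(k, i). i < k}"
  by (auto simp: inversions_def)

text \<open>
  Conjugating \<open>u \<in> slots (inversions w)\<close> by the permutation matrix gives a unipotent upper triangular matrix, which proves one
  inclusion. For the other one, an upper triangular \<open>p\<close> has to be found that eliminates, by column operations,
  all entries of \<open>b ** perm_mat w\<close> outside the inversions. The \<open>i\<close>-th column of \<open>perm_mat w ** p\<close> is the
  solution \<open>z i\<close> of a linear system whose matrix is the principal submatrix of \<open>b\<close> with index set
  \<open>{r. inv w r \<le> i \<and> r \<le> w i}\<close>, hence triangular with nonzero diagonal.
\<close>

lemma cell_eq: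
  fixes w :: "'n::{finite,linorder} \<Rightarrow> 'n"
  assumes w: "bij w"
  shows "orbit Borel (coord_flag w) = chart (cell_rep w) ` slots (inversions w)"
  unfolding cell_rep(2)[OF w]
proof (intro equalityI subsetI)
  have inj: "w i = w j \<longleftrightarrow> i = j" for i j using w by (simp add: bij_is_inj inj_eq)
  have winv: "w (inv w r) = r" "inv w (w r) = r" for r
    using w by (simp_all add: bij_is_surj bij_is_inj surj_f_inv_f)
  fix V :: "'n flag"
  {
    assume "V \<in> chart (perm_mat w) ` slots (inversions w)"
    then obtain u where u: "u \<in> slots (inversions w)" "V = act (perm_mat w ** u) std_flag"
      by (auto simp: chart_def)
    define b where "b = (\<chi> r c. u $ inv w r $ inv w c)"
    have "b ** perm_mat w = perm_mat w ** u"
    proof -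
      have "(b ** perm_mat w) $ r $ c = (perm_mat w ** u) $ r $ c" for r c
        using perm_mat_mult[OF w, of u "inv w r" c] by (simp add: mult_perm_mat b_def winv)
      then show ?thesis by (simp add: vec_eq_iff)
    qed
    then have "V = act b (coord_flag w)" using u(2) by (simp add: coord_flag_perm_mat[OF w] act_act)
    moreover have "b \<in> unipotent"
    proof -
      have "u $ inv w r $ inv w c = 0" if "c < r" for r c
      proof -
        have "(inv w r, inv w c) \<notin> inversions w" using that by (auto simp: inversions_def winv dest: order.asym)
        moreover have "inv w r \<noteq> inv w c" using that winv by (metis less_irrefl)
        ultimately show ?thesis using u(1) by (simp add: slots_def)
      qed
      then show ?thesis using u(1) by (simp add: unipotent_def upper_tri_def b_def slots_def)
    qed
    ultimately show "V \<in> orbit Borel (coord_flag w)" using unipotent_Borel unfolding orbit_def by blast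
  }
  assume "V \<in> orbit Borel (coord_flag w)"
  then obtain b where b: "b \<in> Borel" "V = act b (coord_flag w)" by (auto simp: orbit_def)
  have bu: "b \<in> upper_tri" and "det b = 1" using Borel_upper[OF b(1)] by auto
  then have bd: "b $ i $ i \<noteq> 0" for i using det_upper_tri[OF bu]
    by (metis UNIV_I finite prod_zero zero_neq_one)
  have "\<exists>z. z \<in> coords {r. inv w r \<le> i \<and> r \<le> w i} \<and>
      (\<forall>r. inv w r \<le> i \<longrightarrow> r \<le> w i \<longrightarrow> (b *v z) $ r = (if r = w i then 1 else 0))" for i
  proof -
    define A where "A = {r. inv w r \<le> i \<and> r \<le> w i}"
    have wiA: "w i \<in> A" by (simp add: A_def winv)
    \<comment> \<open>The principal submatrix of \<open>b\<close> on \<open>A\<close>, extended by the identity.\<close>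
    define T where "T = (\<chi> r c. if r \<in> A \<and> c \<in> A then b $ r $ c else if r = c then 1 else 0)"
    have Tu: "T \<in> upper_tri" using bu by (auto simp: T_def upper_tri_def)
    have "T $ r $ r \<noteq> 0" for r using bd by (simp add: T_def)
    then have dT: "det T \<noteq> 0" unfolding det_upper_tri[OF Tu] by simp
    define z where "z = matrix_inv T *v axis (w i) 1"
    have Tz: "T *v z = axis (w i) 1" by (simp add: z_def matrix_vector_mul_assoc matrix_inv_right dT)
    have z0: "z $ r = 0" if "r \<notin> A" for r
    proof -
      have "(T *v z) $ r = (\<Sum>c\<in>UNIV. (if r = c then z $ c else 0))"
        unfolding matrix_vector_mult_def T_def vec_lambda_beta using that by (intro sum.cong) simp_all
      then have "(T *v z) $ r = z $ r" by simp
      moreover have "r \<noteq> w i" using that wiA by blast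
      ultimately show ?thesis unfolding Tz by (simp add: axis_def)
    qed
    have "(b *v z) $ r = (if r = w i then 1 else 0)" if "r \<in> A" for r
    proof -
      have "b $ r $ c * z $ c = T $ r $ c * z $ c" for c
        using that z0[of c] by (cases "c \<in> A") (simp_all add: T_def)
      then have "(b *v z) $ r = (T *v z) $ r"
        unfolding matrix_vector_mult_def vec_lambda_beta by (intro sum.cong refl)
      then show ?thesis unfolding Tz by (simp add: axis_def)
    qed
    moreover have "z \<in> coords A" using z0 by (simp add: coords_def)
    ultimately show ?thesis unfolding A_def by blast
  qed
  then have "\<exists>z. \<forall>i. z i \<in> coords {r. inv w r \<le> i \<and> r \<le> w i} \<and>
      (\<forall>r. inv w r \<le> i \<longrightarrow> r \<le> w i \<longrightarrow> (b *v z i) $ r = (if r = w i then 1 else 0))"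
    by (intro choice allI)
  then obtain z where z: "\<And>i. z i \<in> coords {r. inv w r \<le> i \<and> r \<le> w i}"
    and bz: "\<And>i r. inv w r \<le> i \<Longrightarrow> r \<le> w i \<Longrightarrow> (b *v z i) $ r = (if r = w i then 1 else 0)"
    by blast
  define p where "p = (\<chi> k i. z i $ w k)"
  define u where "u = (\<chi> k i. (b *v z i) $ w k)"
  have pu: "p \<in> upper_tri"
    using z by (auto simp: p_def upper_tri_def coords_def winv not_le)
  have high: "(b *v z i) $ r = 0" if "w i < r" for i r
  proof -
    have "z i \<in> coords {..w i}" using z[of i] by (auto simp: coords_def)
    then have "b *v z i \<in> coords {..w i}" by (rule upper_tri_preserves[OF bu])
    then show ?thesis using that by (simp add: coords_def not_le)
  qed
  have uS: "u \<in> slots (inversions w)"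
  proof -
    have "u $ i $ i = 1" for i using bz[of "w i" i] by (simp add: u_def winv)
    moreover have "u $ k $ i = 0" if "k \<noteq> i" "(k, i) \<notin> inversions w" for k i
    proof (cases "w k < w i")
      case True
      then have "k \<le> i" using that by (auto simp: inversions_def)
      then show ?thesis using bz[of "w k" i] True that(1) by (simp add: u_def winv inj)
    next
      case False
      then have "w i < w k" using that(1) inj[of i k] by (simp add: not_less order.not_eq_order_implies_strict)
      then show ?thesis using high by (simp add: u_def)
    qed
    ultimately show ?thesis by (simp add: slots_def)
  qed
  have eq: "b ** perm_mat w ** p = perm_mat w ** u"
  proof -
    have "(b ** (perm_mat w ** p)) $ r $ i = (perm_mat w ** u) $ r $ i" for r i
    proof -
      have "(perm_mat w ** p) $ c $ i = z i $ c" for c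
        using perm_mat_mult[OF w, of p "inv w c" i] by (simp add: winv p_def)
      then have "(b ** (perm_mat w ** p)) $ r $ i = (b *v z i) $ r"
        by (simp add: matrix_matrix_mult_def[of b] matrix_vector_mult_def)
      then show ?thesis using perm_mat_mult[OF w, of u "inv w r" i] by (simp add: winv u_def)
    qed
    then show ?thesis by (simp add: vec_eq_iff matrix_mul_assoc)
  qed
  have "det (b ** perm_mat w ** p) \<noteq> 0"
    unfolding eq using det_perm_mat[OF w]
      det_lower_unitriangular[OF subsetD[OF slots_lower[OF inversions_below] uS]] by (simp add: det_mul)
  then have "det p \<noteq> 0" by (auto simp: det_mul)
  then have "act p std_flag = std_flag" using pu by (simp add: act_std_flag_iff)
  then have "V = act (b ** perm_mat w ** p) std_flag"
    using b(2) by (metis coord_flag_perm_mat[OF w] act_act)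
  then have "V = chart (perm_mat w) u" by (simp add: eq chart_def)
  then show "V \<in> chart (perm_mat w) ` slots (inversions w)" using uS by blast
qed

section \<open>Semicontinuity of intersection dimensions\<close>

lemma norm_matrix_vector_le:
  fixes A :: "'n::finite cmat"
  shows "norm (A *v x) \<le> (\<Sum>i\<in>UNIV. \<Sum>j\<in>UNIV. norm (A $ i $ j)) * norm x"
proof -
  have "norm (A *v x) \<le> (\<Sum>i\<in>UNIV. norm ((A *v x) $ i))" unfolding norm_vec_def by (rule L2_set_le_sum) simp
  also have "\<dots> \<le> (\<Sum>i\<in>UNIV. \<Sum>j\<in>UNIV. norm (A $ i $ j) * norm x)"
  proof (rule sum_mono)
    fix i
    have "norm ((A *v x) $ i) \<le> (\<Sum>j\<in>UNIV. norm (A $ i $ j * x $ j))"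
      unfolding matrix_vector_mult_def vec_lambda_beta by (rule norm_sum)
    also have "\<dots> \<le> (\<Sum>j\<in>UNIV. norm (A $ i $ j) * norm x)"
      by (intro sum_mono) (simp add: norm_mult mult_left_mono Finite_Cartesian_Product.norm_nth_le)
    finally show "norm ((A *v x) $ i) \<le> (\<Sum>j\<in>UNIV. norm (A $ i $ j) * norm x)" .
  qed
  finally show ?thesis by (simp add: sum_distrib_right)
qed

text \<open>
  The preimage of \<open>coords J\<close> under \<open>h\<close> is the kernel of \<open>h\<close> followed by the projection \<open>Q\<close> to the other coordinates. A
  complement \<open>T\<close> of the kernel for \<open>g\<close> meets the kernels of all nearby maps only in 0, so these are not larger.
\<close>

lemma open_dim_preimage_le:
  fixes g :: "'n::finite cmat" and S :: "(complex^'n) set" and J :: "'n set"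
  assumes S: "vec.subspace S"
  obtains e where "0 < e" "\<And>h. (\<Sum>i\<in>UNIV. \<Sum>j\<in>UNIV. norm (h $ i $ j - g $ i $ j)) < e \<Longrightarrow>
      vec.dim {x \<in> S. h *v x \<in> coords J} \<le> vec.dim {x \<in> S. g *v x \<in> coords J}"
proof -
  let ?K = "\<lambda>h. {x \<in> S. h *v x \<in> coords J}"
  have K: "vec.subspace (?K h)" for h
    using S subspace_coords[of J]
    unfolding vec.subspace_def by (simp add: matrix_vector_right_distrib vector_scalar_commute)
  define T where "T = {y \<in> S. \<forall>x\<in>?K g. orthogonal x y}"
  have KS: "?K g \<subseteq> S" by blast
  have dimT: "dim T + dim (?K g) = dim S"
    unfolding T_def by (rule dim_subspace_orthogonal_to_vectors[OF real_subspace[OF K] real_subspace[OF S] KS])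
  have T: "subspace T"
    using real_subspace[OF S] unfolding T_def subspace_def
    by (simp add: orthogonal_clauses)
  define Q :: "complex^'n \<Rightarrow> complex^'n" where "Q = (\<lambda>x. \<chi> j. if j \<in> J then 0 else x $ j)"
  have Q0: "Q x = 0 \<longleftrightarrow> x \<in> coords J" for x by (auto simp: Q_def coords_def vec_eq_iff)
  have Ql: "linear Q" by (rule linearI) (simp_all add: Q_def vec_eq_iff)
  have Qn: "norm (Q x) \<le> norm x" for x
    unfolding norm_vec_def by (intro L2_set_mono) (simp_all add: Q_def)
  have Qg: "linear (\<lambda>x. Q (h *v x))" for h
    by (rule linear_compose[of "\<lambda>x. h *v x" Q, unfolded o_def, OF _ Ql])
       (rule linearI; simp add: matrix_vector_right_distrib scaleR_vec vector_scalar_commute)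
  have "\<forall>x\<in>T. Q (g *v x) = 0 \<longrightarrow> x = 0"
    unfolding T_def using Q0 by (auto simp: orthogonal_def)
  from injective_imp_isometric[OF closed_subspace[OF T] T _ this]
  obtain e where e: "e > 0" "\<forall>x\<in>T. norm (Q (g *v x)) \<ge> e * norm x"
    using Qg[of g] by (auto simp: linear_conv_bounded_linear)
  show ?thesis
  proof (rule that[OF e(1)])
    fix h :: "'n cmat"
    assume h: "(\<Sum>i\<in>UNIV. \<Sum>j\<in>UNIV. norm (h $ i $ j - g $ i $ j)) < e"
    have "x = 0" if x: "x \<in> T" "x \<in> ?K h" for x
    proof (rule ccontr)
      assume "x \<noteq> 0"
      have "Q (g *v x) = Q (h *v x) - Q ((h - g) *v x)"
        by (simp add: linear_diff[OF Ql, symmetric] matrix_vector_mult_diff_rdistrib)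
      moreover have "Q (h *v x) = 0" using x(2) Q0 by blast
      ultimately have "norm (Q (g *v x)) \<le> norm ((h - g) *v x)" using Qn by simp
      also have "\<dots> \<le> (\<Sum>i\<in>UNIV. \<Sum>j\<in>UNIV. norm (h $ i $ j - g $ i $ j)) * norm x"
        using norm_matrix_vector_le[of "h - g" x] by simp
      also have "\<dots> < e * norm x" using h \<open>x \<noteq> 0\<close> by simp
      finally show False using e(2) x(1) by fastforce
    qed
    moreover have "0 \<in> T" "0 \<in> ?K h" using T real_subspace[OF K[of h]] by (auto simp: subspace_0 dest: subspace_0)
    ultimately have "T \<inter> ?K h = {0}" by blast
    then have "dim {x + y |x y. x \<in> T \<and> y \<in> ?K h} = dim T + dim (?K h)"
      using dim_sums_Int[OF T real_subspace[OF K[of h]]] by simp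
    moreover have "{x + y |x y. x \<in> T \<and> y \<in> ?K h} \<subseteq> S"
      using subspace_add[OF real_subspace[OF S]] unfolding T_def by blast
    then have "dim {x + y |x y. x \<in> T \<and> y \<in> ?K h} \<le> dim S" by (rule dim_subset)
    ultimately have "dim (?K h) \<le> dim (?K g)" using dimT by linarith
    then show "vec.dim (?K h) \<le> vec.dim (?K g)" using real_dim_eq[OF K[of h]] real_dim_eq[OF K[of g]] by linarith
  qed
qed

lemma openin_dim_le:
  fixes J :: "'n::{finite,linorder} set"
  shows "openin flag_topology {V \<in> flags. vec.dim (V i \<inter> coords J) \<le> r}"
proof -
  let ?K = "\<lambda>h. {x \<in> coords {..i}. h *v x \<in> coords J}"
  let ?A = "{h \<in> SL_C. act h std_flag \<in> {V \<in> flags. vec.dim (V i \<inter> coords J) \<le> r}}"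
  have eq: "vec.dim (act h std_flag i \<inter> coords J) = vec.dim (?K h)" if "h \<in> SL_C" for h
  proof -
    have "act h std_flag i \<inter> coords J = (\<lambda>x. h *v x) ` ?K h" by (auto simp: act_def std_flag_eq)
    then show ?thesis using that by (simp add: vec_dim_image SL_C_def)
  qed
  have "openin (top_of_set SL_C) ?A"
  proof (subst openin_subopen, intro ballI)
    fix g assume g: "g \<in> ?A"
    obtain e where e: "0 < e" "\<And>h. (\<Sum>i\<in>UNIV. \<Sum>j\<in>UNIV. norm (h $ i $ j - g $ i $ j)) < e \<Longrightarrow>
        vec.dim (?K h) \<le> vec.dim (?K g)"
      by (rule open_dim_preimage_le[OF subspace_coords]) blast
    let ?U = "{h :: 'n cmat. (\<Sum>i\<in>UNIV. \<Sum>j\<in>UNIV. norm (h $ i $ j - g $ i $ j)) < e}"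
    have "open ?U" by (intro open_Collect_less continuous_intros)
    then have "openin (top_of_set SL_C) (SL_C \<inter> ?U)" by (simp add: openin_open_Int)
    moreover have "g \<in> SL_C \<inter> ?U" using g e(1) by simp
    moreover have "h \<in> ?A" if "h \<in> SL_C \<inter> ?U" for h
    proof -
      have hS: "h \<in> SL_C" using that by blast
      have "vec.dim (?K h) \<le> vec.dim (?K g)" using that e(2)[of h] by blast
      also have "\<dots> \<le> r" using g eq[of g] by simp
      finally have "vec.dim (act h std_flag i \<inter> coords J) \<le> r" using eq[OF hS] by simp
      moreover have "act h std_flag \<in> flags" using hS by (intro act_flags std_flag_in_flags) (simp add: SL_C_def)
      ultimately show ?thesis using hS by blast
    qed
    ultimately show "\<exists>T. openin (top_of_set SL_C) T \<and> g \<in> T \<and> T \<subseteq> ?A" by blast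
  qed
  then show ?thesis by (simp add: openin_flag_topology)
qed

section \<open>Schubert varieties\<close>

lemma orbit_cell_flags:
  fixes w :: "'n::{finite,linorder} \<Rightarrow> 'n"
  assumes "bij w"
  shows "orbit Borel (coord_flag w) \<subseteq> flags"
  unfolding orbit_def using assms
  by (auto intro!: act_flags coord_flag_in_flags simp: bij_is_inj dest: Borel_upper)

lemma cell_subset_schubert:
  fixes w :: "'n::{finite,linorder} \<Rightarrow> 'n"
  assumes "bij w"
  shows "orbit Borel (coord_flag w) \<subseteq> schubert w"
  unfolding schubert_def using orbit_cell_flags[OF assms]
  by (intro closure_of_subset) (simp add: topspace_flag_topology)

text \<open>
  Flags with a smaller intersection dimension form an open set that is disjoint from the cell.
\<close>

lemma schubert_dim_ge:
  fixes w :: "'n::{finite,linorder} \<Rightarrow> 'n"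
  assumes w: "bij w" and V: "V \<in> schubert w"
  shows "V \<in> flags" "rk w (pos i) {..x} \<le> vec.dim (V i \<inter> coords {..x})"
proof -
  show fl: "V \<in> flags"
    using V closure_of_subset_topspace[of flag_topology] unfolding schubert_def topspace_flag_topology by blast
  show "rk w (pos i) {..x} \<le> vec.dim (V i \<inter> coords {..x})"
  proof (rule ccontr)
    let ?O = "{V' \<in> flags. vec.dim (V' i \<inter> coords {..x}) \<le> vec.dim (V i \<inter> coords {..x})}"
    assume neg: "\<not> ?thesis"
    have VO: "V \<in> ?O" using fl by simp
    have op: "openin flag_topology ?O" by (rule openin_dim_le)
    have cl: "\<forall>T. V \<in> T \<and> openin flag_topology T \<longrightarrow> (\<exists>y. y \<in> orbit Borel (coord_flag w) \<and> y \<in> T)"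
      using V unfolding schubert_def in_closure_of by (elim conjE)
    obtain V' where V': "V' \<in> orbit Borel (coord_flag w)" "V' \<in> ?O"
      using cl[rule_format, OF conjI[OF VO op]] by (elim exE conjE)
    then obtain b where "b \<in> Borel" "V' = act b (coord_flag w)" unfolding orbit_def by blast
    then show False using neg V'(2) cell_dim[of b w i x] bij_is_inj[OF w] by simp
  qed
qed

lemma schubert_rk:
  fixes v w :: "'n::{finite,linorder} \<Rightarrow> 'n"
  assumes w: "bij w" and v: "bij v" and b: "b \<in> Borel" and V: "act b (coord_flag v) \<in> schubert w"
  shows "rk w t {..x} \<le> rk v t {..x}"
proof (rule rk_le_all[OF v w])
  fix i :: 'n
  show "rk w (pos i) {..x} \<le> rk v (pos i) {..x}"
    using schubert_dim_ge(2)[OF w V, of i x] by (simp add: cell_dim[OF b bij_is_inj[OF v]])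
qed

lemma one_Borel: "(mat 1 :: ('n::{finite,linorder}) cmat) \<in> Borel"
proof -
  have "(mat 1 :: 'n cmat) \<in> SL_C" by (simp add: SL_C_def)
  then show ?thesis by (simp add: Borel_def) (auto simp: mat_def)
qed

lemma schubert_inject:
  fixes v w :: "'n::{finite,linorder} \<Rightarrow> 'n"
  assumes v: "bij v" and w: "bij w" and eq: "schubert v = schubert w"
  shows "v = w"
proof -
  note one = one_Borel[where 'n='n]
  have "act (mat 1) (coord_flag v) \<in> schubert v" "act (mat 1) (coord_flag w) \<in> schubert w"
    using cell_subset_schubert[OF v] cell_subset_schubert[OF w] one unfolding orbit_def by blast+
  then have "rk w t {..x} = rk v t {..x}" for t x
    using schubert_rk[OF w v one] schubert_rk[OF v w one] eq by (simp add: order.antisym)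
  then show ?thesis by (intro rk_inject) simp
qed

lemma embedding_mapD:
  assumes "embedding_map X Y f"
  shows "continuous_map X Y f" "inj_on f (topspace X)"
proof -
  have h: "homeomorphic_map X (subtopology Y (f ` topspace X)) f"
    using assms by (simp add: embedding_map_def)
  show "continuous_map X Y f"
    using homeomorphic_imp_continuous_map[OF h] by (simp add: continuous_map_in_subtopology)
  show "inj_on f (topspace X)" by (rule homeomorphic_imp_injective_map[OF h])
qed

lemma embedding_map_inverse:
  assumes "embedding_map X Y f"
  obtains k where "continuous_map (subtopology Y (f ` topspace X)) X k"
    "\<And>x. x \<in> topspace X \<Longrightarrow> k (f x) = x"
proof -
  obtain k where "homeomorphic_maps X (subtopology Y (f ` topspace X)) f k"
    using assms by (auto simp: embedding_map_def homeomorphic_map_maps)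
  then show ?thesis using that[of k] by (auto simp: homeomorphic_maps_def)
qed

text \<open>
  The cell itself has dimension \<open>ninv w\<close>. For the upper bound, let \<open>M\<close> be a submanifold contained in the Schubert variety and
  \<open>V\<close> a point of \<open>M\<close> where the sum \<open>\<delta> V\<close> of the dimensions of all intersections with initial coordinate spaces is least. By
  semicontinuity these dimensions are constant on \<open>M\<close> near \<open>V\<close>, so a neighbourhood of \<open>V\<close> in \<open>M\<close> lies in a single Bruhat
  cell, of a permutation \<open>v\<close>. This bounds the dimension of \<open>M\<close> by \<open>ninv v \<le> ninv w\<close>.
\<close>

lemma cdim_schubert:
  fixes w :: "'n::{finite,linorder} \<Rightarrow> 'n"
  assumes w: "bij w"
  shows "cdim (schubert w) = ninv w"
proof (rule cdim_eqI)
  show "orbit Borel (coord_flag w) \<subseteq> schubert w" by (rule cell_subset_schubert[OF w])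
  show "complex_submanifold (ninv w) (orbit Borel (coord_flag w))"
    unfolding cell_eq[OF w] card_inversions[symmetric]
    by (rule complex_submanifold_slots[OF cell_rep(1)[OF w] inversions_below])
  show "orbit Borel (coord_flag w) \<noteq> {}" using one_Borel unfolding orbit_def by blast
  fix M :: "'n flag set" and e
  assume M: "M \<noteq> {}" "M \<subseteq> schubert w" "complex_submanifold e M"
  define \<delta> where "\<delta> V = (\<Sum>p\<in>UNIV. vec.dim (V (fst p) \<inter> coords {..snd p}))" for V :: "'n flag"
  obtain V where V: "V \<in> M" and min: "\<And>V'. V' \<in> M \<Longrightarrow> \<delta> V \<le> \<delta> V'"
    using M(1) ex_has_least_nat[of "\<lambda>V. V \<in> M" _ \<delta>] by blast
  have Vf: "V \<in> flags" using V M(2) schubert_dim_ge(1)[OF w] by blast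
  obtain v b where v: "bij v" and b: "b \<in> unipotent" "V = act b (coord_flag v)"
    by (rule bruhat_decomposition[OF Vf])
  have bB: "b \<in> Borel" using b(1) unipotent_Borel by blast
  define O' where "O' = (\<Inter>p\<in>(UNIV :: ('n \<times> 'n) set). {V' \<in> flags.
      vec.dim (V' (fst p) \<inter> coords {..snd p}) \<le> vec.dim (V (fst p) \<inter> coords {..snd p})})"
  have O': "openin flag_topology O'" unfolding O'_def by (intro openin_INT2 openin_dim_le) auto
  have VO: "V \<in> O'" using Vf by (simp add: O'_def)
  have cell: "V' \<in> orbit Borel (coord_flag v)" if V': "V' \<in> M" "V' \<in> O'" for V'
  proof -
    have le: "vec.dim (V' (fst p) \<inter> coords {..snd p}) \<le> vec.dim (V (fst p) \<inter> coords {..snd p})" for p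
      using V'(2) by (auto simp: O'_def)
    have eq: "vec.dim (V' (fst p) \<inter> coords {..snd p}) = vec.dim (V (fst p) \<inter> coords {..snd p})" for p
    proof (rule ccontr)
      assume "\<not> ?thesis"
      then have "vec.dim (V' (fst p) \<inter> coords {..snd p}) < vec.dim (V (fst p) \<inter> coords {..snd p})"
        using le[of p] by simp
      then have "\<delta> V' < \<delta> V" unfolding \<delta>_def by (intro sum_strict_mono_ex1) (use le in auto)
      then show False using min[OF V'(1)] by simp
    qed
    have "V' \<in> flags" using V'(1) M(2) schubert_dim_ge(1)[OF w] by blast
    then obtain v' b' where v': "bij v'" and b': "b' \<in> unipotent" "V' = act b' (coord_flag v')"
      by (rule bruhat_decomposition)
    have b'B: "b' \<in> Borel" using b'(1) unipotent_Borel by blast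
    have e: "rk v' (pos i) {..x} = rk v (pos i) {..x}" for i x :: 'n
      using eq[of "(i, x)"] by (simp add: b b' cell_dim[OF bB bij_is_inj[OF v]] cell_dim[OF b'B bij_is_inj[OF v']])
    have "rk v' t {..x} = rk v t {..x}" for t x
    proof (rule order.antisym)
      show "rk v' t {..x} \<le> rk v t {..x}" by (rule rk_le_all[OF v v']) (simp only: e)
      show "rk v t {..x} \<le> rk v' t {..x}" by (rule rk_le_all[OF v' v]) (simp only: e)
    qed
    then have "v' = v" by (rule rk_inject)
    then show ?thesis using b' b'B by (auto simp: orbit_def)
  qed
  obtain g and W :: "(complex^('n \<times> 'n)) set" and U f x where
    c: "g \<in> SL_C" "vec.subspace W" "vec.dim W = e" "openin (top_of_set W) U" "f ` U \<subseteq> lower_unitriangular"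
    "holomorphic_immersion_on W U f" "embedding_map (top_of_set U) flag_topology (chart g \<circ> f)"
    "x \<in> U" "V = chart g (f x)" "openin (subtopology flag_topology M) ((chart g \<circ> f) ` U)"
    by (rule complex_submanifold_chart[OF M(3) V]) blast
  let ?F = "chart g \<circ> f" and ?L = "lower_unitriangular :: 'n cmat set" and ?h = "cell_rep v"
  have F: "continuous_map (top_of_set U) flag_topology ?F" "inj_on ?F U"
    using embedding_mapD[OF c(7)] by simp_all
  have FM: "?F ` U \<subseteq> M" using openin_subset[OF c(10)] by simp
  define U' where "U' = {y \<in> U. ?F y \<in> O'}"
  have "openin (top_of_set U) U'"
    using openin_continuous_map_preimage[OF F(1) O'] by (simp add: U'_def)
  then have U': "openin (top_of_set W) U'" using c(4) openin_trans by blast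
  obtain k where k: "continuous_map (subtopology flag_topology (chart ?h ` ?L)) (top_of_set ?L) k"
    "\<And>u. u \<in> ?L \<Longrightarrow> k (chart ?h u) = u"
    using embedding_map_inverse[OF embedding_chart[OF cell_rep(1)[OF v]]] by (metis topspace_euclidean_subtopology)
  have kF: "k (?F y) \<in> slots (inversions v) \<and> chart ?h (k (?F y)) = ?F y" if "y \<in> U'" for y
  proof -
    have "?F y \<in> orbit Borel (coord_flag v)" using that FM cell unfolding U'_def by blast
    then obtain u where u: "u \<in> slots (inversions v)" "?F y = chart ?h u" unfolding cell_eq[OF v] by blast
    then have "k (?F y) = u" using k(2) slots_lower[OF inversions_below] by auto
    then show ?thesis using u by simp
  qed
  have "vec.dim W \<le> card (inversions v)"
  proof (rule dim_le_slots[OF c(2) U'])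
    show "U' \<noteq> {}" using c(8,9) VO by (auto simp: U'_def)
    have "continuous_map (top_of_set U') flag_topology ?F"
      by (rule continuous_map_from_subtopology_mono[OF F(1)]) (auto simp: U'_def)
    moreover have "?F ` U' \<subseteq> chart ?h ` ?L"
    proof (rule image_subsetI)
      fix y assume "y \<in> U'"
      then have "k (?F y) \<in> ?L" "?F y = chart ?h (k (?F y))"
        using kF subsetD[OF slots_lower[OF inversions_below]] by auto
      then show "?F y \<in> chart ?h ` ?L" by blast
    qed
    ultimately have "continuous_map (top_of_set U') (subtopology flag_topology (chart ?h ` ?L)) ?F"
      by (simp only: continuous_map_in_subtopology image_subset_iff_funcset topspace_euclidean_subtopology)
    from continuous_map_compose[OF this k(1)]
    show "continuous_on U' (k \<circ> ?F)"
      by (simp only: continuous_map_in_subtopology continuous_map_iff_continuous)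
    show "inj_on (k \<circ> ?F) U'"
    proof (rule inj_onI)
      fix y z assume yz: "y \<in> U'" "z \<in> U'" "(k \<circ> ?F) y = (k \<circ> ?F) z"
      then have "?F y = ?F z" using kF[OF yz(1)] kF[OF yz(2)] by (metis comp_apply)
      then show "y = z" using F(2) yz unfolding U'_def inj_on_def by blast
    qed
    show "(k \<circ> ?F) ` U' \<subseteq> slots (inversions v)" using kF by auto
    show "inversions v \<subseteq> {(i, j). j < i}" by (rule inversions_below)
  qed
  then have "e \<le> ninv v" by (simp add: c(3) card_inversions)
  also have "ninv v \<le> ninv w"
  proof (rule ninv_mono[OF v w])
    have "act b (coord_flag v) \<in> schubert w" using V M(2) b(2) by auto
    then show "rk w t {..x} \<le> rk v t {..x}" for t x by (rule schubert_rk[OF w v bB])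
  qed
  finally show "e \<le> ninv w" .
qed

section \<open>Limits of matrix equations\<close>

lemma bounded_bilinear_matrix: "bounded_bilinear ((**) :: 'n::finite cmat \<Rightarrow> 'n cmat \<Rightarrow> 'n cmat)"
proof -
  have "bilinear ((**) :: 'n cmat \<Rightarrow> 'n cmat \<Rightarrow> 'n cmat)"
    unfolding bilinear_def
    by (intro conjI allI linearI)
      (simp_all add: vec_eq_iff matrix_matrix_mult_def sum.distrib algebra_simps scaleR_sum_right)
  then show ?thesis by (simp add: bilinear_conv_bounded_bilinear)
qed

lemmas tendsto_matrix_mult [tendsto_intros] = bounded_bilinear.tendsto[OF bounded_bilinear_matrix]

lemma matrix_mult_0 [simp]: "A ** (0 :: 'n::finite cmat) = 0" "(0 :: 'n cmat) ** A = 0"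
  by (simp_all add: vec_eq_iff matrix_matrix_mult_def)

lemma matrix_mult_diff:
  fixes A B D :: "'n::finite cmat"
  shows "(A - B) ** D = A ** D - B ** D" "D ** (A - B) = D ** A - D ** B"
  by (simp_all add: vec_eq_iff matrix_matrix_mult_def sum_subtractf algebra_simps)

lemma matrix_mult_add:
  fixes A B D :: "'n::finite cmat"
  shows "(A + B) ** D = A ** D + B ** D" "D ** (A + B) = D ** A + D ** B"
  by (simp_all add: vec_eq_iff matrix_matrix_mult_def sum.distrib algebra_simps)

lemma matrix_mult_scaleR:
  fixes A D :: "'n::finite cmat"
  shows "(c *\<^sub>R A) ** D = c *\<^sub>R (A ** D)" "D ** (c *\<^sub>R A) = c *\<^sub>R (D ** A)"
  by (simp_all add: vec_eq_iff matrix_matrix_mult_def scaleR_sum_right)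

text \<open>Solving a convergent family of linear systems: first the solutions are bounded, then they converge.\<close>

lemma tendsto_solve:
  fixes m p :: "nat \<Rightarrow> 'n::finite cmat"
  assumes m: "m \<longlonglongrightarrow> M" and det: "det M \<noteq> 0" and y: "(\<lambda>n. m n ** p n) \<longlonglongrightarrow> Y"
  shows "p \<longlonglongrightarrow> matrix_inv M ** Y"
proof -
  have "\<exists>K>0. \<forall>(A :: 'n cmat) (B :: 'n cmat). norm (A ** B) \<le> norm A * norm B * K"
    by (rule bounded_bilinear.pos_bounded[OF bounded_bilinear_matrix])
  then obtain K where K: "K > 0" "\<And>(A :: 'n cmat) (B :: 'n cmat). norm (A ** B) \<le> norm A * norm B * K"
    by blast
  let ?e = "\<lambda>n. matrix_inv M ** (M - m n)"
  have e0: "?e \<longlonglongrightarrow> 0"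
    using tendsto_matrix_mult[OF tendsto_const tendsto_diff[OF tendsto_const m], of "matrix_inv M" M] by simp
  have eq: "p n = matrix_inv M ** (m n ** p n) + ?e n ** p n" for n
    by (simp add: matrix_mul_assoc matrix_mult_diff matrix_inv_left[OF det])
  have lim: "(\<lambda>n. matrix_inv M ** (m n ** p n)) \<longlonglongrightarrow> matrix_inv M ** Y"
    by (intro tendsto_intros y)
  have "eventually (\<lambda>n. norm (?e n) < 1 / (2 * K)) sequentially"
    using tendstoD[OF e0, of "1 / (2 * K)"] K(1) by simp
  then have "eventually (\<lambda>n. norm (?e n ** p n) \<le> norm (?e n) * K * (2 * norm (matrix_inv M ** (m n ** p n)))) sequentially"
  proof eventually_elim
    case (elim n)
    have a: "norm (?e n ** p n) \<le> norm (?e n) * K * norm (p n)" using K(2)[of "?e n" "p n"] by (simp add: mult_ac)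
    have "norm (?e n) * K \<le> 1 / 2" using elim K(1) by (simp add: field_simps)
    then have "norm (?e n) * K * norm (p n) \<le> norm (p n) / 2"
      using mult_right_mono[of "norm (?e n) * K" "1/2" "norm (p n)"] by simp
    then have "norm (p n) \<le> norm (matrix_inv M ** (m n ** p n)) + norm (p n) / 2"
      using arg_cong[OF eq[of n], of norm] norm_triangle_ineq[of "matrix_inv M ** (m n ** p n)" "?e n ** p n"] a by linarith
    then have "norm (p n) \<le> 2 * norm (matrix_inv M ** (m n ** p n))" by simp
    then have "norm (?e n) * K * norm (p n) \<le> norm (?e n) * K * (2 * norm (matrix_inv M ** (m n ** p n)))"
      using K(1) by (intro mult_left_mono) auto
    with a show ?case by linarith
  qed
  moreover have "(\<lambda>n. norm (?e n) * K * (2 * norm (matrix_inv M ** (m n ** p n)))) \<longlonglongrightarrow> 0 * K * (2 * norm (matrix_inv M ** Y))"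
    using tendsto_norm_zero[OF e0] tendsto_norm[OF lim] by (intro tendsto_mult tendsto_const)
  ultimately have "(\<lambda>n. ?e n ** p n) \<longlonglongrightarrow> 0"
    by (intro Lim_null_comparison[of "\<lambda>n. ?e n ** p n"]) auto
  from tendsto_add[OF lim this] show ?thesis using eq by simp
qed

section \<open>Infinitesimal stabilizers of flags\<close>

text \<open>
  The kernel of \<open>low\<close> is the Lie algebra of upper triangular matrices, so \<open>low\<close> represents the differential at the
  identity of the orbit map \<open>g \<mapsto> act g (coord_flag id)\<close>.
\<close>

definition low :: "('n::{finite,linorder}) cmat \<Rightarrow> 'n cmat" where
  "low X = (\<chi> i j. if j < i then X $ i $ j else 0)"

lemma linear_low: "linear (low :: ('n::{finite,linorder}) cmat \<Rightarrow> 'n cmat)"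
  by (rule linearI) (simp_all add: low_def vec_eq_iff)

lemma low_eq_0: "low X = 0 \<longleftrightarrow> X \<in> upper_tri" for X :: "('n::{finite,linorder}) cmat"
  by (auto simp: low_def upper_tri_def vec_eq_iff)

lemma tendsto_low: "f \<longlonglongrightarrow> X \<Longrightarrow> (\<lambda>n. low (f n)) \<longlonglongrightarrow> low X"
  for X :: "('n::{finite,linorder}) cmat"
  using linear_low[unfolded linear_conv_bounded_linear] by (rule bounded_linear.tendsto)

definition stab :: "('n::{finite,linorder}) flag \<Rightarrow> 'n cmat set" where
  "stab V = {X. \<forall>i. \<forall>x\<in>V i. X *v x \<in> V i}"

lemma stab_iff:
  fixes h :: "('n::{finite,linorder}) cmat"
  assumes "det h \<noteq> 0"
  shows "X \<in> stab (act h std_flag) \<longleftrightarrow> matrix_inv h ** X ** h \<in> upper_tri"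
proof
  assume X: "X \<in> stab (act h std_flag)"
  have "(matrix_inv h ** X ** h) $ i $ j = 0" if "j < i" for i j
  proof -
    have "axis j 1 \<in> coords {..j}" by (simp add: coords_def axis_def)
    then have "h *v axis j 1 \<in> act h std_flag j" by (simp add: act_def std_flag_eq)
    then have "X *v (h *v axis j 1) \<in> act h std_flag j" using X by (simp add: stab_def)
    then obtain y where y: "y \<in> coords {..j}" "X *v (h *v axis j 1) = h *v y"
      by (auto simp: act_def std_flag_eq)
    have "(matrix_inv h ** X ** h) *v axis j 1 = matrix_inv h *v (X *v (h *v axis j 1))"
      by (simp only: matrix_vector_mul_assoc matrix_mul_assoc)
    also have "\<dots> = matrix_inv h *v (h *v y)" by (simp only: y(2))
    also have "\<dots> = y" by (simp add: matrix_vector_mul_assoc matrix_inv_left[OF assms])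
    finally have "(matrix_inv h ** X ** h) $ i $ j = y $ i" by (metis matrix_vector_axis)
    then show ?thesis using y(1) that by (simp add: coords_def)
  qed
  then show "matrix_inv h ** X ** h \<in> upper_tri" by (simp add: upper_tri_def)
next
  assume u: "matrix_inv h ** X ** h \<in> upper_tri"
  show "X \<in> stab (act h std_flag)"
    unfolding stab_def
  proof (intro CollectI allI ballI)
    fix i x assume "x \<in> act h std_flag i"
    then obtain y where y: "y \<in> coords {..i}" "x = h *v y" by (auto simp: act_def std_flag_eq)
    have "h *v ((matrix_inv h ** X ** h) *v y) = (h ** matrix_inv h) *v (X *v (h *v y))"
      by (simp only: matrix_vector_mul_assoc matrix_mul_assoc)
    then have "X *v x = h *v ((matrix_inv h ** X ** h) *v y)" by (simp add: y(2) matrix_inv_right[OF assms])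
    then show "X *v x \<in> act h std_flag i"
      using upper_tri_preserves[OF u y(1)] by (simp add: act_def std_flag_eq)
  qed
qed

section \<open>The special orthogonal group\<close>

definition so_R :: "('n::finite) cmat set" where
  "so_R = {A. (\<forall>i j. A $ i $ j \<in> \<real>) \<and> transpose A = - A}"

lemma SO_R_iff: "k \<in> SO_R \<longleftrightarrow> (\<forall>i j. k $ i $ j \<in> \<real>) \<and> transpose k ** k = mat 1 \<and> det k = 1"
  for k :: "'n::finite cmat"
  by (auto simp: SO_R_def SL_R_def SL_C_def)

lemma SO_R_transpose_right: "k \<in> SO_R \<Longrightarrow> k ** transpose k = mat 1" for k :: "'n::finite cmat"
  by (simp add: SO_R_iff matrix_left_right_inverse)

lemma real_matrix_mult:
  "\<forall>i j. A $ i $ j \<in> \<real> \<Longrightarrow> \<forall>i j. B $ i $ j \<in> \<real> \<Longrightarrow> (A ** B) $ i $ j \<in> \<real>" for A B :: "'n::finite cmat"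
  unfolding matrix_matrix_mult_def by (auto intro!: sum_in_Reals)

lemma SO_R_mult: "k \<in> SO_R \<Longrightarrow> l \<in> SO_R \<Longrightarrow> k ** l \<in> SO_R" for k l :: "'n::finite cmat"
proof -
  assume k: "k \<in> SO_R" and l: "l \<in> SO_R"
  have "transpose (k ** l) ** (k ** l) = transpose l ** (transpose k ** k) ** l"
    by (simp add: matrix_transpose_mul matrix_mul_assoc)
  then show "k ** l \<in> SO_R" using k l real_matrix_mult by (auto simp: SO_R_iff det_mul)
qed

lemma SO_R_transpose: "k \<in> SO_R \<Longrightarrow> transpose k \<in> SO_R" for k :: "'n::finite cmat"
  using SO_R_transpose_right[of k] by (simp add: SO_R_iff det_transpose) (simp add: transpose_def)

lemma SO_R_one: "(mat 1 :: 'n::finite cmat) \<in> SO_R"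
  by (simp add: SO_R_iff transpose_mat) (simp add: mat_def)

lemma SO_R_norm:
  fixes k :: "'n::finite cmat"
  assumes "k \<in> SO_R"
  shows "norm (k $ i $ j) \<le> 1"
proof -
  have r: "k $ l $ j \<in> \<real>" for l using assms by (simp add: SO_R_iff)
  have "(transpose k ** k) $ j $ j = 1" using assms by (simp add: SO_R_iff mat_def)
  then have "(\<Sum>l\<in>UNIV. k $ l $ j * k $ l $ j) = 1" by (simp add: matrix_matrix_mult_def transpose_def)
  moreover have "k $ l $ j * k $ l $ j = of_real ((norm (k $ l $ j))\<^sup>2)" for l
  proof -
    obtain a where "k $ l $ j = of_real a" using r[of l] by (auto elim: Reals_cases)
    then show ?thesis by (simp add: power2_eq_square flip: of_real_mult)
  qed
  ultimately have "of_real (\<Sum>l\<in>UNIV. (norm (k $ l $ j))\<^sup>2) = (1 :: complex)" by simp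
  then have "(\<Sum>l\<in>UNIV. (norm (k $ l $ j))\<^sup>2) = 1" by (metis of_real_eq_1_iff)
  moreover have "(norm (k $ i $ j))\<^sup>2 \<le> (\<Sum>l\<in>UNIV. (norm (k $ l $ j))\<^sup>2)"
    by (rule member_le_sum) auto
  ultimately have "(norm (k $ i $ j))\<^sup>2 \<le> 1\<^sup>2" by simp
  then show ?thesis by (rule power2_le_imp_le) simp
qed

lemma compact_SO_R: "compact (SO_R :: 'n::finite cmat set)"
proof -
  have "bounded (SO_R :: 'n cmat set)"
  proof (rule boundedI)
    fix k :: "'n cmat" assume k: "k \<in> SO_R"
    have "norm k \<le> (\<Sum>i\<in>UNIV. norm (k $ i))" unfolding norm_vec_def[of k] by (rule L2_set_le_sum) simp
    also have "\<dots> \<le> (\<Sum>i\<in>(UNIV :: 'n set). \<Sum>j\<in>(UNIV :: 'n set). 1)"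
    proof (rule sum_mono)
      fix i
      have "norm (k $ i) \<le> (\<Sum>j\<in>UNIV. norm (k $ i $ j))" unfolding norm_vec_def[of "k $ i"] by (rule L2_set_le_sum) simp
      also have "\<dots> \<le> (\<Sum>j\<in>(UNIV :: 'n set). 1)" by (intro sum_mono SO_R_norm[OF k])
      finally show "norm (k $ i) \<le> (\<Sum>j\<in>(UNIV :: 'n set). 1)" .
    qed
    finally show "norm k \<le> (\<Sum>i\<in>(UNIV :: 'n set). \<Sum>j\<in>(UNIV :: 'n set). 1)" .
  qed
  moreover have "closed (SO_R :: 'n cmat set)"
  proof -
    have eq: "SO_R = {k :: 'n cmat. \<forall>i j. Im (k $ i $ j) = 0} \<inter> {k. transpose k ** k = mat 1} \<inter> {k. det k = 1}"
      by (auto simp: SO_R_iff complex_is_Real_iff)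
    have c1: "closed {k :: 'n cmat. \<forall>i j. Im (k $ i $ j) = 0}"
      by (intro closed_Collect_all closed_Collect_eq continuous_intros)
    have "continuous_on UNIV (\<lambda>k :: 'n cmat. transpose k)"
      unfolding transpose_def by (intro continuous_intros)
    then have c2: "closed {k :: 'n cmat. transpose k ** k = mat 1}"
      by (intro closed_Collect_eq continuous_intros)
    have c3: "closed {k :: 'n cmat. det k = 1}" by (intro closed_Collect_eq continuous_intros)
    show ?thesis unfolding eq by (intro closed_Int c1 c2 c3)
  qed
  ultimately show ?thesis by (simp add: compact_eq_bounded_closed)
qed

text \<open>
  Divide the equation \<open>k n\<^sup>T k n = 1\<close>, expanded at the identity, by \<open>s n\<close> and pass to the limit.
\<close>

lemma so_R_limit:
  fixes k :: "nat \<Rightarrow> 'n::finite cmat"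
  assumes k: "\<And>n. k n \<in> SO_R" "k \<longlonglongrightarrow> mat 1"
    and s: "\<And>n. s n > 0" and A: "(\<lambda>n. (1 / s n) *\<^sub>R (k n - mat 1)) \<longlonglongrightarrow> A"
  shows "A \<in> so_R"
proof -
  let ?a = "\<lambda>n. (1 / s n) *\<^sub>R (k n - mat 1)"
  have comp: "(\<lambda>n. ?a n $ i $ j) \<longlonglongrightarrow> A $ i $ j" for i j by (intro tendsto_vec_nth A)
  have im: "Im (A $ i $ j) = 0" for i j
  proof -
    have "Im (?a n $ i $ j) = 0" for n
      using k(1)[of n] by (auto simp: SO_R_iff complex_is_Real_iff mat_def)
    then have "(\<lambda>n. Im (?a n $ i $ j)) = (\<lambda>n. 0)" by (rule ext)
    then have "(\<lambda>n. 0) \<longlonglongrightarrow> Im (A $ i $ j)" using tendsto_Im[OF comp[of i j]] by (simp only:)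
    then show ?thesis by (simp only: LIMSEQ_const_iff)
  qed
  have skew: "A $ j $ i = - A $ i $ j" for i j
  proof -
    have tr: "(\<lambda>n. transpose (k n - mat 1)) \<longlonglongrightarrow> 0"
    proof -
      have "(\<lambda>n. k n - mat 1) \<longlonglongrightarrow> 0" using tendsto_diff[OF k(2) tendsto_const[of "mat 1"]] by simp
      then have "(\<lambda>n. \<chi> i j. (k n - mat 1) $ j $ i) \<longlonglongrightarrow> (\<chi> i j. (0 :: 'n cmat) $ j $ i)"
        by (intro tendsto_vec_lambda tendsto_vec_nth)
      then show ?thesis by (simp add: transpose_def zero_vec_def)
    qed
    have "?a n + transpose (?a n) + transpose (k n - mat 1) ** ?a n = 0" for n
    proof -
      have "transpose (k n) ** k n = mat 1" using k(1)[of n] by (simp add: SO_R_iff)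
      moreover have "transpose (k n - mat 1) = transpose (k n) - mat 1"
        by (simp add: transpose_def vec_eq_iff mat_def)
      ultimately have "(k n - mat 1) + transpose (k n - mat 1) + transpose (k n - mat 1) ** (k n - mat 1) = 0"
        by (simp add: matrix_mult_diff)
      moreover have "transpose (?a n) = (1 / s n) *\<^sub>R transpose (k n - mat 1)"
        by (simp add: transpose_def vec_eq_iff)
      ultimately show ?thesis
        by (simp only: matrix_mult_scaleR scaleR_add_right[symmetric] scaleR_zero_right)
    qed
    then have "(?a n + transpose (?a n) + transpose (k n - mat 1) ** ?a n) $ i $ j = 0" for n
      by (metis zero_index)
    moreover have "(?a n + transpose (?a n) + transpose (k n - mat 1) ** ?a n) $ i $ j =
        ?a n $ i $ j + ?a n $ j $ i + (transpose (k n - mat 1) ** ?a n) $ i $ j" for n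
      by (simp only: transpose_def vector_add_component vec_lambda_beta)
    ultimately have "(\<lambda>n. ?a n $ i $ j + ?a n $ j $ i + (transpose (k n - mat 1) ** ?a n) $ i $ j) = (\<lambda>n. 0)"
      by (simp only:)
    moreover have "(\<lambda>n. ?a n $ i $ j + ?a n $ j $ i + (transpose (k n - mat 1) ** ?a n) $ i $ j)
        \<longlonglongrightarrow> A $ i $ j + A $ j $ i + (0 ** A) $ i $ j"
      by (intro tendsto_add comp tendsto_vec_nth tendsto_matrix_mult tr A)
    ultimately have "(\<lambda>n. 0) \<longlonglongrightarrow> A $ i $ j + A $ j $ i + (0 ** A) $ i $ j" by (simp only:)
    then have "A $ i $ j + A $ j $ i + (0 ** A) $ i $ j = 0" by (simp only: LIMSEQ_const_iff)
    then have "A $ i $ j + A $ j $ i = 0" by simp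
    then show ?thesis by (simp add: add_eq_0_iff)
  qed
  have "transpose A $ i $ j = (- A) $ i $ j" for i j
    unfolding transpose_def vec_lambda_beta vector_uminus_component by (rule skew)
  then have "transpose A = - A" by (simp only: vec_eq_iff) simp
  then show ?thesis by (simp add: so_R_def complex_is_Real_iff im)
qed

definition herm :: "complex^('n::finite) \<Rightarrow> complex^'n \<Rightarrow> complex" where
  "herm x y = (\<Sum>i\<in>UNIV. x $ i * cnj (y $ i))"

lemma inner_herm: "x \<bullet> y = Re (herm x y)"
  by (simp add: inner_vec_def herm_def inner_complex_def)

lemma herm_linear:
  "herm (x + x') y = herm x y + herm x' y" "herm x (y + y') = herm x y + herm x y'"
  "herm (c *s x) y = c * herm x y" "herm x (c *s y) = cnj c * herm x y"
  "herm (x - x') y = herm x y - herm x' y" "herm x (y - y') = herm x y - herm x y'"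
  "herm 0 y = 0" "herm x 0 = 0" "herm (- x) y = - herm x y" "herm x (- y) = - herm x y"
  by (simp_all add: herm_def sum.distrib sum_distrib_left sum_subtractf sum_negf algebra_simps)

lemma herm_commute: "herm y x = cnj (herm x y)"
  by (simp add: herm_def mult.commute)

lemma herm_self: "herm x x = of_real ((norm x)\<^sup>2)"
proof -
  have "Re (herm x x) = (norm x)\<^sup>2" using inner_herm[of x x] by (simp add: power2_norm_eq_inner)
  moreover have "Im (herm x x) = 0" using herm_commute[of x x] by (simp add: complex_eq_iff)
  ultimately show ?thesis by (simp add: complex_eq_iff)
qed

lemma herm_adjoint:
  fixes A :: "'n::finite cmat"
  assumes "\<forall>i j. A $ i $ j \<in> \<real>"
  shows "herm (A *v x) y = herm x (transpose A *v y)"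
proof -
  have r: "cnj (A $ i $ j) = A $ i $ j" for i j using assms by (simp add: Reals_cnj_iff)
  have "herm (A *v x) y = (\<Sum>i\<in>UNIV. \<Sum>j\<in>UNIV. A $ i $ j * x $ j * cnj (y $ i))"
    by (simp add: herm_def matrix_vector_mult_def sum_distrib_right)
  also have "\<dots> = (\<Sum>j\<in>UNIV. \<Sum>i\<in>UNIV. A $ i $ j * x $ j * cnj (y $ i))" by (rule sum.swap)
  also have "\<dots> = herm x (transpose A *v y)"
    by (simp add: herm_def matrix_vector_mult_def transpose_def sum_distrib_left r mult_ac)
  finally show ?thesis .
qed

lemma herm_so_R: "A \<in> so_R \<Longrightarrow> herm (A *v x) y = - herm x (A *v y)" for A :: "'n::finite cmat"
proof -
  assume A: "A \<in> so_R"
  have "(- A) *v y = - (A *v y)" by (simp add: vec_eq_iff matrix_vector_mult_def sum_negf)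
  moreover have "herm (A *v x) y = herm x (transpose A *v y)"
    by (rule herm_adjoint) (use A in \<open>simp add: so_R_def\<close>)
  moreover have "transpose A = - A" using A by (simp add: so_R_def)
  ultimately show "herm (A *v x) y = - herm x (A *v y)" by (simp only: herm_linear)
qed

text \<open>The Cayley transform supplies curves in the orthogonal group with any prescribed tangent, inside the
  stabilizer of a flag whenever the tangent stabilizes it.\<close>

definition cayley :: "('n::finite) cmat \<Rightarrow> 'n cmat" where
  "cayley Y = (mat 1 + Y) ** matrix_inv (mat 1 - Y)"

lemma so_R_scaleR: "A \<in> so_R \<Longrightarrow> c *\<^sub>R A \<in> so_R" for A :: "'n::finite cmat"
proof -
  assume A: "A \<in> so_R"
  have "transpose (c *\<^sub>R A) = c *\<^sub>R transpose A" by (simp add: transpose_def vec_eq_iff)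
  then have "transpose (c *\<^sub>R A) = - (c *\<^sub>R A)" using A by (simp add: so_R_def)
  moreover have "(c *\<^sub>R A) $ i $ j \<in> \<real>" for i j
    using A by (simp add: so_R_def scaleR_conv_of_real[where 'a=complex])
  ultimately show "c *\<^sub>R A \<in> so_R" by (simp add: so_R_def)
qed

text \<open>
  The real skew matrix \<open>Y\<close> is skew Hermitian, so it does not have the eigenvalue 1.
\<close>

lemma det_cayley_denominator:
  fixes Y :: "'n::finite cmat"
  assumes "Y \<in> so_R"
  shows "det (mat 1 - Y) \<noteq> 0"
proof -
  have "x = 0" if "(mat 1 - Y) *v x = 0" for x
  proof -
    have "Y *v x = x" using that by (simp add: matrix_vector_mult_diff_rdistrib)
    then have "herm x x = - herm x x" using herm_so_R[OF assms, of x x] by simp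
    then have "herm x x = 0" by (simp add: eq_neg_iff_add_eq_0)
    then show "x = 0" by (simp add: herm_self)
  qed
  then have "\<exists>B. B ** (mat 1 - Y) = mat 1" by (simp add: matrix_left_invertible_ker)
  then have "invertible (mat 1 - Y)" by (simp add: invertible_left_inverse)
  then show ?thesis by (simp add: invertible_det_nz)
qed

lemma real_matrix_inv:
  fixes M :: "'n::finite cmat"
  assumes "\<forall>i j. M $ i $ j \<in> \<real>" "det M \<noteq> 0"
  shows "\<forall>i j. matrix_inv M $ i $ j \<in> \<real>"
proof -
  define B :: "'n cmat" where "B = (\<chi> i j. cnj (matrix_inv M $ i $ j))"
  have "B ** M = mat 1"
  proof -
    have "(B ** M) $ i $ j = cnj ((matrix_inv M ** M) $ i $ j)" for i j
    proof -
      have "cnj (M $ k $ j) = M $ k $ j" for k using assms(1) by (simp add: Reals_cnj_iff)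
      then show ?thesis by (simp add: B_def matrix_matrix_mult_def)
    qed
    then show ?thesis by (simp add: matrix_inv_left[OF assms(2)] vec_eq_iff) (simp add: mat_def)
  qed
  then have "B = matrix_inv M"
    by (metis assms(2) matrix_inv_right matrix_mul_assoc matrix_mul_lid matrix_mul_rid)
  then have "cnj (matrix_inv M $ i $ j) = matrix_inv M $ i $ j" for i j by (simp add: B_def vec_eq_iff)
  then show ?thesis by (simp add: Reals_cnj_iff)
qed

lemma transpose_add: "transpose (A + B) = transpose A + transpose B" 
  and transpose_diff: "transpose (A - B) = transpose A - transpose B" for A B :: "'n::finite cmat"
  by (simp_all add: transpose_def vec_eq_iff)

lemma cayley_SO:
  fixes Y :: "'n::finite cmat"
  assumes "Y \<in> so_R"
  shows "cayley Y \<in> SO_R"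
proof -
  let ?P = "mat 1 + Y" and ?M = "mat 1 - Y"
  have Yr: "\<forall>i j. Y $ i $ j \<in> \<real>" and Yt: "transpose Y = - Y" using assms by (auto simp: so_R_def)
  have d: "det ?M \<noteq> 0" by (rule det_cayley_denominator[OF assms])
  have tM: "transpose ?M = ?P" "transpose ?P = ?M" by (simp_all add: transpose_add transpose_diff Yt transpose_mat)
  have dP: "det ?P = det ?M" using det_transpose[of ?M] tM by simp
  have cM: "cayley Y ** ?M = ?P"
    unfolding cayley_def by (simp add: matrix_mul_assoc[symmetric] matrix_inv_left[OF d])
  have "\<forall>i j. ?M $ i $ j \<in> \<real>" "\<forall>i j. ?P $ i $ j \<in> \<real>" using Yr by (auto simp: mat_def)
  then have real: "\<forall>i j. cayley Y $ i $ j \<in> \<real>"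
    unfolding cayley_def using real_matrix_inv[OF _ d] real_matrix_mult by blast
  have "?P ** (transpose (cayley Y) ** cayley Y) ** ?M = transpose (cayley Y ** ?M) ** (cayley Y ** ?M)"
    by (simp add: matrix_transpose_mul tM matrix_mul_assoc)
  also have "\<dots> = ?M ** ?P" by (simp add: cM tM)
  also have "\<dots> = ?P ** ?M" by (simp add: matrix_mult_diff matrix_mult_add)
  finally have eq: "?P ** (transpose (cayley Y) ** cayley Y) ** ?M = ?P ** ?M" .
  have dP0: "det ?P \<noteq> 0" using d dP by simp
  have "transpose (cayley Y) ** cayley Y =
      matrix_inv ?P ** (?P ** (transpose (cayley Y) ** cayley Y) ** ?M) ** matrix_inv ?M"
    by (metis (no_types, lifting) d dP0 matrix_inv_left matrix_inv_right matrix_mul_assoc matrix_mul_lid matrix_mul_rid)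
  also have "\<dots> = mat 1"
    unfolding eq by (metis d dP0 matrix_inv_left matrix_inv_right matrix_mul_assoc matrix_mul_lid)
  finally have "transpose (cayley Y) ** cayley Y = mat 1" .
  moreover have "det (cayley Y) = 1"
    using det_matrix_inv[OF d] by (simp add: cayley_def det_mul dP mult.commute)
  ultimately show ?thesis using real by (simp add: SO_R_iff)
qed

lemma cayley_stab:
  fixes Y :: "('n::{finite,linorder}) cmat"
  assumes "Y \<in> so_R" "Y \<in> stab V" "V \<in> flags"
  shows "act (cayley Y) V = V"
proof
  fix i
  have d: "det (mat 1 - Y) \<noteq> 0" by (rule det_cayley_denominator[OF assms(1)])
  have sub: "vec.subspace (V i)" by (rule flagsD(2)[OF assms(3)])
  have Y: "Y *v x \<in> V i" if "x \<in> V i" for x using assms(2) that by (simp add: stab_def)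
  have M: "(\<lambda>x. (mat 1 - Y) *v x) ` V i = V i"
    by (rule invariant_subspace_image[OF d sub])
       (simp add: matrix_vector_mult_diff_rdistrib vec.subspace_diff[OF sub] Y)
  have dc: "det (cayley Y) \<noteq> 0" using cayley_SO[OF assms(1)] by (simp add: SO_R_iff)
  have "(\<lambda>x. cayley Y *v x) ` V i = V i"
  proof (rule invariant_subspace_image[OF dc sub])
    fix x assume "x \<in> V i"
    then obtain z where z: "z \<in> V i" "x = (mat 1 - Y) *v z" using M by blast
    have "cayley Y *v x = (mat 1 + Y) *v z"
      unfolding z cayley_def by (simp add: matrix_vector_mul_assoc matrix_mul_assoc[symmetric] matrix_inv_left[OF d])
    then show "cayley Y *v x \<in> V i"
      by (simp add: matrix_vector_mult_add_rdistrib vec.subspace_add[OF sub] Y z)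
  qed
  then show "act (cayley Y) V i = V i" by (simp add: act_def)
qed

text \<open>
  The Cayley transform is \<open>1 + 2 Y + \<dots>\<close> near 0, which explains the factor \<open>1/2\<close>.
\<close>

lemma cayley_tangent:
  fixes A :: "'n::finite cmat"
  assumes A: "A \<in> so_R" and s: "s \<longlonglongrightarrow> 0" "\<And>n. s n \<noteq> 0"
  shows "(\<lambda>n. (1 / s n) *\<^sub>R (cayley ((s n / 2) *\<^sub>R A) - mat 1)) \<longlonglongrightarrow> A"
    "(\<lambda>n. cayley ((s n / 2) *\<^sub>R A)) \<longlonglongrightarrow> mat 1"
proof -
  let ?Y = "\<lambda>n. (s n / 2) *\<^sub>R A"
  have d: "det (mat 1 - ?Y n) \<noteq> 0" for n by (rule det_cayley_denominator[OF so_R_scaleR[OF A]])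
  have "(\<lambda>n. (s n / 2) *\<^sub>R A) \<longlonglongrightarrow> (0 / 2) *\<^sub>R A" by (intro tendsto_intros s) simp
  then have m: "(\<lambda>n. mat 1 - ?Y n) \<longlonglongrightarrow> mat 1"
    using tendsto_diff[OF tendsto_const[of "mat 1"]] by fastforce
  have "(\<lambda>n. (mat 1 - ?Y n) ** matrix_inv (mat 1 - ?Y n)) \<longlonglongrightarrow> mat 1"
    by (simp add: matrix_inv_right[OF d])
  then have "(\<lambda>n. matrix_inv (mat 1 - ?Y n)) \<longlonglongrightarrow> matrix_inv (mat 1) ** mat 1"
    by (intro tendsto_solve[OF m]) simp_all
  moreover have "matrix_inv (mat 1 :: 'n cmat) ** mat 1 = mat 1" by (rule matrix_inv_left) simp
  ultimately have i: "(\<lambda>n. matrix_inv (mat 1 - ?Y n)) \<longlonglongrightarrow> mat 1" by simp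
  have c: "cayley (?Y n) - mat 1 = s n *\<^sub>R (A ** matrix_inv (mat 1 - ?Y n))" for n
  proof -
    have "mat 1 = (mat 1 - ?Y n) ** matrix_inv (mat 1 - ?Y n)" by (simp add: matrix_inv_right[OF d])
    then have "cayley (?Y n) - mat 1 = ((mat 1 + ?Y n) - (mat 1 - ?Y n)) ** matrix_inv (mat 1 - ?Y n)"
      by (simp only: cayley_def matrix_mult_diff(1))
    also have "(mat 1 + ?Y n) - (mat 1 - ?Y n) = s n *\<^sub>R A"
      by (simp add: scaleR_add_left[symmetric])
    finally show ?thesis by (simp add: matrix_mult_scaleR)
  qed
  have "(\<lambda>n. A ** matrix_inv (mat 1 - ?Y n)) \<longlonglongrightarrow> A ** mat 1" by (intro tendsto_intros i)
  then show l: "(\<lambda>n. (1 / s n) *\<^sub>R (cayley (?Y n) - mat 1)) \<longlonglongrightarrow> A"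
    using s(2) by (simp add: c)
  have "(\<lambda>n. s n *\<^sub>R (A ** matrix_inv (mat 1 - ?Y n)) + mat 1) \<longlonglongrightarrow> 0 *\<^sub>R (A ** mat 1) + mat 1"
    by (intro tendsto_intros s i)
  then show "(\<lambda>n. cayley (?Y n)) \<longlonglongrightarrow> mat 1" by (simp add: c[symmetric])
qed

section \<open>The dimension of a submanifold\<close>

text \<open>
  Near a common point, the parametrization of \<open>M\<close> followed by the inverse of that of \<open>N\<close> is a continuous injection
  between open subsets of the two parameter spaces, and invariance of dimension applies.
\<close>

lemma submanifold_dim_mono:
  fixes M N :: "('n::{finite,linorder}) flag set"
  assumes M: "complex_submanifold e M" "M \<noteq> {}" and N: "complex_submanifold d N" and sub: "M \<subseteq> N"
  shows "e \<le> d"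
proof -
  obtain V where V: "V \<in> M" using M(2) by blast
  then have VN: "V \<in> N" using sub by blast
  obtain g1 and W1 :: "(complex^('n \<times> 'n)) set" and U1 f1 x1 where
    c1: "g1 \<in> SL_C" "vec.subspace W1" "vec.dim W1 = e" "openin (top_of_set W1) U1" "f1 ` U1 \<subseteq> lower_unitriangular"
    "holomorphic_immersion_on W1 U1 f1" "embedding_map (top_of_set U1) flag_topology (chart g1 \<circ> f1)"
    "x1 \<in> U1" "V = chart g1 (f1 x1)" "openin (subtopology flag_topology M) ((chart g1 \<circ> f1) ` U1)"
    by (rule complex_submanifold_chart[OF M(1) V]) blast
  obtain g2 and W2 :: "(complex^('n \<times> 'n)) set" and U2 f2 x2 where
    c2: "g2 \<in> SL_C" "vec.subspace W2" "vec.dim W2 = d" "openin (top_of_set W2) U2" "f2 ` U2 \<subseteq> lower_unitriangular"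
    "holomorphic_immersion_on W2 U2 f2" "embedding_map (top_of_set U2) flag_topology (chart g2 \<circ> f2)"
    "x2 \<in> U2" "V = chart g2 (f2 x2)" "openin (subtopology flag_topology N) ((chart g2 \<circ> f2) ` U2)"
    by (rule complex_submanifold_chart[OF N VN]) blast
  let ?F1 = "chart g1 \<circ> f1" and ?F2 = "chart g2 \<circ> f2"
  have F1: "continuous_map (top_of_set U1) flag_topology ?F1" "inj_on ?F1 U1"
    using embedding_mapD[OF c1(7)] by simp_all
  have F1M: "?F1 ` U1 \<subseteq> M" using openin_subset[OF c1(10)] by simp
  obtain T where T: "openin flag_topology T" "?F2 ` U2 = T \<inter> N"
    using c2(10) unfolding openin_subtopology by blast
  obtain k where k: "continuous_map (subtopology flag_topology (?F2 ` U2)) (top_of_set U2) k"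
    "\<And>y. y \<in> U2 \<Longrightarrow> k (?F2 y) = y"
    using embedding_map_inverse[OF c2(7)] by (metis topspace_euclidean_subtopology)
  define U' where "U' = {y \<in> U1. ?F1 y \<in> T}"
  have "openin (top_of_set U1) U'"
    using openin_continuous_map_preimage[OF F1(1) T(1)] by (simp add: U'_def)
  then have U': "openin (top_of_set W1) U'" using c1(4) openin_trans by blast
  have im: "?F1 y \<in> ?F2 ` U2" if "y \<in> U'" for y
    using that F1M sub T(2) unfolding U'_def by blast
  have kF: "k (?F1 y) \<in> U2 \<and> ?F2 (k (?F1 y)) = ?F1 y" if y: "y \<in> U'" for y
  proof -
    obtain z where "z \<in> U2" "?F1 y = ?F2 z" using im[OF y] by blast
    then show ?thesis using k(2) by simp
  qed
  have U2W: "U2 \<subseteq> W2" using openin_imp_subset[OF c2(4)] .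
  have "dim W1 \<le> dim W2"
  proof (rule invariance_of_dimension_subspaces[OF U'])
    show "subspace W1" "subspace W2" by (intro real_subspace c1(2) c2(2))+
    have "continuous_map (top_of_set U') flag_topology ?F1"
      by (rule continuous_map_from_subtopology_mono[OF F1(1)]) (auto simp: U'_def)
    moreover have "?F1 ` U' \<subseteq> ?F2 ` U2" by (rule image_subsetI) (rule im)
    ultimately have "continuous_map (top_of_set U') (subtopology flag_topology (?F2 ` U2)) ?F1"
      by (simp only: continuous_map_in_subtopology image_subset_iff_funcset topspace_euclidean_subtopology)
    from continuous_map_compose[OF this k(1)]
    show "continuous_on U' (k \<circ> ?F1)"
      by (simp only: continuous_map_in_subtopology continuous_map_iff_continuous)
    show "k \<circ> ?F1 \<in> U' \<rightarrow> W2" using kF U2W by auto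
    show "inj_on (k \<circ> ?F1) U'"
    proof (rule inj_onI)
      fix y z assume yz: "y \<in> U'" "z \<in> U'" "(k \<circ> ?F1) y = (k \<circ> ?F1) z"
      then have "?F1 y = ?F1 z" using kF[OF yz(1)] kF[OF yz(2)] by (metis comp_apply)
      then show "y = z" using F1(2) yz unfolding U'_def inj_on_def by blast
    qed
    have "V \<in> ?F2 ` U2" using c2(8,9) by auto
    then have "V \<in> T" using T(2) by blast
    then have "?F1 x1 \<in> T" using c1(9) by simp
    then show "U' \<noteq> {}" using c1(8) by (auto simp: U'_def)
  qed
  then show ?thesis using real_dim_eq[OF c1(2)] real_dim_eq[OF c2(2)] c1(3) c2(3) by simp
qed

lemma cdim_submanifold:
  fixes M :: "('n::{finite,linorder}) flag set"
  assumes "complex_submanifold d M" "M \<noteq> {}"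
  shows "cdim M = d"
  using assms submanifold_dim_mono by (intro cdim_eqI[of M M d]) blast+

text \<open>
  The remainder of the first-order expansion is small in comparison with \<open>x n - x0\<close>, whose quotient by \<open>s n\<close> is bounded.
\<close>

lemma derivative_along_sequence:
  fixes f :: "'a::euclidean_space \<Rightarrow> 'b::euclidean_space"
  assumes der: "(f has_derivative f') (at x0 within W)" and x: "\<And>n. x n \<in> W" "x \<longlonglongrightarrow> x0"
    and s: "\<And>n. s n > 0" and a: "(\<lambda>n. (1 / s n) *\<^sub>R (x n - x0)) \<longlonglongrightarrow> \<alpha>"
  shows "(\<lambda>n. (1 / s n) *\<^sub>R (f (x n) - f x0)) \<longlonglongrightarrow> f' \<alpha>"
proof -
  have bl: "bounded_linear f'" using der by (rule has_derivative_bounded_linear)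
  define r where "r n = f (x n) - f x0 - f' (x n - x0)" for n
  obtain B where B: "\<And>n. norm ((1 / s n) *\<^sub>R (x n - x0)) \<le> B" "B > 0"
    using convergent_imp_Bseq[OF convergentI[OF a]] unfolding Bseq_def by blast
  have "(\<lambda>n. (1 / s n) *\<^sub>R r n) \<longlonglongrightarrow> 0"
  proof (rule tendstoI)
    fix e :: real assume e: "e > 0"
    then have "e / (2 * B) > 0" using B(2) by simp
    then obtain \<delta> where \<delta>: "\<delta> > 0"
      "\<And>y. y \<in> W \<Longrightarrow> norm (y - x0) < \<delta> \<Longrightarrow> norm (f y - f x0 - f' (y - x0)) \<le> e / (2 * B) * norm (y - x0)"
      using der unfolding has_derivative_within_alt by blast
    have "eventually (\<lambda>n. dist (x n) x0 < \<delta>) sequentially" using tendstoD[OF x(2) \<delta>(1)] .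
    then show "eventually (\<lambda>n. dist ((1 / s n) *\<^sub>R r n) 0 < e) sequentially"
    proof eventually_elim
      case (elim n)
      have "norm (r n) \<le> e / (2 * B) * norm (x n - x0)"
        unfolding r_def using \<delta>(2)[OF x(1)] elim by (simp add: dist_norm)
      then have "norm ((1 / s n) *\<^sub>R r n) \<le> e / (2 * B) * norm ((1 / s n) *\<^sub>R (x n - x0))"
      proof -
        have "norm ((1 / s n) *\<^sub>R z) = norm z / s n" for z :: 'b
          using s[of n] by simp
        moreover have "norm ((1 / s n) *\<^sub>R z) = norm z / s n" for z :: 'a
          using s[of n] by simp
        moreover have "norm (r n) / s n \<le> e / (2 * B) * norm (x n - x0) / s n"
          using \<open>norm (r n) \<le> _\<close> s[of n] by (intro divide_right_mono) auto
        ultimately show ?thesis using s[of n] by simp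
      qed
      also have "\<dots> \<le> e / (2 * B) * B" using B(1)[of n] e B(2) by (intro mult_left_mono) auto
      also have "\<dots> < e" using e B(2) by simp
      finally show ?case by simp
    qed
  qed
  moreover have "(\<lambda>n. f' ((1 / s n) *\<^sub>R (x n - x0))) \<longlonglongrightarrow> f' \<alpha>"
    by (rule bounded_linear.tendsto[OF bl a])
  ultimately have "(\<lambda>n. f' ((1 / s n) *\<^sub>R (x n - x0)) + (1 / s n) *\<^sub>R r n) \<longlonglongrightarrow> f' \<alpha> + 0"
    by (intro tendsto_add)
  moreover have "f' ((1 / s n) *\<^sub>R (x n - x0)) + (1 / s n) *\<^sub>R r n = (1 / s n) *\<^sub>R (f (x n) - f x0)" for n
  proof -
    have "f' ((1 / s n) *\<^sub>R (x n - x0)) = (1 / s n) *\<^sub>R f' (x n - x0)"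
      by (rule linear_scale[OF bounded_linear.linear[OF bl]])
    then show ?thesis by (simp add: r_def scaleR_add_right[symmetric])
  qed
  ultimately show ?thesis by simp
qed

section \<open>The tangent space of an orbit that is a complex submanifold\<close>

text \<open>
  On a type of matrices the scalars of the operation \<open>*s\<close> would be vectors, so complex scalars need a separate operation.
\<close>

definition cmul :: "complex \<Rightarrow> ('n::finite) cmat \<Rightarrow> 'n cmat" where
  "cmul c A = (\<chi> i j. c * A $ i $ j)"

text \<open>
  The orbit \<open>C\<close> of \<open>V\<close> is locally parametrized by \<open>u \<mapsto> chart g (f u)\<close> for \<open>u\<close> in an open subset of \<open>W\<close>, where \<open>x0\<close> is the
  parameter of \<open>V\<close>. Via \<open>h\<close>, the tangent space of the flag manifold at \<open>V\<close> is identified with the space of strictly lower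
  triangular matrices; \<open>\<Lambda>\<close> is the differential of the parametrization and \<open>\<Theta>\<close> that of the group action. The aim is
  \<open>\<Theta> ` so_R = \<Lambda> ` W\<close>: both describe the tangent space of \<open>C\<close>.
\<close>

context
  fixes C :: "('n::{finite,linorder}) flag set" and V :: "'n flag" and g h :: "'n cmat"
    and W U :: "(complex^('n \<times> 'n)) set" and f f' and x0 and \<Lambda> \<Theta>
  assumes C: "C = orbit SO_R V" and g: "g \<in> SL_C" and W: "vec.subspace W"
    and U: "openin (top_of_set W) U" and f: "f ` U \<subseteq> lower_unitriangular"
    and emb: "embedding_map (top_of_set U) flag_topology (chart g \<circ> f)"
    and x0: "x0 \<in> U" and V: "V = chart g (f x0)"
    and openC: "openin (subtopology flag_topology C) ((chart g \<circ> f) ` U)"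
    and der: "(f has_derivative f') (at x0 within W)" and inj: "inj_on f' W"
    and h: "h = g ** f x0"
    and Lam: "\<Lambda> = (\<lambda>v. low (matrix_inv h ** g ** f' v))" and Theta: "\<Theta> = (\<lambda>A. low (matrix_inv h ** A ** h))"
begin

lemma UW: "U \<subseteq> W" using openin_imp_subset[OF U] .

lemma x0W: "x0 \<in> W" using UW x0 by blast

lemma dets: "det g = 1" "det h = 1" "u \<in> U \<Longrightarrow> det (g ** f u) = 1"
proof -
  show g1: "det g = 1" using g by (simp add: SL_C_def)
  show "det (g ** f u) = 1" if "u \<in> U" for u
    using g1 det_lower_unitriangular[of "f u"] f that by (auto simp: det_mul)
  from this[OF x0] show "det h = 1" by (simp add: h)
qed

lemma V_h: "V = act h std_flag" by (simp add: V chart_def h)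

lemma linear_Lam: "linear \<Lambda>"
proof -
  have "linear f'" using has_derivative_bounded_linear[OF der] by (rule bounded_linear.linear)
  moreover have "linear (\<lambda>X :: 'n cmat. matrix_inv h ** g ** X)"
    by (rule linearI) (simp_all add: matrix_mult_add matrix_mult_scaleR)
  ultimately have "linear (low \<circ> ((\<lambda>X :: 'n cmat. matrix_inv h ** g ** X) \<circ> f'))"
    by (intro linear_compose linear_low)
  then show ?thesis by (simp add: Lam o_def)
qed

lemma linear_Theta: "linear \<Theta>"
proof -
  have "linear (\<lambda>A. matrix_inv h ** A ** h)"
    by (rule linearI) (simp_all add: matrix_mult_add matrix_mult_scaleR)
  then have "linear (low \<circ> (\<lambda>A. matrix_inv h ** A ** h))" by (intro linear_compose linear_low)
  then show ?thesis by (simp add: Theta o_def)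
qed

lemma Theta_0: "\<Theta> A = 0 \<longleftrightarrow> A \<in> stab V"
  using dets(2) by (simp add: Theta low_eq_0 V_h stab_iff)

text \<open>
  The equation between flags means \<open>k n ** h = g ** f (x n) ** p n\<close> with upper triangular \<open>p n\<close>. Only the limit of \<open>p n\<close>
  matters for the first-order expansion modulo upper triangular matrices, so no differentiability of \<open>p\<close> is required.
\<close>

lemma first_order:
  assumes x: "\<And>n. x n \<in> U" "x \<longlonglongrightarrow> x0" and k: "\<And>n. k n \<in> SO_R" "k \<longlonglongrightarrow> mat 1"
    and eq: "\<And>n. act (k n) V = chart g (f (x n))" and s: "\<And>n. s n > 0"
    and a: "(\<lambda>n. (1 / s n) *\<^sub>R (x n - x0)) \<longlonglongrightarrow> \<alpha>"
    and A: "(\<lambda>n. (1 / s n) *\<^sub>R (k n - mat 1)) \<longlonglongrightarrow> A"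
  shows "\<Theta> A = \<Lambda> \<alpha>"
proof -
  define m where "m n = g ** f (x n)" for n
  define p where "p n = matrix_inv (m n) ** (k n ** h)" for n
  have dm: "det (m n) = 1" for n unfolding m_def by (rule dets(3)[OF x(1)])
  have xW: "x n \<in> W" for n using x(1) UW by blast
  have D: "(\<lambda>n. (1 / s n) *\<^sub>R (f (x n) - f x0)) \<longlonglongrightarrow> f' \<alpha>"
    by (rule derivative_along_sequence[OF der xW x(2) s a])
  have "(f \<circ> x) \<longlonglongrightarrow> f x0"
    using has_derivative_continuous[OF der] xW x(2) unfolding continuous_within_sequentially by blast
  then have "(\<lambda>n. f (x n)) \<longlonglongrightarrow> f x0" by (simp add: o_def)
  then have m: "m \<longlonglongrightarrow> h" unfolding m_def h by (intro tendsto_intros)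
  have mp: "m n ** p n = k n ** h" for n
    unfolding p_def using dm[of n] by (simp add: matrix_mul_assoc matrix_inv_right)
  have pu: "p n \<in> upper_tri" for n
  proof -
    have "act (k n ** h) std_flag = act (m n) std_flag"
      using eq[of n] by (simp add: V_h act_act chart_def m_def)
    moreover have "det (k n ** h) = 1" using k(1)[of n] dets(2) by (simp add: SO_R_iff det_mul)
    ultimately show ?thesis unfolding p_def using dm[of n] by (subst act_std_flag_eq_iff[symmetric]) simp_all
  qed
  have "(\<lambda>n. m n ** p n) \<longlonglongrightarrow> mat 1 ** h" unfolding mp by (intro tendsto_intros k(2))
  then have "p \<longlonglongrightarrow> matrix_inv h ** (mat 1 ** h)" using dets(2) by (intro tendsto_solve[OF m]) simp_all
  then have p: "p \<longlonglongrightarrow> mat 1" using dets(2) by (simp add: matrix_inv_left)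
  have key: "low (matrix_inv h ** g ** ((1 / s n) *\<^sub>R (f (x n) - f x0)) ** p n) =
      low (matrix_inv h ** ((1 / s n) *\<^sub>R (k n - mat 1)) ** h)" for n
  proof -
    have "matrix_inv h ** (k n - mat 1) ** h = matrix_inv h ** (m n ** p n) - mat 1"
      using dets(2) by (simp add: matrix_mult_diff mp matrix_inv_left matrix_mul_assoc)
    also have "\<dots> = matrix_inv h ** (m n - h) ** p n + (p n - mat 1)"
      using dets(2) by (simp add: matrix_mult_diff matrix_inv_left matrix_mul_assoc)
    also have "m n - h = g ** (f (x n) - f x0)" by (simp add: m_def h matrix_mult_diff)
    finally have e: "matrix_inv h ** (k n - mat 1) ** h =
        matrix_inv h ** g ** (f (x n) - f x0) ** p n + (p n - mat 1)" by (simp add: matrix_mul_assoc)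
    have "p n - mat 1 \<in> upper_tri" using pu[of n] by (auto simp: upper_tri_def mat_def)
    then have "low (p n - mat 1) = 0" by (simp add: low_eq_0)
    then have "low (matrix_inv h ** (k n - mat 1) ** h) = low (matrix_inv h ** g ** (f (x n) - f x0) ** p n)"
      unfolding e by (simp only: linear_add[OF linear_low] add_0_right)
    then show ?thesis by (simp add: matrix_mult_scaleR linear_scale[OF linear_low])
  qed
  have "(\<lambda>n. low (matrix_inv h ** g ** ((1 / s n) *\<^sub>R (f (x n) - f x0)) ** p n)) \<longlonglongrightarrow>
      low (matrix_inv h ** g ** f' \<alpha> ** mat 1)"
    by (intro tendsto_low tendsto_matrix_mult tendsto_const D p)
  moreover have "(\<lambda>n. low (matrix_inv h ** ((1 / s n) *\<^sub>R (k n - mat 1)) ** h)) \<longlonglongrightarrow> low (matrix_inv h ** A ** h)"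
    by (intro tendsto_low tendsto_matrix_mult tendsto_const A)
  ultimately have "low (matrix_inv h ** g ** f' \<alpha> ** mat 1) = low (matrix_inv h ** A ** h)"
    unfolding key by (rule LIMSEQ_unique)
  then show ?thesis by (simp add: Lam Theta)
qed

lemma small_steps:
  assumes "v \<in> W"
  obtains s where "\<And>n. s n > 0" "s \<longlonglongrightarrow> 0" "\<And>n. x0 + s n *\<^sub>R v \<in> U" "(\<lambda>n. x0 + s n *\<^sub>R v) \<longlonglongrightarrow> x0"
proof -
  obtain e where e: "e > 0" "\<And>y. y \<in> W \<Longrightarrow> dist y x0 < e \<Longrightarrow> y \<in> U"
    using U x0 unfolding openin_euclidean_subtopology_iff by blast
  define s where "s n = e / (norm v + 1) * (1 / real (Suc n))" for n
  have pos: "s n > 0" for n using e(1) by (simp add: s_def add_nonneg_pos)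
  have lim: "s \<longlonglongrightarrow> 0"
  proof -
    have "(\<lambda>n. e / (norm v + 1) * (1 / real (Suc n))) \<longlonglongrightarrow> e / (norm v + 1) * 0"
      by (intro tendsto_mult tendsto_const LIMSEQ_Suc lim_1_over_n)
    then show ?thesis by (simp only: s_def[symmetric] mult_zero_right)
  qed
  have "x0 + s n *\<^sub>R v \<in> U" for n
  proof (rule e(2))
    show "x0 + s n *\<^sub>R v \<in> W"
      using real_subspace[OF W] x0W assms by (simp add: subspace_add subspace_scale)
    have "s n \<le> e / (norm v + 1)"
    proof -
      have "e / (norm v + 1) * (1 / real (Suc n)) \<le> e / (norm v + 1) * 1"
        using e(1) by (intro mult_left_mono) auto
      then show ?thesis by (simp add: s_def)
    qed
    then have "s n * norm v \<le> e / (norm v + 1) * norm v" by (intro mult_right_mono) auto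
    also have "\<dots> < e"
    proof -
      have "norm v + 1 > 0" by (simp add: add_nonneg_pos)
      then show ?thesis using e(1) by (simp add: pos_divide_less_eq)
    qed
    finally show "dist (x0 + s n *\<^sub>R v) x0 < e" using pos[of n] by (simp add: dist_norm)
  qed
  moreover have "(\<lambda>n. x0 + s n *\<^sub>R v) \<longlonglongrightarrow> x0 + 0 *\<^sub>R v" by (intro tendsto_intros lim)
  ultimately show ?thesis using that[of s] pos lim by simp
qed

lemma derivative_strictly_lower:
  assumes v: "v \<in> W" and ij: "\<not> j < i"
  shows "f' v $ i $ j = 0"
proof -
  obtain s where s: "\<And>n. s n > 0" "s \<longlonglongrightarrow> 0" "\<And>n. x0 + s n *\<^sub>R v \<in> U" "(\<lambda>n. x0 + s n *\<^sub>R v) \<longlonglongrightarrow> x0"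
    by (rule small_steps[OF v]) blast
  have "(1 / s n) *\<^sub>R (x0 + s n *\<^sub>R v - x0) = v" for n using s(1)[of n] by simp
  then have "(\<lambda>n. (1 / s n) *\<^sub>R (x0 + s n *\<^sub>R v - x0)) \<longlonglongrightarrow> v" by simp
  then have "(\<lambda>n. (1 / s n) *\<^sub>R (f (x0 + s n *\<^sub>R v) - f x0)) \<longlonglongrightarrow> f' v"
    using s(3) UW by (intro derivative_along_sequence[OF der _ s(4) s(1)]) auto
  then have l: "(\<lambda>n. ((1 / s n) *\<^sub>R (f (x0 + s n *\<^sub>R v) - f x0)) $ i $ j) \<longlonglongrightarrow> f' v $ i $ j"
    by (intro tendsto_vec_nth)
  have "f y $ i $ j = f x0 $ i $ j" if "y \<in> U" for y
  proof -
    have L: "f y \<in> lower_unitriangular" "f x0 \<in> lower_unitriangular" using f that x0 by auto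
    consider "i = j" | "i < j" using ij by (meson linorder_neqE)
    then show ?thesis using L by cases (simp_all add: lower_unitriangular_def)
  qed
  then have "((1 / s n) *\<^sub>R (f (x0 + s n *\<^sub>R v) - f x0)) $ i $ j = 0" for n using s(3)[of n] by simp
  then have "(\<lambda>n. 0) \<longlonglongrightarrow> f' v $ i $ j" using l by (simp only:)
  then show ?thesis by (simp only: LIMSEQ_const_iff)
qed

text \<open>
  If \<open>f' v = f x0 ** r\<close> with upper triangular \<open>r\<close>, then \<open>f x0 ** (mat 1 + r) = f x0 + f' v\<close> is lower unitriangular,
  and uniqueness of triangular factors gives \<open>f' v = 0\<close>.
\<close>

lemma Lam_0:
  assumes v: "v \<in> W" and 0: "\<Lambda> v = 0"
  shows "v = 0"
proof -
  define r where "r = matrix_inv h ** g ** f' v"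
  have ru: "r \<in> upper_tri" using 0 by (simp add: Lam low_eq_0 r_def)
  have "g ** (f x0 ** r) = h ** r" by (simp add: h matrix_mul_assoc)
  also have "\<dots> = g ** f' v" using dets(2) by (simp add: r_def matrix_mul_assoc matrix_inv_right)
  finally have "matrix_inv g ** (g ** (f x0 ** r)) = matrix_inv g ** (g ** f' v)" by simp
  then have e: "f x0 ** r = f' v" using dets(1) by (simp add: matrix_mul_assoc matrix_inv_left)
  have L0: "f x0 \<in> lower_unitriangular" using f x0 by blast
  have L: "f x0 + f' v \<in> lower_unitriangular"
    using L0 derivative_strictly_lower[OF v] by (auto simp: lower_unitriangular_def)
  have R: "mat 1 + r \<in> upper_tri" using ru by (auto simp: upper_tri_def mat_def)
  have "f x0 ** (mat 1 + r) = f x0 + f' v" by (simp add: matrix_mult_add e)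
  from lower_upper_unique(1)[OF L L0 R this] have "f' v = 0" by simp
  moreover have "f' 0 = 0" using has_derivative_bounded_linear[OF der] by (simp add: bounded_linear.linear linear_0)
  ultimately show "v = 0" using inj v vec.subspace_0[OF W] by (metis inj_onD)
qed

text \<open>
  The submanifold carries the subspace topology, so matrices near \<open>h\<close> whose flag is in \<open>C\<close> have parameters near \<open>x0\<close>.
\<close>

lemma neighbourhood:
  assumes "e > 0"
  obtains T where "open T" "h \<in> T"
    "\<And>m. m \<in> SL_C \<Longrightarrow> m \<in> T \<Longrightarrow> act m std_flag \<in> C \<Longrightarrow> \<exists>x\<in>U. dist x x0 < e \<and> chart g (f x) = act m std_flag"
proof -
  let ?F = "chart g \<circ> f"
  obtain T1 where T1: "openin flag_topology T1" "?F ` U = T1 \<inter> C"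
    using openC unfolding openin_subtopology by blast
  have "homeomorphic_map (top_of_set U) (subtopology flag_topology (?F ` U)) ?F"
    using emb by (simp add: embedding_map_def)
  then have "open_map (top_of_set U) (subtopology flag_topology (?F ` U)) ?F"
    by (rule homeomorphic_imp_open_map)
  moreover have "openin (top_of_set U) (U \<inter> ball x0 e)" by (simp add: openin_open_Int)
  ultimately have "openin (subtopology flag_topology (?F ` U)) (?F ` (U \<inter> ball x0 e))"
    unfolding open_map_def by blast
  then obtain T2 where T2: "openin flag_topology T2" "?F ` (U \<inter> ball x0 e) = T2 \<inter> ?F ` U"
    unfolding openin_subtopology by blast
  have "openin flag_topology (T1 \<inter> T2)" using T1(1) T2(1) by (rule openin_Int)
  then have "openin (top_of_set SL_C) {m \<in> SL_C. act m std_flag \<in> T1 \<inter> T2}"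
    by (simp only: openin_flag_topology)
  then obtain T where T: "open T" "{m \<in> SL_C. act m std_flag \<in> T1 \<inter> T2} = SL_C \<inter> T"
    unfolding openin_open by blast
  show ?thesis
  proof (rule that[OF T(1)])
    have "V \<in> ?F ` U" using V x0 by auto
    then have "V \<in> T1" unfolding T1(2) by (rule IntD1)
    moreover have "V \<in> ?F ` (U \<inter> ball x0 e)" using V x0 assms by auto
    then have "V \<in> T2" unfolding T2(2) by (rule IntD1)
    ultimately have "act h std_flag \<in> T1 \<inter> T2" unfolding V_h[symmetric] by (rule IntI)
    moreover have "h \<in> SL_C" using dets(2) by (simp add: SL_C_def)
    ultimately show "h \<in> T" using T(2) by blast
    fix m assume m: "m \<in> SL_C" "m \<in> T" "act m std_flag \<in> C"
    then have "act m std_flag \<in> T1 \<inter> T2" using T(2) by blast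
    then have "act m std_flag \<in> ?F ` U" unfolding T1(2) using m(3) by blast
    then have "act m std_flag \<in> ?F ` (U \<inter> ball x0 e)"
      unfolding T2(2) using \<open>act m std_flag \<in> T1 \<inter> T2\<close> by blast
    then show "\<exists>x\<in>U. dist x x0 < e \<and> chart g (f x) = act m std_flag"
      by (auto simp: dist_commute)
  qed
qed

text \<open>
  The curve with tangent \<open>A\<close> in the orthogonal group yields flags in \<open>C\<close> with parameters \<open>x j\<close>, about whose
  differentiability nothing is known. But after division by their total size \<open>\<sigma> j\<close>, the increments of the parameters and
  of the time accumulate at some \<open>(\<alpha>, \<tau>)\<close> with \<open>\<parallel>\<alpha>\<parallel> + \<tau> = 1\<close>, and the first-order expansion gives \<open>\<tau> \<Theta> A = \<Lambda> \<alpha>\<close>. Here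
  \<open>\<tau> \<noteq> 0\<close>, since \<open>\<Lambda>\<close> is injective on \<open>W\<close>.
\<close>

lemma tangent_1:
  assumes A: "A \<in> so_R"
  shows "\<exists>v\<in>W. \<Theta> A = \<Lambda> v"
proof -
  define t where "t n = 1 / real (Suc n)" for n
  have t0: "t \<longlonglongrightarrow> 0" unfolding t_def by (intro LIMSEQ_Suc lim_1_over_n)
  have tp: "t n > 0" for n by (simp add: t_def)
  have tn: "t n \<noteq> 0" for n using tp[of n] by simp
  define c where "c n = cayley ((t n / 2) *\<^sub>R A)" for n
  have cS: "c n \<in> SO_R" for n unfolding c_def by (intro cayley_SO so_R_scaleR A)
  have c1: "c \<longlonglongrightarrow> mat 1" and cA: "(\<lambda>n. (1 / t n) *\<^sub>R (c n - mat 1)) \<longlonglongrightarrow> A"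
    using cayley_tangent[OF A t0 tn] unfolding c_def by simp_all
  have "\<exists>n x. j \<le> n \<and> x \<in> U \<and> dist x x0 < t j \<and> chart g (f x) = act (c n) V" for j
  proof -
    obtain T where T: "open T" "h \<in> T" "\<And>m. m \<in> SL_C \<Longrightarrow> m \<in> T \<Longrightarrow> act m std_flag \<in> C \<Longrightarrow>
        \<exists>x\<in>U. dist x x0 < t j \<and> chart g (f x) = act m std_flag"
      by (rule neighbourhood[OF tp]) blast
    have "(\<lambda>n. c n ** h) \<longlonglongrightarrow> mat 1 ** h" by (intro tendsto_intros c1)
    then have "eventually (\<lambda>n. c n ** h \<in> T) sequentially" using T(1,2) by (intro topological_tendstoD) simp_all
    then obtain N where N: "\<And>n. n \<ge> N \<Longrightarrow> c n ** h \<in> T" unfolding eventually_sequentially by blast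
    let ?n = "max N j"
    have "act (c ?n ** h) std_flag = act (c ?n) V" by (simp add: V_h act_act)
    moreover have "act (c ?n) V \<in> C" using cS[of ?n] unfolding C orbit_def by blast
    moreover have "c ?n ** h \<in> SL_C" using cS[of ?n] dets(2) by (simp add: SO_R_iff SL_C_def det_mul)
    ultimately obtain x where "x \<in> U" "dist x x0 < t j" "chart g (f x) = act (c ?n) V"
      using T(3)[of "c ?n ** h"] N[of ?n] by auto
    then show ?thesis by (intro exI[of _ ?n] exI[of _ x]) simp
  qed
  then obtain \<nu> x where \<nu>: "\<And>j. j \<le> \<nu> j" and xU: "\<And>j. x j \<in> U" and xd: "\<And>j. dist (x j) x0 < t j"
    and xe: "\<And>j. chart g (f (x j)) = act (c (\<nu> j)) V" by metis
  have \<nu>lim: "filterlim \<nu> sequentially sequentially"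
    using \<nu> by (intro filterlim_at_top_mono[OF filterlim_ident]) auto
  have xl: "x \<longlonglongrightarrow> x0"
  proof -
    have "eventually (\<lambda>j. 0 \<le> dist (x j) x0) sequentially" "eventually (\<lambda>j. dist (x j) x0 \<le> t j) sequentially"
      by (simp_all add: less_imp_le[OF xd])
    then have "(\<lambda>j. dist (x j) x0) \<longlonglongrightarrow> 0" by (rule tendsto_sandwich[OF _ _ tendsto_const t0])
    then show ?thesis by (rule tendsto_dist_iff[THEN iffD2])
  qed
  define s where "s j = t (\<nu> j)" for j
  have s: "s j > 0" for j by (simp add: s_def tp)
  define \<sigma> where "\<sigma> j = s j + norm (x j - x0)" for j
  have \<sigma>: "\<sigma> j > 0" for j using s[of j] by (simp add: \<sigma>_def add_pos_nonneg)
  define y where "y j = ((1 / \<sigma> j) *\<^sub>R (x j - x0), s j / \<sigma> j)" for j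
  have y1: "norm (fst (y j)) + snd (y j) = 1" for j
  proof -
    have "norm ((1 / \<sigma> j) *\<^sub>R (x j - x0)) = norm (x j - x0) / \<sigma> j" using \<sigma>[of j] by simp
    then have "norm (fst (y j)) + snd (y j) = (norm (x j - x0) + s j) / \<sigma> j"
      by (simp only: y_def fst_conv snd_conv add_divide_distrib)
    also have "norm (x j - x0) + s j = \<sigma> j" by (simp add: \<sigma>_def)
    finally show ?thesis using \<sigma>[of j] by simp
  qed
  have y2: "snd (y j) \<ge> 0" for j using s[of j] \<sigma>[of j] by (simp add: y_def)
  have "bounded (range y)"
  proof (rule boundedI)
    fix z assume "z \<in> range y"
    then obtain j where "z = y j" by blast
    then have "norm z \<le> norm (fst (y j)) + norm (snd (y j))" by (simp add: norm_Pair_le[of "fst (y j)" "snd (y j)", simplified])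
    then show "norm z \<le> 1" using y1[of j] y2[of j] by simp
  qed
  then obtain l r where r: "strict_mono r" "(y \<circ> r) \<longlonglongrightarrow> l"
    using bounded_imp_convergent_subsequence by blast
  let ?\<alpha> = "fst l" and ?\<tau> = "snd l"
  have \<alpha>: "(\<lambda>n. (1 / \<sigma> (r n)) *\<^sub>R (x (r n) - x0)) \<longlonglongrightarrow> ?\<alpha>"
    using tendsto_fst[OF r(2)] by (simp add: o_def y_def)
  have \<tau>: "(\<lambda>n. s (r n) / \<sigma> (r n)) \<longlonglongrightarrow> ?\<tau>" using tendsto_snd[OF r(2)] by (simp add: o_def y_def)
  have "(\<lambda>n. norm (fst (y (r n))) + snd (y (r n))) \<longlonglongrightarrow> norm ?\<alpha> + ?\<tau>"
    using r(2) by (intro tendsto_intros) (simp_all add: o_def)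
  then have sum1: "norm ?\<alpha> + ?\<tau> = 1" by (simp only: y1 LIMSEQ_const_iff)
  have \<alpha>W: "?\<alpha> \<in> W"
  proof (rule closed_sequentially[OF closed_subspace[OF real_subspace[OF W]] _ \<alpha>])
    show "(1 / \<sigma> (r n)) *\<^sub>R (x (r n) - x0) \<in> W" for n
      using real_subspace[OF W] xU UW x0W by (intro subspace_scale subspace_diff) auto
  qed
  have \<nu>r: "filterlim (\<lambda>n. \<nu> (r n)) sequentially sequentially"
    by (rule filterlim_compose[OF \<nu>lim filterlim_subseq[OF r(1)]])
  have "\<Theta> (?\<tau> *\<^sub>R A) = \<Lambda> ?\<alpha>"
  proof (rule first_order[of "\<lambda>n. x (r n)" "\<lambda>n. c (\<nu> (r n))" "\<lambda>n. \<sigma> (r n)"])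
    show "x (r n) \<in> U" "c (\<nu> (r n)) \<in> SO_R" "act (c (\<nu> (r n))) V = chart g (f (x (r n)))" "\<sigma> (r n) > 0" for n
      by (simp_all add: xU cS xe \<sigma>)
    show "(\<lambda>n. x (r n)) \<longlonglongrightarrow> x0" using LIMSEQ_subseq_LIMSEQ[OF xl r(1)] by (simp add: o_def)
    show "(\<lambda>n. c (\<nu> (r n))) \<longlonglongrightarrow> mat 1" by (rule filterlim_compose[OF c1 \<nu>r])
    show "(\<lambda>n. (1 / \<sigma> (r n)) *\<^sub>R (x (r n) - x0)) \<longlonglongrightarrow> ?\<alpha>" by (rule \<alpha>)
    have "(\<lambda>n. (1 / t (\<nu> (r n))) *\<^sub>R (c (\<nu> (r n)) - mat 1)) \<longlonglongrightarrow> A" by (rule filterlim_compose[OF cA \<nu>r])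
    then have "(\<lambda>n. (s (r n) / \<sigma> (r n)) *\<^sub>R ((1 / t (\<nu> (r n))) *\<^sub>R (c (\<nu> (r n)) - mat 1))) \<longlonglongrightarrow> ?\<tau> *\<^sub>R A"
      by (intro tendsto_scaleR \<tau>)
    then show "(\<lambda>n. (1 / \<sigma> (r n)) *\<^sub>R (c (\<nu> (r n)) - mat 1)) \<longlonglongrightarrow> ?\<tau> *\<^sub>R A"
      using tn by (simp add: s_def)
  qed
  then have eq: "?\<tau> *\<^sub>R \<Theta> A = \<Lambda> ?\<alpha>" by (simp add: linear_scale[OF linear_Theta])
  have "?\<tau> \<noteq> 0"
  proof
    assume "?\<tau> = 0"
    then have "?\<alpha> = 0" using Lam_0[OF \<alpha>W] eq by simp
    then show False using sum1 \<open>?\<tau> = 0\<close> by simp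
  qed
  then have "\<Theta> A = (1 / ?\<tau>) *\<^sub>R (?\<tau> *\<^sub>R \<Theta> A)" by simp
  also have "\<dots> = \<Lambda> ((1 / ?\<tau>) *\<^sub>R ?\<alpha>)" by (simp only: eq linear_scale[OF linear_Lam])
  finally show ?thesis using subspace_scale[OF real_subspace[OF W] \<alpha>W] by blast
qed

text \<open>
  A curve in the submanifold has the form \<open>k(t) V\<close>, where \<open>k(t)\<close> may be discontinuous in \<open>t\<close>. Choosing \<open>k(t)\<close> as close to
  the identity as possible, which compactness allows, prevents it from moving along the stabilizer of \<open>V\<close>.
\<close>

lemma closest_element:
  assumes u: "u \<in> U"
  obtains k where "k \<in> SO_R" "act k V = chart g (f u)"
    "\<And>l. l \<in> SO_R \<Longrightarrow> act l V = chart g (f u) \<Longrightarrow> norm (k - mat 1) \<le> norm (l - mat 1)"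
proof -
  let ?m = "g ** f u"
  define K where "K = {k \<in> SO_R. act k V = chart g (f u)}"
  have dm: "det ?m = 1" by (rule dets(3)[OF u])
  have K_eq: "K = SO_R \<inter> {k. low (matrix_inv ?m ** (k ** h)) = 0}"
  proof -
    have "act k V = chart g (f u) \<longleftrightarrow> low (matrix_inv ?m ** (k ** h)) = 0" if "k \<in> SO_R" for k
    proof -
      have "det (k ** h) \<noteq> 0" using that dets(2) by (simp add: SO_R_iff det_mul)
      then have "act (k ** h) std_flag = act ?m std_flag \<longleftrightarrow> matrix_inv ?m ** (k ** h) \<in> upper_tri"
        using dm by (intro act_std_flag_eq_iff) simp_all
      then show ?thesis by (simp add: low_eq_0 V_h act_act chart_def)
    qed
    then show ?thesis unfolding K_def by blast
  qed
  have "continuous_on UNIV (\<lambda>k. low (matrix_inv ?m ** (k ** h)))"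
    by (intro continuous_on_compose2[OF linear_continuous_on[OF linear_low[unfolded linear_conv_bounded_linear], of UNIV]]
        continuous_intros) auto
  then have "closed {k. low (matrix_inv ?m ** (k ** h)) = 0}"
    by (intro closed_Collect_eq continuous_on_const)
  then have "compact K" unfolding K_eq by (intro compact_Int_closed compact_SO_R)
  moreover have "K \<noteq> {}"
  proof -
    have "chart g (f u) \<in> (chart g \<circ> f) ` U" using u by auto
    then have "chart g (f u) \<in> C" using openin_subset[OF openC] by auto
    then obtain k where "k \<in> SO_R" "act k V = chart g (f u)" unfolding C orbit_def by (metis imageE)
    then have "k \<in> K" by (simp add: K_def)
    then show ?thesis by blast
  qed
  moreover have "continuous_on K (\<lambda>k. norm (k - mat 1))" by (intro continuous_intros)
  ultimately obtain k where "k \<in> K" "\<forall>l\<in>K. norm (k - mat 1) \<le> norm (l - mat 1)"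
    using continuous_attains_inf by blast
  then show ?thesis using that[of k] unfolding K_def by blast
qed

lemma limit_stabilizes:
  assumes x: "\<And>n. x n \<in> U" "x \<longlonglongrightarrow> x0" and k: "\<And>n. k n \<in> SO_R" "k \<longlonglongrightarrow> l"
    and eq: "\<And>n. act (k n) V = chart g (f (x n))" and l: "l \<in> SO_R"
  shows "act l V = V"
proof -
  define m where "m n = g ** f (x n)" for n
  define p where "p n = matrix_inv (m n) ** (k n ** h)" for n
  have dm: "det (m n) = 1" for n unfolding m_def by (rule dets(3)[OF x(1)])
  have xW: "x n \<in> W" for n using x(1) UW by blast
  have "(f \<circ> x) \<longlonglongrightarrow> f x0"
    using has_derivative_continuous[OF der] xW x(2) unfolding continuous_within_sequentially by blast
  then have "(\<lambda>n. f (x n)) \<longlonglongrightarrow> f x0" by (simp add: o_def)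
  then have m: "m \<longlonglongrightarrow> h" unfolding m_def h by (intro tendsto_intros)
  have mp: "m n ** p n = k n ** h" for n
    unfolding p_def using dm[of n] by (simp add: matrix_mul_assoc matrix_inv_right)
  have "low (p n) = 0" for n
  proof -
    have "act (k n ** h) std_flag = act (m n) std_flag"
      using eq[of n] by (simp add: V_h act_act chart_def m_def)
    moreover have "det (k n ** h) = 1" using k(1)[of n] dets(2) by (simp add: SO_R_iff det_mul)
    ultimately have "p n \<in> upper_tri" unfolding p_def using dm[of n] by (subst act_std_flag_eq_iff[symmetric]) simp_all
    then show ?thesis by (simp add: low_eq_0)
  qed
  then have z: "(\<lambda>n. low (p n)) = (\<lambda>n. 0)" by (rule ext)
  have "(\<lambda>n. m n ** p n) \<longlonglongrightarrow> l ** h" unfolding mp by (intro tendsto_intros k(2))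
  then have "p \<longlonglongrightarrow> matrix_inv h ** (l ** h)" using dets(2) by (intro tendsto_solve[OF m]) simp_all
  from tendsto_low[OF this] have "low (matrix_inv h ** (l ** h)) = 0" by (simp only: z LIMSEQ_const_iff)
  then have "matrix_inv h ** (l ** h) \<in> upper_tri" by (simp add: low_eq_0)
  moreover have "det (l ** h) = 1" using l dets(2) by (simp add: SO_R_iff det_mul)
  ultimately have "act (l ** h) std_flag = act h std_flag" using dets(2) by (subst act_std_flag_eq_iff) simp_all
  then show ?thesis by (simp add: V_h act_act)
qed

lemma V_flag: "V \<in> flags"
  unfolding V_h using dets(2) by (intro act_flags std_flag_in_flags) simp

text \<open>
  Take the closest elements \<open>k n\<close> along the curve \<open>x0 + t n *\<^sub>R v\<close>. They tend to the identity: along a subsequence they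
  converge to an element \<open>l\<close> of the stabilizer, and \<open>k n ** transpose l\<close> is not closer to the identity than \<open>k n\<close>. The
  increments of \<open>k\<close> and \<open>t\<close>, divided by their total size \<open>\<sigma> n\<close>, accumulate at some \<open>(A, \<tau>)\<close> with \<open>\<parallel>A\<parallel> + \<tau> = 1\<close> and
  \<open>\<Theta> A = \<tau> \<Lambda> v\<close>. If \<open>\<tau> = 0\<close>, then \<open>A\<close> is tangent to the stabilizer, and multiplying \<open>k n\<close> by an element of the
  stabilizer with tangent \<open>- A\<close> would bring it closer to the identity, unless \<open>A = 0\<close>.
\<close>

lemma tangent_2:
  assumes v: "v \<in> W"
  shows "\<exists>A\<in>so_R. \<Theta> A = \<Lambda> v"
proof -
  obtain t where t: "\<And>n. t n > 0" "t \<longlonglongrightarrow> 0" "\<And>n. x0 + t n *\<^sub>R v \<in> U" "(\<lambda>n. x0 + t n *\<^sub>R v) \<longlonglongrightarrow> x0"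
    by (rule small_steps[OF v]) blast
  define x where "x n = x0 + t n *\<^sub>R v" for n
  have xU: "x n \<in> U" for n using t(3) by (simp add: x_def)
  have xl: "x \<longlonglongrightarrow> x0" using t(4) by (simp add: x_def[abs_def])
  have "\<exists>k. k \<in> SO_R \<and> act k V = chart g (f (x n)) \<and>
      (\<forall>l. l \<in> SO_R \<longrightarrow> act l V = chart g (f (x n)) \<longrightarrow> norm (k - mat 1) \<le> norm (l - mat 1))" for n
    by (rule closest_element[OF xU[of n]]) blast
  then have "\<exists>k. \<forall>n. k n \<in> SO_R \<and> act (k n) V = chart g (f (x n)) \<and>
      (\<forall>l. l \<in> SO_R \<longrightarrow> act l V = chart g (f (x n)) \<longrightarrow> norm (k n - mat 1) \<le> norm (l - mat 1))"
    by (intro choice allI)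
  then obtain k where kS: "\<And>n. k n \<in> SO_R" and kV: "\<And>n. act (k n) V = chart g (f (x n))"
    and kmin: "\<And>n l. l \<in> SO_R \<Longrightarrow> act l V = chart g (f (x n)) \<Longrightarrow> norm (k n - mat 1) \<le> norm (l - mat 1)"
    by blast
  obtain l r where l: "l \<in> SO_R" and r: "strict_mono r" and lim: "(k \<circ> r) \<longlonglongrightarrow> l"
    using compact_SO_R[unfolded compact_def] kS by blast
  have xr: "(\<lambda>n. x (r n)) \<longlonglongrightarrow> x0" using LIMSEQ_subseq_LIMSEQ[OF xl r] by (simp add: o_def)
  have tr: "(\<lambda>n. t (r n)) \<longlonglongrightarrow> 0" using LIMSEQ_subseq_LIMSEQ[OF t(2) r] by (simp add: o_def)
  have kr: "(\<lambda>n. k (r n)) \<longlonglongrightarrow> l" using lim by (simp add: o_def)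
  have lV: "act l V = V"
    by (rule limit_stabilizes[of "\<lambda>n. x (r n)" "\<lambda>n. k (r n)"]) (simp_all add: xU xr kS kr kV l)
  have lt: "act (transpose l) V = V"
  proof -
    have "act (transpose l ** l) V = V" using l by (simp add: SO_R_iff)
    then show ?thesis by (simp add: act_act[symmetric] lV)
  qed
  define \<kappa> where "\<kappa> n = k (r n) - mat 1" for n
  have minimal: "norm (\<kappa> n) \<le> norm (k (r n) ** c - mat 1)" if "c \<in> SO_R" "act c V = V" for n c
    unfolding \<kappa>_def by (rule kmin) (use that kS kV in \<open>simp_all add: SO_R_mult act_act[symmetric]\<close>)
  have "(\<lambda>n. k (r n) ** transpose l - mat 1) \<longlonglongrightarrow> l ** transpose l - mat 1" by (intro tendsto_intros kr)
  then have n0: "(\<lambda>n. norm (k (r n) ** transpose l - mat 1)) \<longlonglongrightarrow> 0"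
    using SO_R_transpose_right[OF l] tendsto_norm_zero by simp
  have "eventually (\<lambda>n. norm (\<kappa> n) \<le> norm (k (r n) ** transpose l - mat 1)) sequentially"
    using minimal[OF SO_R_transpose[OF l] lt] by simp
  then have \<kappa>0: "\<kappa> \<longlonglongrightarrow> 0" by (rule Lim_null_comparison) (rule n0)
  have k1: "(\<lambda>n. k (r n)) \<longlonglongrightarrow> mat 1" using tendsto_add[OF \<kappa>0 tendsto_const[of "mat 1"]] by (simp add: \<kappa>_def)
  define \<sigma> where "\<sigma> n = t (r n) + norm (\<kappa> n)" for n
  have \<sigma>: "\<sigma> n > 0" for n using t(1)[of "r n"] by (simp add: \<sigma>_def add_pos_nonneg)
  have \<sigma>0: "\<sigma> \<longlonglongrightarrow> 0"
    using tendsto_add[OF tr tendsto_norm_zero[OF \<kappa>0]] by (simp add: \<sigma>_def[abs_def])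
  define y where "y n = ((1 / \<sigma> n) *\<^sub>R \<kappa> n, t (r n) / \<sigma> n)" for n
  have y1: "norm (fst (y n)) + snd (y n) = 1" for n
  proof -
    have "norm ((1 / \<sigma> n) *\<^sub>R \<kappa> n) = norm (\<kappa> n) / \<sigma> n" using \<sigma>[of n] by simp
    then have "norm (fst (y n)) + snd (y n) = (norm (\<kappa> n) + t (r n)) / \<sigma> n"
      by (simp only: y_def fst_conv snd_conv add_divide_distrib)
    also have "norm (\<kappa> n) + t (r n) = \<sigma> n" by (simp add: \<sigma>_def)
    finally show ?thesis using \<sigma>[of n] by simp
  qed
  have y2: "snd (y n) \<ge> 0" for n using t(1)[of "r n"] \<sigma>[of n] by (simp add: y_def)
  have "bounded (range y)"
  proof (rule boundedI)
    fix z assume "z \<in> range y"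
    then obtain n where "z = y n" by blast
    then have "norm z \<le> norm (fst (y n)) + norm (snd (y n))" by (simp add: norm_Pair_le[of "fst (y n)" "snd (y n)", simplified])
    then show "norm z \<le> 1" using y1[of n] y2[of n] by simp
  qed
  then obtain L q where q: "strict_mono q" "(y \<circ> q) \<longlonglongrightarrow> L"
    using bounded_imp_convergent_subsequence by blast
  let ?A = "fst L" and ?\<tau> = "snd L"
  have A: "(\<lambda>n. (1 / \<sigma> (q n)) *\<^sub>R \<kappa> (q n)) \<longlonglongrightarrow> ?A" using tendsto_fst[OF q(2)] by (simp add: o_def y_def)
  have \<tau>: "(\<lambda>n. t (r (q n)) / \<sigma> (q n)) \<longlonglongrightarrow> ?\<tau>" using tendsto_snd[OF q(2)] by (simp add: o_def y_def)
  have "(\<lambda>n. norm (fst (y (q n))) + snd (y (q n))) \<longlonglongrightarrow> norm ?A + ?\<tau>"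
    using q(2) by (intro tendsto_intros) (simp_all add: o_def)
  then have sum1: "norm ?A + ?\<tau> = 1" by (simp only: y1 LIMSEQ_const_iff)
  have k1q: "(\<lambda>n. k (r (q n))) \<longlonglongrightarrow> mat 1" using LIMSEQ_subseq_LIMSEQ[OF k1 q(1)] by (simp add: o_def)
  have AS: "?A \<in> so_R"
    by (rule so_R_limit[of "\<lambda>n. k (r (q n))" "\<lambda>n. \<sigma> (q n)"]) (use kS k1q \<sigma> A in \<open>simp_all add: \<kappa>_def\<close>)
  have "\<Theta> ?A = \<Lambda> (?\<tau> *\<^sub>R v)"
  proof (rule first_order[of "\<lambda>n. x (r (q n))" "\<lambda>n. k (r (q n))" "\<lambda>n. \<sigma> (q n)"])
    show "x (r (q n)) \<in> U" "k (r (q n)) \<in> SO_R" "act (k (r (q n))) V = chart g (f (x (r (q n))))" "\<sigma> (q n) > 0" for n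
      by (simp_all add: xU kS kV \<sigma>)
    show "(\<lambda>n. x (r (q n))) \<longlonglongrightarrow> x0" using LIMSEQ_subseq_LIMSEQ[OF xr q(1)] by (simp add: o_def)
    show "(\<lambda>n. k (r (q n))) \<longlonglongrightarrow> mat 1" by (rule k1q)
    show "(\<lambda>n. (1 / \<sigma> (q n)) *\<^sub>R (k (r (q n)) - mat 1)) \<longlonglongrightarrow> ?A" using A by (simp only: \<kappa>_def)
    have "(\<lambda>n. (t (r (q n)) / \<sigma> (q n)) *\<^sub>R v) \<longlonglongrightarrow> ?\<tau> *\<^sub>R v" by (intro tendsto_scaleR \<tau> tendsto_const)
    then show "(\<lambda>n. (1 / \<sigma> (q n)) *\<^sub>R (x (r (q n)) - x0)) \<longlonglongrightarrow> ?\<tau> *\<^sub>R v" by (simp add: x_def)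
  qed
  then have eq: "\<Theta> ?A = ?\<tau> *\<^sub>R \<Lambda> v" by (simp add: linear_scale[OF linear_Lam])
  have "?\<tau> \<noteq> 0"
  proof
    assume \<tau>0: "?\<tau> = 0"
    then have "\<Theta> ?A = 0" using eq by simp
    then have "?A \<in> stab V" by (simp add: Theta_0)
    have st: "c *\<^sub>R (- ?A) \<in> stab V" for c
    proof -
      have "(c *\<^sub>R (- ?A)) *v z \<in> V i" if "z \<in> V i" for i z
      proof -
        have "(c *\<^sub>R (- ?A)) *v z = (- complex_of_real c) *s (?A *v z)"
          by (simp add: vec_eq_iff matrix_vector_mult_def sum_distrib_left scaleR_conv_of_real[where 'a=complex] sum_negf mult_ac)
        moreover have "?A *v z \<in> V i" using \<open>?A \<in> stab V\<close> that unfolding stab_def by blast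
        ultimately show ?thesis by (simp only: vec.subspace_scale[OF flagsD(2)[OF V_flag]])
      qed
      then show ?thesis unfolding stab_def by blast
    qed
    have nA: "- ?A \<in> so_R" using so_R_scaleR[OF AS, of "-1"] by simp
    define c where "c n = cayley ((\<sigma> (q n) / 2) *\<^sub>R (- ?A))" for n
    have \<sigma>q: "(\<lambda>n. \<sigma> (q n)) \<longlonglongrightarrow> 0" using LIMSEQ_subseq_LIMSEQ[OF \<sigma>0 q(1)] by (simp add: o_def)
    have \<sigma>n: "\<sigma> (q n) \<noteq> 0" for n using \<sigma>[of "q n"] by simp
    have cS: "c n \<in> SO_R" for n unfolding c_def by (intro cayley_SO so_R_scaleR nA)
    have cV: "act (c n) V = V" for n unfolding c_def by (intro cayley_stab so_R_scaleR nA st V_flag)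
    have cA: "(\<lambda>n. (1 / \<sigma> (q n)) *\<^sub>R (c n - mat 1)) \<longlonglongrightarrow> - ?A"
      unfolding c_def by (rule cayley_tangent(1)[OF nA \<sigma>q \<sigma>n])
    have \<kappa>q: "(\<lambda>n. \<kappa> (q n)) \<longlonglongrightarrow> 0" using LIMSEQ_subseq_LIMSEQ[OF \<kappa>0 q(1)] by (simp add: o_def)
    have "(\<lambda>n. (1 / \<sigma> (q n)) *\<^sub>R \<kappa> (q n) + (1 / \<sigma> (q n)) *\<^sub>R (c n - mat 1) +
        \<kappa> (q n) ** ((1 / \<sigma> (q n)) *\<^sub>R (c n - mat 1))) \<longlonglongrightarrow> ?A + - ?A + 0 ** (- ?A)"
      by (intro tendsto_add A cA tendsto_matrix_mult \<kappa>q)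
    moreover have "(1 / \<sigma> (q n)) *\<^sub>R \<kappa> (q n) + (1 / \<sigma> (q n)) *\<^sub>R (c n - mat 1) +
        \<kappa> (q n) ** ((1 / \<sigma> (q n)) *\<^sub>R (c n - mat 1)) = (1 / \<sigma> (q n)) *\<^sub>R (k (r (q n)) ** c n - mat 1)" for n
    proof -
      have "k (r (q n)) ** c n - mat 1 = \<kappa> (q n) + (c n - mat 1) + \<kappa> (q n) ** (c n - mat 1)"
        by (simp add: \<kappa>_def matrix_mult_diff)
      then show ?thesis by (simp only: matrix_mult_scaleR scaleR_add_right[symmetric])
    qed
    ultimately have "(\<lambda>n. (1 / \<sigma> (q n)) *\<^sub>R (k (r (q n)) ** c n - mat 1)) \<longlonglongrightarrow> 0" by simp
    then have n1: "(\<lambda>n. norm ((1 / \<sigma> (q n)) *\<^sub>R (k (r (q n)) ** c n - mat 1))) \<longlonglongrightarrow> 0" by (rule tendsto_norm_zero)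
    have "norm ((1 / \<sigma> (q n)) *\<^sub>R \<kappa> (q n)) \<le> norm ((1 / \<sigma> (q n)) *\<^sub>R (k (r (q n)) ** c n - mat 1))" for n
      using minimal[OF cS[of n] cV[of n], of "q n"] \<sigma>[of "q n"] by (simp add: divide_right_mono)
    then have "(\<lambda>n. (1 / \<sigma> (q n)) *\<^sub>R \<kappa> (q n)) \<longlonglongrightarrow> 0"
      by (intro Lim_null_comparison[OF always_eventually[OF allI] n1])
    from LIMSEQ_unique[OF A this] have "?A = 0" .
    then show False using sum1 \<tau>0 by simp
  qed
  then have "\<Lambda> v = (1 / ?\<tau>) *\<^sub>R (?\<tau> *\<^sub>R \<Lambda> v)" by simp
  also have "\<dots> = \<Theta> ((1 / ?\<tau>) *\<^sub>R ?A)" by (simp only: eq[symmetric] linear_scale[OF linear_Theta])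
  finally show ?thesis using so_R_scaleR[OF AS] by metis
qed

end

lemma cmul_mult:
  fixes A B :: "'n::finite cmat"
  shows "B ** cmul c A = cmul c (B ** A)" "cmul c A ** B = cmul c (A ** B)"
  by (simp_all add: vec_eq_iff cmul_def matrix_matrix_mult_def sum_distrib_left mult_ac)

lemma low_cmul: "low (cmul c A) = cmul c (low A)" for A :: "('n::{finite,linorder}) cmat"
  by (simp add: vec_eq_iff low_def cmul_def)

text \<open>
  The description of the tangent space of the orbit in a form that no longer mentions the parametrization.
\<close>

lemma cycle_tangent:
  fixes C :: "('n::{finite,linorder}) flag set" and V :: "'n flag"
  assumes C: "C = orbit SO_R V" and sub: "complex_submanifold d C"
  shows "\<exists>(W :: (complex^('n \<times> 'n)) set) (\<Lambda> :: complex^('n \<times> 'n) \<Rightarrow> 'n cmat) (\<Theta> :: 'n cmat \<Rightarrow> 'n cmat).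
    vec.subspace W \<and> vec.dim W = d \<and> linear \<Lambda> \<and> (\<forall>v\<in>W. \<Lambda> v = 0 \<longrightarrow> v = 0) \<and>
    (\<forall>c. \<forall>v\<in>W. \<Lambda> (c *s v) = cmul c (\<Lambda> v)) \<and> linear \<Theta> \<and> (\<forall>c A. \<Theta> (cmul c A) = cmul c (\<Theta> A)) \<and>
    (\<forall>A. \<Theta> A = 0 \<longleftrightarrow> A \<in> stab V) \<and> \<Theta> ` so_R = \<Lambda> ` W"
proof -
  have "act (mat 1) V \<in> C" unfolding C orbit_def using SO_R_one by blast
  then have VC: "V \<in> C" by simp
  obtain g and W :: "(complex^('n \<times> 'n)) set" and U f x0 where
    c: "g \<in> SL_C" "vec.subspace W" "vec.dim W = d" "openin (top_of_set W) U" "f ` U \<subseteq> lower_unitriangular"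
    "holomorphic_immersion_on W U f" "embedding_map (top_of_set U) flag_topology (chart g \<circ> f)"
    "x0 \<in> U" "V = chart g (f x0)" "openin (subtopology flag_topology C) ((chart g \<circ> f) ` U)"
    by (rule complex_submanifold_chart[OF sub VC]) blast
  obtain f' where f': "(f has_derivative f') (at x0 within W)"
    "\<And>c v i j. v \<in> W \<Longrightarrow> f' (c *s v) $ i $ j = c * f' v $ i $ j" "inj_on f' W"
    using c(6,8) unfolding holomorphic_immersion_on_def by blast
  define h where "h = g ** f x0"
  define \<Lambda> where "\<Lambda> = (\<lambda>v. low (matrix_inv h ** g ** f' v))"
  define \<Theta> where "\<Theta> = (\<lambda>A. low (matrix_inv h ** A ** h))"
  note ctx = C c(1,2,4,5,7,8,9,10) f'(1,3) h_def \<Lambda>_def \<Theta>_def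
  show ?thesis
  proof (intro exI[of _ W] exI[of _ \<Lambda>] exI[of _ \<Theta>] conjI ballI allI impI)
    show "vec.subspace W" "vec.dim W = d" by (rule c)+
    show "linear \<Lambda>" by (rule linear_Lam[OF ctx])
    show "v = 0" if "v \<in> W" "\<Lambda> v = 0" for v by (rule Lam_0[OF ctx that])
    show "linear \<Theta>" by (rule linear_Theta[OF ctx])
    show "\<Theta> A = 0 \<longleftrightarrow> A \<in> stab V" for A by (rule Theta_0[OF ctx])
    show "\<Theta> (cmul c A) = cmul c (\<Theta> A)" for c A by (simp add: \<Theta>_def cmul_mult low_cmul)
    show "\<Lambda> (c *s v) = cmul c (\<Lambda> v)" if "v \<in> W" for c v
    proof -
      have "f' (c *s v) = cmul c (f' v)" using f'(2)[OF that] by (simp add: vec_eq_iff cmul_def)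
      then show ?thesis by (simp add: \<Lambda>_def cmul_mult low_cmul)
    qed
    show "\<Theta> ` so_R = \<Lambda> ` W"
    proof (intro equalityI image_subsetI)
      show "\<Theta> A \<in> \<Lambda> ` W" if "A \<in> so_R" for A using tangent_1[OF ctx that] by blast
      show "\<Lambda> v \<in> \<Theta> ` so_R" if "v \<in> W" for v using tangent_2[OF ctx that] by (metis imageI)
    qed
  qed
qed

section \<open>The bilinear form and orthogonal complements\<close>

definition bil :: "complex^('n::finite) \<Rightarrow> complex^'n \<Rightarrow> complex" where
  "bil x y = (\<Sum>i\<in>UNIV. x $ i * y $ i)"

definition cnjv :: "complex^('n::finite) \<Rightarrow> complex^'n" where
  "cnjv x = (\<chi> i. cnj (x $ i))"

lemma bil_linear:
  "bil (x + x') y = bil x y + bil x' y" "bil x (y + y') = bil x y + bil x y'"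
  "bil (c *s x) y = c * bil x y" "bil x (c *s y) = c * bil x y"
  "bil (x - x') y = bil x y - bil x' y" "bil x (y - y') = bil x y - bil x y'"
  "bil 0 y = 0" "bil x 0 = 0"
  by (simp_all add: bil_def sum.distrib sum_distrib_left sum_subtractf algebra_simps)

lemma bil_commute: "bil x y = bil y x"
  by (simp add: bil_def mult.commute)

lemma herm_bil: "herm x y = bil x (cnjv y)"
  by (simp add: herm_def bil_def cnjv_def)

lemma cnjv_simps [simp]:
  "cnjv (cnjv x) = x" "cnjv (x + y) = cnjv x + cnjv y" "cnjv (x - y) = cnjv x - cnjv y"
  "cnjv (c *s x) = cnj c *s cnjv x" "cnjv 0 = 0"
  by (simp_all add: cnjv_def vec_eq_iff)

lemma bil_cnjv: "bil (cnjv x) (cnjv y) = cnj (bil x y)"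
  by (simp add: bil_def cnjv_def)

lemma bil_axis: "bil (axis i a) (axis j b) = (if i = j then a * b else 0)" for i j :: "'n::finite"
proof -
  have "bil (axis i a) (axis j b) = (\<Sum>k\<in>UNIV. if k = i then (if i = j then a * b else 0) else 0)"
    unfolding bil_def axis_def vec_lambda_beta by (intro sum.cong) auto
  then show ?thesis by simp
qed

lemma bil_adjoint: "bil (A *v x) y = bil x (transpose A *v y)" for A :: "'n::finite cmat"
proof -
  have "bil (A *v x) y = (\<Sum>i\<in>UNIV. \<Sum>j\<in>UNIV. A $ i $ j * x $ j * y $ i)"
    by (simp add: bil_def matrix_vector_mult_def sum_distrib_right)
  also have "\<dots> = (\<Sum>j\<in>UNIV. \<Sum>i\<in>UNIV. A $ i $ j * x $ j * y $ i)" by (rule sum.swap)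
  also have "\<dots> = (\<Sum>j\<in>UNIV. x $ j * (\<Sum>i\<in>UNIV. A $ i $ j * y $ i))"
    by (simp add: sum_distrib_left mult_ac)
  finally show ?thesis by (simp add: bil_def matrix_vector_mult_def transpose_def)
qed

lemma bil_orthogonal:
  fixes k :: "'n::finite cmat"
  assumes "transpose k ** k = mat 1"
  shows "bil (k *v x) (k *v y) = bil x y"
  unfolding bil_adjoint[of k] by (simp only: matrix_vector_mul_assoc assms matrix_vector_mul_lid)

lemma bil_skew:
  fixes Z :: "'n::finite cmat"
  assumes "transpose Z = - Z"
  shows "bil (Z *v x) y = - bil x (Z *v y)"
proof -
  have "(- Z) *v y = - (Z *v y)" by (simp add: vec_eq_iff matrix_vector_mult_def sum_negf)
  then have "bil (Z *v x) y = bil x (- (Z *v y))" by (simp only: bil_adjoint assms)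
  also have "\<dots> = - bil x (Z *v y)" by (simp add: bil_def sum_negf)
  finally show ?thesis .
qed

lemma linear_cnjv: "linear cnjv"
  by (rule linearI) (simp_all add: cnjv_def vec_eq_iff)

lemma dim_cnjv: "dim (cnjv ` S) = dim S" for S :: "(complex^'n::finite) set"
  by (rule dim_image_eq[OF linear_cnjv]) (metis cnjv_simps(1) inj_onI)

lemma inner_cnjv: "cnjv x \<bullet> y = Re (bil x y)"
  by (simp add: inner_herm herm_bil bil_cnjv)

text \<open>
  The conjugate of \<open>P\<close> is orthogonal to \<open>Q\<close> for the inner product and lies in \<open>coords J\<close> as well.
\<close>

lemma bil_orthogonal_dim_le:
  fixes P Q :: "(complex^'n::finite) set"
  assumes P: "vec.subspace P" "P \<subseteq> coords J" and Q: "vec.subspace Q" "Q \<subseteq> coords J"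
    and orth: "\<And>x y. x \<in> P \<Longrightarrow> y \<in> Q \<Longrightarrow> bil x y = 0"
  shows "vec.dim P + vec.dim Q \<le> card J"
proof -
  have "cnjv ` P \<union> Q \<subseteq> coords J"
    using P(2) Q(2) by (auto simp: coords_def cnjv_def)
  then have "dim (cnjv ` P \<union> Q) \<le> dim (coords J)" by (rule dim_subset)
  moreover have "dim (cnjv ` P \<union> Q) = dim (cnjv ` P) + dim Q"
    by (rule dim_orthogonal_sum) (auto simp: inner_cnjv orth)
  ultimately show ?thesis
    using real_dim_eq[OF P(1)] real_dim_eq[OF Q(1)] real_dim_eq[OF subspace_coords[of J]] dim_coords[of J]
    by (simp add: dim_cnjv)
qed

definition perp :: "(complex^('n::finite)) set \<Rightarrow> (complex^'n) set" where
  "perp S = {y. \<forall>x\<in>S. bil x y = 0}"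

lemma subspace_perp: "vec.subspace (perp S)"
  by (simp add: perp_def vec.subspace_def bil_linear)

lemma perp_mono: "S \<subseteq> T \<Longrightarrow> perp T \<subseteq> perp S"
  by (auto simp: perp_def)

lemma dim_perp:
  fixes S :: "(complex^'n::finite) set"
  assumes S: "vec.subspace S"
  shows "vec.dim (perp S) + vec.dim S = CARD('n)"
proof -
  have "perp S = {y \<in> UNIV. \<forall>x\<in>cnjv ` S. orthogonal x y}"
  proof (intro equalityI subsetI)
    fix y assume "y \<in> perp S"
    then show "y \<in> {y \<in> UNIV. \<forall>x\<in>cnjv ` S. orthogonal x y}"
      by (auto simp: perp_def orthogonal_def inner_cnjv)
  next
    fix y assume y: "y \<in> {y \<in> UNIV. \<forall>x\<in>cnjv ` S. orthogonal x y}"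
    have re: "Re (bil x y) = 0" if "x \<in> S" for x
      using y that by (auto simp: orthogonal_def inner_cnjv)
    have "bil x y = 0" if x: "x \<in> S" for x
    proof -
      have "Re (bil (\<i> *s x) y) = 0" by (rule re[OF vec.subspace_scale[OF S x]])
      then show ?thesis using re[OF x] by (simp add: bil_linear complex_eq_iff)
    qed
    then show "y \<in> perp S" by (simp add: perp_def)
  qed
  moreover have sub: "subspace (cnjv ` S)"
    by (rule linear_subspace_image[OF linear_cnjv real_subspace[OF S]])
  ultimately have "dim (perp S) + dim (cnjv ` S) = dim (UNIV :: (complex^'n) set)"
    using dim_subspace_orthogonal_to_vectors[OF sub subspace_UNIV] by simp
  moreover have "dim (UNIV :: (complex^'n) set) = 2 * CARD('n)" by simp
  ultimately show ?thesis using real_dim_eq[OF S] real_dim_eq[OF subspace_perp[of S]] by (simp add: dim_cnjv)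
qed

text \<open>
  A vector orthogonal to \<open>S\<close> for the real inner product is also Hermitian orthogonal, since \<open>S\<close> is closed under
  multiplication by \<open>\<i>\<close>.
\<close>

lemma unit_complement:
  fixes S T :: "(complex^'n::finite) set"
  assumes S: "vec.subspace S" and T: "vec.subspace T" and ST: "S \<subseteq> T" "vec.dim S < vec.dim T"
  obtains x where "x \<in> T" "herm x x = 1" "\<And>s. s \<in> S \<Longrightarrow> herm s x = 0"
proof -
  have "S \<noteq> T" using ST(2) by auto
  have e: "span S = S" "span T = T"
    using real_subspace[OF S] real_subspace[OF T] by (simp_all only: span_eq_iff)
  have "span S \<subset> span T" unfolding e using ST(1) \<open>S \<noteq> T\<close> by (rule psubsetI)
  then obtain z where z: "z \<noteq> 0" "z \<in> span T" "\<And>y. y \<in> span S \<Longrightarrow> orthogonal z y"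
    by (rule orthogonal_to_subspace_exists_gen) blast
  have zT: "z \<in> T" using z(2) by (simp only: e)
  have re: "Re (herm s z) = 0" if "s \<in> S" for s
    using z(3)[OF span_base[OF that]] by (simp add: orthogonal_def inner_commute inner_herm)
  have h0: "herm s z = 0" if s: "s \<in> S" for s
  proof -
    have "Re (herm (\<i> *s s) z) = 0" by (rule re[OF vec.subspace_scale[OF S s]])
    then show ?thesis using re[OF s] by (simp add: herm_linear complex_eq_iff)
  qed
  define x where "x = complex_of_real (1 / norm z) *s z"
  show ?thesis
  proof (rule that[of x])
    show "x \<in> T" unfolding x_def by (rule vec.subspace_scale[OF T zT])
    have "herm x x = of_real (1 / norm z * (1 / norm z * (norm z)\<^sup>2))"
      by (simp only: x_def herm_linear herm_self[of z] complex_cnj_complex_of_real of_real_mult)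
    also have "1 / norm z * (1 / norm z * (norm z)\<^sup>2) = 1" using z(1) by (simp add: power2_eq_square)
    finally show "herm x x = 1" by simp
    show "herm s x = 0" if "s \<in> S" for s using h0[OF that] by (simp add: x_def herm_linear)
  qed
qed

lemma one_more_dim:
  fixes S T :: "(complex^'n::finite) set"
  assumes S: "vec.subspace S" and T: "vec.subspace T" and ST: "S \<subseteq> T" "vec.dim T = vec.dim S + 1"
    and x: "x \<in> T" "x \<notin> S" and z: "z \<in> T"
  obtains c where "z - c *s x \<in> S"
proof -
  have sS: "vec.span S = S" using S by (simp add: vec.span_eq_iff)
  have "vec.dim (insert x S) = vec.dim S + 1" using x(2) by (simp add: vec.dim_insert sS)
  moreover have "vec.span (insert x S) \<subseteq> T" by (rule vec.span_minimal) (use x ST T in auto)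
  ultimately have "vec.span (insert x S) = T"
    using ST(2) by (intro vec.subspace_dim_equal vec.subspace_span T) simp_all
  then have "z \<in> vec.span (insert x S)" using z by simp
  then show ?thesis using that by (auto simp: vec.span_insert sS)
qed

text \<open>
  The case of equality in the Cauchy-Schwarz inequality.
\<close>

lemma herm_unit_equal:
  assumes "herm x x = 1" "herm y y = 1" "herm x y * cnj (herm x y) = 1"
  shows "x = herm x y *s y"
proof -
  have "herm y x = cnj (herm x y)" by (rule herm_commute)
  then have "herm (x - herm x y *s y) (x - herm x y *s y) = 0"
    using assms by (simp add: herm_linear algebra_simps)
  then have "norm (x - herm x y *s y) = 0" by (simp add: herm_self)
  then show ?thesis by simp
qed

definition wedge :: "complex^('n::finite) \<Rightarrow> complex^'n \<Rightarrow> 'n cmat" where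
  "wedge a b = (\<chi> i j. a $ i * b $ j - b $ i * a $ j)"

lemma wedge_vec: "wedge a b *v x = bil b x *s a - bil a x *s b"
proof -
  have "(wedge a b *v x) $ i = bil b x * a $ i - bil a x * b $ i" for i
    by (simp add: wedge_def matrix_vector_mult_def bil_def sum_distrib_left sum_distrib_right sum_subtractf[symmetric] algebra_simps)
  then show ?thesis by (simp add: vec_eq_iff)
qed

lemma transpose_wedge: "transpose (wedge a b) = - wedge a b"
  by (simp add: vec_eq_iff transpose_def wedge_def)

section \<open>Isotropy of the base cycle\<close>

text \<open>
  The member of dimension \<open>t\<close>, including the zero space for \<open>t = 0\<close>.
\<close>

definition member :: "('n::{finite,linorder}) flag \<Rightarrow> nat \<Rightarrow> (complex^('n::{finite,linorder})) set" where
  "member V t = {x. x = 0 \<or> (\<exists>i. pos i \<le> t \<and> x \<in> V i)}"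

lemma member_pos:
  fixes V :: "('n::{finite,linorder}) flag"
  assumes V: "V \<in> flags"
  shows "member V (pos i) = V i"
proof (intro equalityI subsetI)
  fix x assume "x \<in> member V (pos i)"
  then consider "x = 0" | k where "k \<le> i" "x \<in> V k" by (auto simp: member_def pos_le)
  then show "x \<in> V i"
  proof cases
    case 1
    then show ?thesis using vec.subspace_0[OF flagsD(2)[OF V]] by simp
  next
    case 2
    then show ?thesis using monoD[OF flagsD(1)[OF V] 2(1)] by blast
  qed
qed (auto simp: member_def)

lemma member_0: "member V 0 = {0}" for V :: "('n::{finite,linorder}) flag"
proof -
  have "\<not> pos i \<le> 0" for i :: 'n using pos_range(1)[of i] by linarith
  then show ?thesis unfolding member_def by blast
qed

lemma member_mono: "s \<le> t \<Longrightarrow> member V s \<subseteq> member V t"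
  unfolding member_def by (auto intro: order.trans)

lemma member_props:
  fixes V :: "('n::{finite,linorder}) flag"
  assumes V: "V \<in> flags" and t: "t \<le> CARD('n)"
  shows "vec.subspace (member V t)" "vec.dim (member V t) = t"
proof -
  have "vec.subspace (member V t) \<and> vec.dim (member V t) = t"
  proof (cases "t = 0")
    case True
    then show ?thesis by (simp add: member_0 vec.subspace_def)
  next
    case False
    then obtain i :: 'n where "pos i = t" using ex_pos[of t] t by auto
    then show ?thesis using member_pos[OF V, of i] flagsD(2,3)[OF V, of i] by simp
  qed
  then show "vec.subspace (member V t)" "vec.dim (member V t) = t" by auto
qed

text \<open>
  For reasons of dimension this is equivalent to \<open>V\<^bsub>n-i\<^esub> = V\<^sub>i\<^sup>\<bottom>\<close> for all \<open>i\<close>.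
\<close>

definition isotropic :: "('n::{finite,linorder}) flag \<Rightarrow> bool" where
  "isotropic V \<longleftrightarrow> (\<forall>i j. pos i + pos j \<le> CARD('n) \<longrightarrow> (\<forall>x\<in>V i. \<forall>y\<in>V j. bil x y = 0))"

lemma stab_perp:
  assumes Z: "transpose Z = - Z" "\<And>x. x \<in> S \<Longrightarrow> Z *v x \<in> S" and y: "y \<in> perp S"
  shows "Z *v y \<in> perp S"
proof -
  have "bil x (Z *v y) = 0" if "x \<in> S" for x
    using bil_skew[OF Z(1), of x y] Z(2)[OF that] y by (simp add: perp_def)
  then show ?thesis by (simp add: perp_def)
qed

text \<open>
  In the application \<open>S = V\<^sub>t = (V\<^bsub>n-t\<^esub>)\<^sup>\<bottom>\<close>, \<open>T = V\<^bsub>t+1\<^esub>\<close> and \<open>T' = (V\<^bsub>n-t-1\<^esub>)\<^sup>\<bottom>\<close>. The hypothesis \<open>N = A + Z\<close>, with \<open>A\<close> real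
  skew and hence skew Hermitian, says that the complex orthogonal group moves \<open>T\<close> and \<open>T'\<close> infinitesimally no further
  than the compact group, which preserves the Hermitian form. Let \<open>x\<close> and \<open>y\<close> be unit vectors that span the
  Hermitian complements of \<open>S\<close> in \<open>T\<close> and \<open>T'\<close>. Modulo \<open>S\<close> they are eigenvectors of \<open>Z\<close>, so the variation of their Hermitian
  products under \<open>N\<close> is determined by two eigenvalues. The rank two elements \<open>x \<and> cnj x\<close> and \<open>x \<and> cnj y\<close> then force
  \<open>bil x x = 0\<close> and equality in the Cauchy-Schwarz inequality for \<open>x\<close> and \<open>y\<close>.
\<close>

lemma isotropic_step:
  fixes S T T' :: "(complex^'n::finite) set"
  assumes S: "vec.subspace S" and T: "vec.subspace T" and T': "vec.subspace T'"
    and ST: "S \<subseteq> T" "S \<subseteq> T'" and dims: "vec.dim T = vec.dim S + 1" "vec.dim T' = vec.dim S + 1"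
    and bS: "\<And>x s. x \<in> T \<Longrightarrow> s \<in> S \<Longrightarrow> bil s x = 0"
    and bT: "\<And>x y. x \<in> T \<Longrightarrow> y \<in> T' \<Longrightarrow> bil x y = 0"
    and H: "\<And>N. transpose N = - N \<Longrightarrow> \<exists>A\<in>so_R. \<exists>Z. N = A + Z \<and> transpose Z = - Z \<and>
      (\<forall>x\<in>T. Z *v x \<in> T) \<and> (\<forall>y\<in>T'. Z *v y \<in> T')"
  shows "T = T'"
proof -
  obtain x where x: "x \<in> T" "herm x x = 1" "\<And>s. s \<in> S \<Longrightarrow> herm s x = 0"
    by (rule unit_complement[OF S T ST(1)]) (use dims in auto)
  obtain y' where y': "y' \<in> T'" "herm y' y' = 1" "\<And>s. s \<in> S \<Longrightarrow> herm s y' = 0"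
    by (rule unit_complement[OF S T' ST(2)]) (use dims in auto)
  \<comment> \<open>A phase that makes the Hermitian product of \<open>x\<close> and \<open>y\<close> real and nonnegative.\<close>
  define \<theta> where "\<theta> = (if herm x y' = 0 then 1 else herm x y' / of_real (cmod (herm x y')))"
  have \<theta>: "\<theta> * cnj \<theta> = 1" by (simp add: \<theta>_def complex_norm_square[symmetric] power2_eq_square norm_divide)
  define y where "y = \<theta> *s y'"
  have y: "y \<in> T'" "herm y y = 1" "\<And>s. s \<in> S \<Longrightarrow> herm s y = 0"
    using y' \<theta> by (simp_all add: y_def vec.subspace_scale[OF T'] herm_linear mult_ac)
  define r where "r = cmod (herm x y')"
  have r: "herm x y = of_real r"
    using complex_norm_square[of "herm x y'"]
    by (auto simp: y_def \<theta>_def r_def herm_linear power2_eq_square field_simps)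
  have ryx: "herm y x = of_real r" using herm_commute[of y x] r by simp
  have xS: "x \<notin> S" "y \<notin> S" using x(2) x(3)[of x] y(2) y(3)[of y] by auto
  have E: "\<exists>l m. herm (N *v x) x + herm x (N *v x) = l + cnj l \<and>
      herm (N *v x) y + herm x (N *v y) = (l + cnj m) * of_real r \<and>
      herm (N *v y) y + herm y (N *v y) = m + cnj m \<and> l * bil x x = 0"
    if N: "transpose N = - N" for N
  proof -
    obtain A Z where A: "A \<in> so_R" and NZ: "N = A + Z" and Z: "transpose Z = - Z"
      "\<And>x. x \<in> T \<Longrightarrow> Z *v x \<in> T" "\<And>y. y \<in> T' \<Longrightarrow> Z *v y \<in> T'" using H[OF N] by blast
    obtain l where l: "Z *v x - l *s x \<in> S"
      by (rule one_more_dim[OF S T ST(1) dims(1) x(1) xS(1) Z(2)[OF x(1)]])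
    obtain m where m: "Z *v y - m *s y \<in> S"
      by (rule one_more_dim[OF S T' ST(2) dims(2) y(1) xS(2) Z(3)[OF y(1)]])
    have hN: "herm (N *v u) v + herm u (N *v v) = herm (Z *v u) v + herm u (Z *v v)" for u v
      using herm_so_R[OF A, of u v] by (simp add: NZ matrix_vector_mult_add_rdistrib herm_linear)
    have "herm (Z *v x - l *s x) x = 0" "herm (Z *v x - l *s x) y = 0"
      "herm (Z *v y - m *s y) x = 0" "herm (Z *v y - m *s y) y = 0" using x(3) y(3) l m by blast+
    then have h: "herm (Z *v x) x = l" "herm (Z *v x) y = l * of_real r"
      "herm (Z *v y) x = m * of_real r" "herm (Z *v y) y = m"
      by (simp_all add: herm_linear x(2) y(2) r ryx)
    have h': "herm x (Z *v x) = cnj l" "herm x (Z *v y) = cnj m * of_real r" "herm y (Z *v y) = cnj m"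
      using herm_commute[of x "Z *v x"] herm_commute[of x "Z *v y"] herm_commute[of y "Z *v y"] by (simp_all add: h)
    have "bil (Z *v x) x = 0" using bil_skew[OF Z(1), of x x] bil_commute[of x "Z *v x"] by simp
    moreover have "bil (Z *v x - l *s x) x = 0" by (rule bS[OF x(1) l])
    ultimately have "l * bil x x = 0" by (simp add: bil_linear)
    then show ?thesis unfolding hN h h' by (intro exI[of _ l] exI[of _ m]) (simp add: distrib_right)
  qed
  have i_N: "transpose (cmul \<i> N) = - cmul \<i> N" if "transpose N = - N" for N :: "'n cmat"
  proof -
    have "transpose (cmul \<i> N) = cmul \<i> (transpose N)" by (simp add: transpose_def cmul_def vec_eq_iff)
    then show ?thesis by (simp add: that) (simp add: cmul_def vec_eq_iff)
  qed
  have i_vec: "cmul \<i> N *v u = \<i> *s (N *v u)" for N :: "'n cmat" and u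
    by (simp add: vec_eq_iff cmul_def matrix_vector_mult_def sum_distrib_left mult_ac)
  have bxy: "bil x y = 0" by (rule bT[OF x(1) y(1)])
  have cxx: "bil (cnjv x) x = 1" using x(2) by (simp add: herm_bil bil_commute)
  have cyy: "bil (cnjv y) y = 1" using y(2) by (simp add: herm_bil bil_commute)
  have cyx: "bil (cnjv y) x = of_real r" using r by (simp add: herm_bil bil_commute)
  have bxx: "bil x x = 0"
  proof (rule ccontr)
    assume nz: "bil x x \<noteq> 0"
    \<comment> \<open>The eigenvalue \<open>l\<close> vanishes, for \<open>N\<close> as well as for \<open>\<i> N\<close>, and these give the real and the imaginary part.\<close>
    have a: "herm (N *v x) x = 0" if N: "transpose N = - N" for N
    proof -
      have "herm (N *v x) x + herm x (N *v x) = 0" using E[OF N] nz by auto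
      moreover have "herm (\<i> *s (N *v x)) x + herm x (\<i> *s (N *v x)) = 0"
        using E[OF i_N[OF N]] nz unfolding i_vec by auto
      then have "\<i> * (herm (N *v x) x - herm x (N *v x)) = 0" by (simp add: herm_linear algebra_simps)
      ultimately show ?thesis by simp
    qed
    let ?b = "bil x x"
    have "herm (wedge x (cnjv x) *v x) x = 1 - ?b * cnj ?b"
      by (simp add: wedge_vec cxx herm_linear x(2)) (simp add: herm_bil bil_cnjv)
    then have bb: "?b * cnj ?b = 1" using a[OF transpose_wedge, of x "cnjv x"] by simp
    have hxc: "herm x (cnjv x) = ?b" by (simp add: herm_bil)
    have "herm (cnjv x) (cnjv x) = 1" using cxx by (simp add: herm_bil)
    then have xe: "x = ?b *s cnjv x"
      using herm_unit_equal[OF x(2), of "cnjv x"] hxc bb by simp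
    have "herm x y = ?b * herm (cnjv x) y" by (subst xe) (simp add: herm_linear)
    also have "herm (cnjv x) y = 0" using bxy by (simp add: herm_bil bil_cnjv)
    finally have r0: "r = 0" using r by simp
    have b: "herm x (N *v y) = 0" if N: "transpose N = - N" for N
    proof -
      have "herm (N *v x) y + herm x (N *v y) = 0" using E[OF N] r0 by auto
      moreover have "herm (\<i> *s (N *v x)) y + herm x (\<i> *s (N *v y)) = 0"
        using E[OF i_N[OF N]] r0 unfolding i_vec by auto
      then have "\<i> * (herm (N *v x) y - herm x (N *v y)) = 0" by (simp add: herm_linear algebra_simps)
      ultimately show ?thesis by simp
    qed
    have "wedge x (cnjv y) *v y = x" by (simp add: wedge_vec cyy bxy)
    then show False using b[OF transpose_wedge, of x "cnjv y"] x(2) by simp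
  qed
  have Nx: "wedge x (cnjv y) *v x = of_real r *s x" by (simp add: wedge_vec bxx cyx)
  have Ny: "wedge x (cnjv y) *v y = x" by (simp add: wedge_vec cyy bxy)
  obtain l m where "of_real r + of_real r = l + cnj l" "of_real r * of_real r + 1 = (l + cnj m) * of_real r"
    "of_real r + of_real r = m + cnj m"
    using E[OF transpose_wedge, of x "cnjv y"] by (auto simp: Nx Ny herm_linear x(2) r ryx)
  then have "r = Re l" "r = Re m" "r * r + 1 = (Re l + Re m) * r"
    by (auto simp: complex_eq_iff)
  then have "r * r = 1" by (simp add: algebra_simps)
  then have "complex_of_real r * cnj (complex_of_real r) = 1" by (simp flip: of_real_mult)
  then have "x = of_real r *s y" using herm_unit_equal[OF x(2) y(2)] r by simp
  then have xT': "x \<in> T'" using vec.subspace_scale[OF T' y(1)] by simp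
  have "T \<subseteq> T'"
  proof
    fix z assume z: "z \<in> T"
    obtain c where "z - c *s x \<in> S" by (rule one_more_dim[OF S T ST(1) dims(1) x(1) xS(1) z])
    then have "(z - c *s x) + c *s x \<in> T'"
      using ST(2) by (intro vec.subspace_add[OF T'] vec.subspace_scale[OF T' xT']) auto
    then show "z \<in> T'" by simp
  qed
  then show ?thesis using dims by (intro vec.subspace_dim_equal T T') simp_all
qed

text \<open>
  By induction on \<open>t \<le> n/2\<close>, the member of dimension \<open>t\<close> is the orthogonal complement of the one of dimension \<open>n - t\<close>.
\<close>

lemma isotropic_if_tangent:
  fixes V :: "('n::{finite,linorder}) flag"
  assumes V: "V \<in> flags"
    and H: "\<And>N. transpose N = - N \<Longrightarrow> \<exists>A\<in>so_R. N - A \<in> stab V"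
  shows "isotropic V"
proof -
  let ?n = "CARD('n)"
  note sub = member_props(1)[OF V] and dim = member_props(2)[OF V]
  have Zmem: "Z *v x \<in> member V t" if "Z \<in> stab V" "x \<in> member V t" for Z x t
    using that unfolding member_def stab_def by auto
  have P: "member V t = perp (member V (?n - t))" if "t \<le> ?n div 2" for t
    using that
  proof (induction t)
    case 0
    have "vec.dim (perp (member V ?n)) = 0" using dim_perp[OF sub[of ?n]] dim[of ?n] by simp
    then show ?case
      by (simp add: member_0) (metis member_0 dim le0 order_refl subset_antisym vec.subspace_0 subspace_perp
          vec.dim_eq_0 empty_subsetI insert_subset)
  next
    case (Suc t)
    have IH: "member V t = perp (member V (?n - t))" using Suc by simp
    have t: "t \<le> ?n" "Suc t \<le> ?n" "Suc t \<le> ?n - Suc t" "Suc t \<le> ?n - t" using Suc.prems by linarith+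
    show ?case
    proof (rule isotropic_step[of "member V t"])
      show "vec.subspace (member V t)" "vec.subspace (member V (Suc t))" by (intro sub t)+
      show "vec.subspace (perp (member V (?n - Suc t)))" by (rule subspace_perp)
      show "member V t \<subseteq> member V (Suc t)" by (rule member_mono) simp
      show "member V t \<subseteq> perp (member V (?n - Suc t))"
        unfolding IH by (intro perp_mono member_mono) simp
      show "vec.dim (member V (Suc t)) = vec.dim (member V t) + 1" using dim t by simp
      show "vec.dim (perp (member V (?n - Suc t))) = vec.dim (member V t) + 1"
        using dim_perp[OF sub[of "?n - Suc t"]] dim[of "?n - Suc t"] dim[OF t(1)] t by simp
      show "bil s x = 0" if "x \<in> member V (Suc t)" "s \<in> member V t" for x s
      proof -
        have "x \<in> member V (?n - t)" using that(1) member_mono[OF t(4), of V] by blast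
        moreover have "s \<in> perp (member V (?n - t))" using that(2) IH by simp
        ultimately show ?thesis by (simp add: perp_def bil_commute[of s x])
      qed
      show "bil x y = 0" if "x \<in> member V (Suc t)" "y \<in> perp (member V (?n - Suc t))" for x y
      proof -
        have "x \<in> member V (?n - Suc t)" using that(1) member_mono[OF t(3), of V] by blast
        then show ?thesis using that(2) by (simp add: perp_def)
      qed
      fix N :: "'n cmat" assume N: "transpose N = - N"
      obtain A where A: "A \<in> so_R" "N - A \<in> stab V" using H[OF N] by blast
      have Z: "transpose (N - A) = - (N - A)" using A(1) N by (simp add: transpose_diff so_R_def)
      show "\<exists>A\<in>so_R. \<exists>Z. N = A + Z \<and> transpose Z = - Z \<and> (\<forall>x\<in>member V (Suc t). Z *v x \<in> member V (Suc t)) \<and>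
          (\<forall>y\<in>perp (member V (?n - Suc t)). Z *v y \<in> perp (member V (?n - Suc t)))"
      proof (intro bexI[OF _ A(1)] exI[of _ "N - A"] conjI ballI)
        show "N = A + (N - A)" by simp
        show "transpose (N - A) = - (N - A)" by (rule Z)
        show "(N - A) *v x \<in> member V (Suc t)" if "x \<in> member V (Suc t)" for x by (rule Zmem[OF A(2) that])
        show "(N - A) *v y \<in> perp (member V (?n - Suc t))" if "y \<in> perp (member V (?n - Suc t))" for y
          by (rule stab_perp[OF Z Zmem[OF A(2)] that])
      qed
    qed
  qed
  have half: "bil x y = 0" if "pos i + pos j \<le> ?n" "pos i \<le> pos j" "x \<in> V i" "y \<in> V j" for i j x y
  proof -
    have t: "pos i \<le> ?n div 2" "pos j \<le> ?n - pos i" using that by linarith+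
    have "x \<in> perp (member V (?n - pos i))" using P[OF t(1)] that(3) by (simp add: member_pos[OF V])
    moreover have "y \<in> member V (?n - pos i)"
      using member_mono[OF t(2), of V] that(4) by (auto simp: member_pos[OF V])
    ultimately show ?thesis by (simp add: perp_def bil_commute[of x y])
  qed
  show ?thesis
    unfolding isotropic_def
  proof (intro allI impI ballI)
    fix i j x y assume *: "pos i + pos j \<le> ?n" "x \<in> V i" "y \<in> V j"
    show "bil x y = 0"
    proof (cases "pos i \<le> pos j")
      case True
      then show ?thesis using half[OF *(1) _ *(2,3)] by simp
    next
      case False
      then have "bil y x = 0" using *(1) by (intro half[OF _ _ *(3,2)]) simp_all
      then show ?thesis by (simp add: bil_commute[of x y])
    qed
  qed
qed

text \<open>
  The tangent space of the orbit is complex, so multiplying an infinitesimal motion by a real skew matrix with \<open>\<i>\<close> gives the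
  infinitesimal motion by another real skew matrix. Splitting a complex skew matrix into its real and imaginary parts yields
  the hypothesis of \<open>isotropic_if_tangent\<close>.
\<close>

lemma cycle_isotropic:
  fixes V :: "('n::{finite,linorder}) flag"
  assumes V: "V \<in> flags" and sub: "complex_submanifold d (orbit SO_R V)"
  shows "isotropic V"
proof (rule isotropic_if_tangent[OF V])
  obtain W :: "(complex^('n \<times> 'n)) set" and \<Lambda> :: "complex^('n \<times> 'n) \<Rightarrow> 'n cmat" and \<Theta> :: "'n cmat \<Rightarrow> 'n cmat"
    where W: "vec.subspace W" and Lc: "\<forall>c. \<forall>v\<in>W. \<Lambda> (c *s v) = cmul c (\<Lambda> v)"
    and Tl: "linear \<Theta>" and Tc: "\<forall>c A. \<Theta> (cmul c A) = cmul c (\<Theta> A)"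
    and T0: "\<forall>A. \<Theta> A = 0 \<longleftrightarrow> A \<in> stab V" and TL: "\<Theta> ` so_R = \<Lambda> ` W"
    using cycle_tangent[OF refl sub] by (elim exE conjE) (rule that; assumption)
  fix N :: "'n cmat" assume N: "transpose N = - N"
  define A1 A2 :: "'n cmat" where "A1 = (\<chi> i j. of_real (Re (N $ i $ j)))" and "A2 = (\<chi> i j. of_real (Im (N $ i $ j)))"
  have skew: "N $ j $ i = - (N $ i $ j)" for i j
  proof -
    have "N $ j $ i = transpose N $ i $ j" by (simp add: transpose_def)
    also have "\<dots> = - (N $ i $ j)" by (simp only: N vector_uminus_component)
    finally show ?thesis .
  qed
  have "A1 $ j $ i = - (A1 $ i $ j)" "A2 $ j $ i = - (A2 $ i $ j)" for i j
    unfolding A1_def A2_def vec_lambda_beta by (subst skew, simp)+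
  then have tr: "transpose A1 = - A1" "transpose A2 = - A2"
    unfolding vec_eq_iff transpose_def vec_lambda_beta vector_uminus_component by blast+
  have "A1 $ i $ j \<in> \<real>" "A2 $ i $ j \<in> \<real>" for i j by (simp_all add: A1_def A2_def)
  with tr have A1: "A1 \<in> so_R" and A2: "A2 \<in> so_R" unfolding so_R_def by blast+
  have NA: "N = A1 + cmul \<i> A2" by (simp add: A1_def A2_def cmul_def vec_eq_iff complex_eq[symmetric])
  obtain v where v: "v \<in> W" "\<Theta> A2 = \<Lambda> v" using TL A2 by (metis imageE imageI)
  have "\<Lambda> (\<i> *s v) \<in> \<Theta> ` so_R" using TL vec.subspace_scale[OF W v(1)] by blast
  then obtain A3 where A3: "A3 \<in> so_R" "\<Theta> A3 = cmul \<i> (\<Theta> A2)" using Lc v by auto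
  have "\<Theta> (N - (A1 + A3)) = 0"
    unfolding NA by (simp add: linear_diff[OF Tl] linear_add[OF Tl] Tc A3(2))
  then have "N - (A1 + A3) \<in> stab V" by (simp only: T0)
  moreover have "A1 + A3 \<in> so_R" using A1 A3(1) by (simp add: so_R_def transpose_add)
  ultimately show "\<exists>A\<in>so_R. N - A \<in> stab V" by blast
qed

section \<open>Model isotropic flags\<close>

text \<open>
  The columns are \<open>e\<^bsub>w(p)\<^esub> + \<i> e\<^bsub>w(n+1-p)\<^esub>\<close> for \<open>p \<le> n/2\<close> and \<open>e\<^bsub>w(p)\<^esub>\<close> for the remaining \<open>p\<close>. Any two of them with
  \<open>p + q \<le> n\<close> are orthogonal for the bilinear form.
\<close>

definition iso_mat :: "('n \<Rightarrow> 'n) \<Rightarrow> ('n::{finite,linorder}) cmat" where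
  "iso_mat w = (\<chi> r p. (if r = w p then 1 else 0) + (if p < opp p \<and> r = w (opp p) then \<i> else 0))"

definition iso_flag :: "('n \<Rightarrow> 'n) \<Rightarrow> ('n::{finite,linorder}) flag" where
  "iso_flag w = act (iso_mat w) std_flag"

lemma iso_mat_column:
  fixes w :: "'n::{finite,linorder} \<Rightarrow> 'n"
  shows "iso_mat w *v axis p 1 = axis (w p) 1 + (if p < opp p then \<i> *s axis (w (opp p)) 1 else 0)"
  unfolding vec_eq_iff matrix_vector_axis by (simp add: iso_mat_def axis_def)

lemma act_std_flag_span:
  fixes h :: "('n::{finite,linorder}) cmat"
  shows "act h std_flag p = vec.span ((\<lambda>q. h *v axis q 1) ` {..p})"
proof -
  have "act h std_flag p = (\<lambda>x. h *v x) ` vec.span ((\<lambda>j. axis j 1) ` {..p})"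
    by (simp only: act_def std_flag_eq span_axis_coords)
  also have "\<dots> = vec.span ((\<lambda>x. h *v x) ` (\<lambda>j. axis j 1) ` {..p})"
    by (rule vec.linear_span_image[symmetric, OF matrix_vector_mul_linear_gen])
  finally show ?thesis by (simp add: image_image)
qed

lemma opp_neq: "p < opp p \<Longrightarrow> opp p \<noteq> p" for p :: "'n::{finite,linorder}"
  by (metis less_irrefl)

text \<open>
  The additional entry in the column with leading entry in row \<open>w p\<close> is in row \<open>w (opp p)\<close>, above the leading one.
\<close>

lemma iso_mat_factor:
  fixes w :: "'n::{finite,linorder} \<Rightarrow> 'n"
  assumes w: "bij w" and good: "\<And>p. p < opp p \<Longrightarrow> w (opp p) < w p"
  obtains b where "b \<in> unipotent" "iso_mat w = b ** perm_mat w"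
proof -
  have winv: "w (inv w r) = r" "inv w (w r) = r" for r
    using w by (simp_all add: bij_is_surj bij_is_inj surj_f_inv_f)
  define b where "b = (\<chi> r c. iso_mat w $ r $ inv w c)"
  have "iso_mat w $ r $ p = (b ** perm_mat w) $ r $ p" for r p
    by (simp add: mult_perm_mat b_def winv)
  then have "iso_mat w = b ** perm_mat w" by (simp add: vec_eq_iff)
  moreover have "b $ r $ r = 1" for r
  proof -
    have "\<not> (inv w r < opp (inv w r) \<and> r = w (opp (inv w r)))"
      using good[of "inv w r"] winv(1)[of r] by (metis less_irrefl)
    then show ?thesis by (simp add: b_def iso_mat_def winv)
  qed
  moreover have "b $ r $ c = 0" if "c < r" for r c
  proof -
    have "\<not> (inv w c < opp (inv w c) \<and> r = w (opp (inv w c)))"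
      using good[of "inv w c"] winv(1)[of c] that by (metis less_asym)
    moreover have "r \<noteq> c" using that by simp
    ultimately show ?thesis by (simp add: b_def iso_mat_def winv)
  qed
  ultimately show ?thesis using that[of b] by (simp add: unipotent_def upper_tri_def)
qed

lemma iso_flag_cell:
  fixes w :: "'n::{finite,linorder} \<Rightarrow> 'n"
  assumes w: "bij w" and good: "\<And>p. p < opp p \<Longrightarrow> w (opp p) < w p"
  shows "det (iso_mat w) \<noteq> 0" "\<exists>b\<in>unipotent. iso_flag w = act b (coord_flag w)"
proof -
  obtain b where b: "b \<in> unipotent" "iso_mat w = b ** perm_mat w"
    using iso_mat_factor[OF w good] by blast
  have "det b = 1" using b(1) unipotent_Borel Borel_upper by blast
  then show "det (iso_mat w) \<noteq> 0" using det_perm_mat[OF w] by (simp add: b(2) det_mul)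
  have "iso_flag w = act b (coord_flag w)"
    by (simp add: iso_flag_def b(2) act_act[symmetric] coord_flag_perm_mat[OF w])
  then show "\<exists>b\<in>unipotent. iso_flag w = act b (coord_flag w)" using b(1) by blast
qed

lemma bil_matrix:
  fixes M :: "'n::finite cmat"
  shows "bil (M *v a) (M *v c) = (\<Sum>p\<in>UNIV. \<Sum>q\<in>UNIV. a $ p * bil (M *v axis p 1) (M *v axis q 1) * c $ q)"
proof -
  have col: "bil (M *v axis p 1) (M *v axis q 1) = (transpose M ** M) $ p $ q" for p q
    unfolding bil_def matrix_vector_axis by (simp add: matrix_matrix_mult_def transpose_def)
  have "bil (M *v a) (M *v c) = bil a ((transpose M ** M) *v c)"
    by (simp only: bil_adjoint matrix_vector_mul_assoc)
  then show ?thesis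
    unfolding col by (simp add: bil_def matrix_vector_mult_def[of "transpose M ** M"] sum_distrib_left mult_ac)
qed

lemma iso_flag_isotropic:
  fixes w :: "'n::{finite,linorder} \<Rightarrow> 'n"
  assumes w: "bij w"
  shows "isotropic (iso_flag w)"
  unfolding isotropic_def
proof (intro allI impI ballI)
  have inj: "w i = w j \<longleftrightarrow> i = j" for i j using w by (simp add: bij_is_inj inj_eq)
  have G: "bil (iso_mat w *v axis p 1) (iso_mat w *v axis q 1) = 0" if "pos p + pos q \<le> CARD('n)" for p q :: 'n
  proof -
    have "pos p < pos (opp q)" "pos q < pos (opp p)" using that pos_range[of p] pos_range[of q] by (auto simp: pos_opp)
    then have ne: "p \<noteq> opp q" "opp p \<noteq> q" "q \<noteq> opp p" "opp q \<noteq> p" by auto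
    have oe: "opp p = opp q \<longleftrightarrow> p = q" by (metis opp_opp)
    show ?thesis
    proof (cases "p = q")
      case True
      then have "p < opp p" using \<open>pos p < pos (opp q)\<close> by (simp add: pos_less)
      then show ?thesis unfolding iso_mat_column using True opp_neq[of p]
        by (simp add: bil_linear bil_axis inj ne) 
    next
      case False
      then show ?thesis unfolding iso_mat_column by (simp add: bil_linear bil_axis inj ne oe)
    qed
  qed
  fix i j :: 'n and x y
  assume ij: "pos i + pos j \<le> CARD('n)" and x: "x \<in> iso_flag w i" and y: "y \<in> iso_flag w j"
  obtain a where a: "a \<in> coords {..i}" "x = iso_mat w *v a"
    using x by (auto simp: iso_flag_def act_def std_flag_eq)
  obtain c where c: "c \<in> coords {..j}" "y = iso_mat w *v c"
    using y by (auto simp: iso_flag_def act_def std_flag_eq)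
  have "a $ p * bil (iso_mat w *v axis p 1) (iso_mat w *v axis q 1) * c $ q = 0" for p q
  proof (cases "p \<le> i \<and> q \<le> j")
    case True
    then have "pos p \<le> pos i" "pos q \<le> pos j" by (simp_all add: pos_le)
    then have "pos p + pos q \<le> CARD('n)" using ij by linarith
    then show ?thesis using G by simp
  next
    case False
    then have "a $ p = 0 \<or> c $ q = 0" using a(1) c(1) by (auto simp: coords_def)
    then show ?thesis by auto
  qed
  then show "bil x y = 0" unfolding a(2) c(2) by (subst bil_matrix) (intro sum.neutral ballI)
qed

text \<open>
  The members in the upper half are the orthogonal complements of those in the lower half.
\<close>

lemma isotropic_flags_eqI:
  fixes V V' :: "('n::{finite,linorder}) flag"
  assumes V: "V \<in> flags" "isotropic V" and V': "V' \<in> flags" "isotropic V'"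
    and eq: "\<And>p. 2 * pos p \<le> CARD('n) \<Longrightarrow> V p = V' p"
  shows "V = V'"
proof
  fix p
  show "V p = V' p"
  proof (cases "2 * pos p \<le> CARD('n)")
    case True
    then show ?thesis by (rule eq)
  next
    case False
    let ?t = "CARD('n) - pos p"
    have t: "?t \<le> CARD('n)" "2 * ?t \<le> CARD('n)" using False by auto
    have pn: "pos p \<le> CARD('n)" by (rule pos_range)
    have perp: "F p = perp (member F ?t)" if F: "F \<in> flags" "isotropic F" for F
    proof (rule vec.subspace_dim_equal)
      show "vec.subspace (F p)" "vec.subspace (perp (member F ?t))" by (intro flagsD(2)[OF F(1)] subspace_perp)+
      show "vec.dim (perp (member F ?t)) \<le> vec.dim (F p)"
        using dim_perp[OF member_props(1)[OF F(1) t(1)]] member_props(2)[OF F(1) t(1)] flagsD(3)[OF F(1), of p] pn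
        by simp
      show "F p \<subseteq> perp (member F ?t)"
      proof
        fix y assume y: "y \<in> F p"
        have "bil x y = 0" if "x \<in> member F ?t" for x
        proof -
          from that consider "x = 0" | i where "pos i \<le> ?t" "x \<in> F i" unfolding member_def by blast
          then show ?thesis
          proof cases
            case 1
            then show ?thesis by (simp add: bil_linear)
          next
            case 2
            then have "pos i + pos p \<le> CARD('n)" using pn by linarith
            then show ?thesis using F(2) 2(2) y unfolding isotropic_def by blast
          qed
        qed
        then show "y \<in> perp (member F ?t)" by (simp add: perp_def)
      qed
    qed
    have "V i = V' i" if "pos i \<le> ?t" for i using that t(2) by (intro eq) linarith
    then have "member V ?t = member V' ?t" unfolding member_def by auto
    then show ?thesis using perp[OF V] perp[OF V'] by simp
  qed
qed

section \<open>The real orthogonal group is transitive on isotropic flags\<close>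

text \<open>
  The real or the imaginary part of \<open>c\<close> is nonzero.
\<close>

lemma real_unit_vector:
  fixes c :: "complex^'n::finite"
  assumes "c \<noteq> 0"
  obtains \<gamma> a b where "cnjv \<gamma> = \<gamma>" "bil \<gamma> \<gamma> = 1" "\<gamma> = a *s c + b *s cnjv c"
proof -
  have unit: "\<exists>s :: real. bil (of_real s *s y) (of_real s *s y) = 1" if "cnjv y = y" "y \<noteq> 0" for y :: "complex^'n"
  proof -
    have "bil y y = of_real ((norm y)\<^sup>2)" using herm_self[of y] that(1) by (simp add: herm_bil)
    then have "bil (of_real (1 / norm y) *s y) (of_real (1 / norm y) *s y) = of_real (1 / norm y * (1 / norm y * (norm y)\<^sup>2))"
      by (simp only: bil_linear of_real_mult)
    also have "1 / norm y * (1 / norm y * (norm y)\<^sup>2) = 1" using that(2) by (simp add: power2_eq_square)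
    finally have "bil (of_real (1 / norm y) *s y) (of_real (1 / norm y) *s y) = 1" by simp
    then show ?thesis by blast
  qed
  show ?thesis
  proof (cases "c + cnjv c = 0")
    case False
    have r: "cnjv (c + cnjv c) = c + cnjv c" by (simp add: add.commute)
    obtain s :: real where s: "bil (of_real s *s (c + cnjv c)) (of_real s *s (c + cnjv c)) = 1"
      using unit[OF r False] by blast
    show ?thesis
      by (rule that[of "of_real s *s (c + cnjv c)" "of_real s" "of_real s"])
         (use s in \<open>simp_all add: vec.scale_right_distrib add.commute\<close>)
  next
    case True
    then have "cnjv c = - c" by (simp add: eq_neg_iff_add_eq_0 add.commute)
    then have r: "cnjv (\<i> *s c) = \<i> *s c" by (simp add: vec_eq_iff)
    have "\<i> *s c \<noteq> 0" using assms by simp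
    then obtain s :: real where s: "bil (of_real s *s (\<i> *s c)) (of_real s *s (\<i> *s c)) = 1"
      using unit[OF r] by blast
    show ?thesis
    proof (rule that[of "of_real s *s (\<i> *s c)" "of_real s * \<i>" 0])
      have "cnjv (of_real s *s (\<i> *s c)) = of_real s *s cnjv (\<i> *s c)"
        by (simp only: cnjv_simps(4) complex_cnj_complex_of_real)
      then show "cnjv (of_real s *s (\<i> *s c)) = of_real s *s (\<i> *s c)" by (simp only: r)
      show "bil (of_real s *s (\<i> *s c)) (of_real s *s (\<i> *s c)) = 1" by (rule s)
      show "of_real s *s (\<i> *s c) = (of_real s * \<i>) *s c + 0 *s cnjv c" by simp
    qed
  qed
qed

text \<open>
  Let \<open>x p\<close> be a Hermitian orthonormal basis adapted to \<open>V\<close>. Isotropy says that the \<open>x p\<close> in the lower half and their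
  complex conjugates are all orthonormal. Hence the real and imaginary parts \<open>\<alpha> p\<close> and \<open>\<beta> p\<close> of the
  vectors \<open>sqrt 2 *s x p\<close> form a real orthonormal system, which is complete for even \<open>n\<close>. For odd \<open>n\<close> a real unit
  vector in the span of the middle \<open>x p\<close> and its conjugate completes it. The matrix \<open>k\<close> with these columns maps the
  lower half of \<open>iso_flag w\<close> to that of \<open>V\<close>.
\<close>

lemma isotropic_transitive:
  fixes V :: "('n::{finite,linorder}) flag" and w :: "'n \<Rightarrow> 'n"
  assumes V: "V \<in> flags" "isotropic V" and w: "bij w" and dw: "det (iso_mat w) \<noteq> 0"
  obtains k :: "'n cmat" where "\<forall>i j. k $ i $ j \<in> \<real>" "transpose k ** k = mat 1" "V = act k (iso_flag w)"
proof -
  let ?n = "CARD('n)"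
  have winv: "w (inv w r) = r" "inv w (w r) = r" for r
    using w by (simp_all add: bij_is_surj bij_is_inj surj_f_inv_f)
  have "\<exists>x. x \<in> V p \<and> herm x x = 1 \<and> (\<forall>q<p. \<forall>s\<in>V q. herm s x = 0)" for p
  proof -
    have le: "pos p - 1 \<le> ?n" "pos p \<le> ?n" using pos_range(2)[of p] by linarith+
    have dims: "vec.dim (member V (pos p - 1)) < vec.dim (V p)"
      using member_props(2)[OF V(1) le(1)] flagsD(3)[OF V(1), of p] pos_range(1)[of p] by linarith
    have "member V (pos p - 1) \<subseteq> V p"
      unfolding member_pos[OF V(1), of p, symmetric] by (rule member_mono) simp
    then obtain x where x: "x \<in> V p" "herm x x = 1" "\<And>s. s \<in> member V (pos p - 1) \<Longrightarrow> herm s x = 0"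
      by (rule unit_complement[OF member_props(1)[OF V(1) le(1)] flagsD(2)[OF V(1)] _ dims]) blast
    have "herm s x = 0" if "q < p" "s \<in> V q" for q s
    proof -
      have "pos q \<le> pos p - 1" using that(1) pos_less[of q p] by linarith
      then have "s \<in> member V (pos p - 1)" using that(2) unfolding member_def by blast
      then show ?thesis by (rule x(3))
    qed
    then show ?thesis using x by blast
  qed
  then have "\<exists>x. \<forall>p. x p \<in> V p \<and> herm (x p) (x p) = 1 \<and> (\<forall>q<p. \<forall>s\<in>V q. herm s (x p) = 0)"
    by (intro choice allI)
  then obtain x where xV: "\<And>p. x p \<in> V p" and x1: "\<And>p. herm (x p) (x p) = 1"
    and xo: "\<And>p q s. q < p \<Longrightarrow> s \<in> V q \<Longrightarrow> herm s (x p) = 0" by blast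
  have hx: "herm (x p) (x q) = (if p = q then 1 else 0)" for p q
  proof -
    consider "p < q" | "p = q" | "q < p" by (rule linorder_cases)
    then show ?thesis
    proof cases
      case 1
      then show ?thesis using xo[OF 1 xV] by auto
    next
      case 2
      then show ?thesis by (simp add: x1)
    next
      case 3
      then have "herm (x q) (x p) = 0" by (rule xo[OF _ xV])
      then show ?thesis using 3 herm_commute[of "x p" "x q"] by auto
    qed
  qed
  have half: "2 * pos p \<le> ?n \<longleftrightarrow> p < opp p" for p :: 'n
    using pos_range[of p] by (subst pos_less[symmetric]) (auto simp: pos_opp)
  have mid: "2 * pos p = ?n + 1" if "opp p = p" for p :: 'n
    using pos_opp[of p] pos_range[of p] that by simp
  have bx: "bil (x p) (x q) = 0" if "pos p + pos q \<le> ?n" for p q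
    using V(2) that xV unfolding isotropic_def by blast
  have bx1: "bil (x p) (x q) = 0" if "p < opp p" "q < opp q" for p q
    using that unfolding half[symmetric] by (intro bx) linarith
  have bx2: "bil (x p) (x q) = 0" if "opp p = p" "q < opp q" for p q
    using mid[OF that(1)] that(2) unfolding half[symmetric] by (intro bx) linarith
  have xc: "bil (x p) (cnjv (x q)) = (if p = q then 1 else 0)" for p q using hx[of p q] by (simp add: herm_bil)
  have cx: "bil (cnjv (x p)) (x q) = (if p = q then 1 else 0)" for p q
    using xc[of q p] by (simp add: bil_commute[of "cnjv (x p)"])
  have "\<exists>\<gamma>. cnjv \<gamma> = \<gamma> \<and> bil \<gamma> \<gamma> = 1 \<and> (\<exists>a b. \<gamma> = a *s x p + b *s cnjv (x p))" for p
  proof -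
    have "x p \<noteq> 0" using x1[of p] by (auto simp: herm_linear)
    then show ?thesis by (rule real_unit_vector) blast
  qed
  then have "\<exists>\<gamma>. \<forall>p. cnjv (\<gamma> p) = \<gamma> p \<and> bil (\<gamma> p) (\<gamma> p) = 1 \<and> (\<exists>a b. \<gamma> p = a *s x p + b *s cnjv (x p))"
    by (intro choice allI)
  then obtain \<gamma> where g1: "\<And>p. cnjv (\<gamma> p) = \<gamma> p" and g2: "\<And>p. bil (\<gamma> p) (\<gamma> p) = 1"
    and g3: "\<And>p. \<exists>a b. \<gamma> p = a *s x p + b *s cnjv (x p)" by blast
  \<comment> \<open>With this factor \<open>\<alpha> p + \<i> *s \<beta> p\<close> equals \<open>sqrt 2 *s x p\<close>.\<close>
  define \<eta> where "\<eta> = complex_of_real (1 / sqrt 2)"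
  have \<eta>: "\<eta> * \<eta> = 1 / 2" "cnj \<eta> = \<eta>"
    unfolding \<eta>_def by (simp_all flip: of_real_mult)
  define \<alpha> where "\<alpha> p = \<eta> *s (x p + cnjv (x p))" for p
  define \<beta> where "\<beta> p = (- \<i> * \<eta>) *s (x p - cnjv (x p))" for p
  have real: "cnjv (\<alpha> p) = \<alpha> p" "cnjv (\<beta> p) = \<beta> p" for p
    by (simp_all add: \<alpha>_def \<beta>_def \<eta>(2) add.commute)
  have ab: "\<alpha> p + \<i> *s \<beta> p = (2 * \<eta>) *s x p" for p
    by (simp add: \<alpha>_def \<beta>_def vec_eq_iff algebra_simps)
  have aa: "bil (\<alpha> p) (\<alpha> q) = (if p = q then 1 else 0)"
    and bb: "bil (\<beta> p) (\<beta> q) = (if p = q then 1 else 0)" and aby: "bil (\<alpha> p) (\<beta> q) = 0"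
    if "p < opp p" "q < opp q" for p q
  proof -
    note f = bx1[OF that] xc[of p q] cx[of p q] bil_cnjv[of "x p" "x q"]
    have e2: "\<eta> * (\<eta> * z) = z / 2" for z using \<eta>(1) by (simp add: mult.assoc[symmetric])
    show "bil (\<alpha> p) (\<alpha> q) = (if p = q then 1 else 0)"
      unfolding \<alpha>_def bil_linear f by (cases "p = q") (simp_all add: e2 algebra_simps)
    show "bil (\<beta> p) (\<beta> q) = (if p = q then 1 else 0)"
      unfolding \<beta>_def bil_linear f by (cases "p = q") (simp_all add: e2 algebra_simps)
    show "bil (\<alpha> p) (\<beta> q) = 0" unfolding \<alpha>_def \<beta>_def bil_linear f by simp
  qed
  have gx: "bil (\<gamma> p) (x q) = 0" "bil (\<gamma> p) (cnjv (x q)) = 0" if p: "opp p = p" and q: "q < opp q" for p q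
  proof -
    obtain a b where g: "\<gamma> p = a *s x p + b *s cnjv (x p)" using g3 by blast
    have "p \<noteq> q" using p q by auto
    then show "bil (\<gamma> p) (x q) = 0" by (simp add: g bil_linear bx2[OF p q] cx)
    show "bil (\<gamma> p) (cnjv (x q)) = 0" using \<open>p \<noteq> q\<close> by (simp add: g bil_linear bil_cnjv bx2[OF p q] xc)
  qed
  have ga: "bil (\<gamma> p) (\<alpha> q) = 0" "bil (\<gamma> p) (\<beta> q) = 0" if "opp p = p" "q < opp q" for p q
    by (simp_all add: \<alpha>_def \<beta>_def bil_linear gx[OF that])
  define E where "E q = (if q < opp q then \<alpha> q else if opp q < q then \<beta> (opp q) else \<gamma> q)" for q
  have Er: "cnjv (E q) = E q" for q by (simp add: E_def real g1)
  have tri: "(q < opp q \<and> E q = \<alpha> q) \<or> (opp q < q \<and> E q = \<beta> (opp q)) \<or> (opp q = q \<and> E q = \<gamma> q)" for q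
    unfolding E_def by (metis linorder_neqE less_asym less_irrefl)
  have oo: "opp q < opp (opp q) \<longleftrightarrow> opp q < q" for q :: 'n by simp
  have oe: "opp p = opp q \<longleftrightarrow> p = q" for p q :: 'n by (metis opp_opp)
  have midu: "p = q" if "opp p = p" "opp q = q" for p q :: 'n
    using mid[OF that(1)] mid[OF that(2)] pos_eq[of p q] by simp
  have EE: "bil (E p) (E q) = (if p = q then 1 else 0)" for p q
  proof -
    have "bil (E p) (E q) = (if p = q then 1 else 0)"
      if "(p < opp p \<and> E p = \<alpha> p) \<or> (opp p < p \<and> E p = \<beta> (opp p)) \<or> (opp p = p \<and> E p = \<gamma> p)"
        "(q < opp q \<and> E q = \<alpha> q) \<or> (opp q < q \<and> E q = \<beta> (opp q)) \<or> (opp q = q \<and> E q = \<gamma> q)"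
      using that
    proof (elim disjE conjE)
      assume "p < opp p" "E p = \<alpha> p" "q < opp q" "E q = \<alpha> q"
      then show ?thesis using aa by simp
    next
      assume a: "p < opp p" "E p = \<alpha> p" "opp q < q" "E q = \<beta> (opp q)"
      then have "p \<noteq> q" by auto
      then show ?thesis using a aby[of p "opp q"] by simp
    next
      assume a: "p < opp p" "E p = \<alpha> p" "opp q = q" "E q = \<gamma> q"
      then have "p \<noteq> q" by auto
      then show ?thesis using a ga(1)[of q p] by (simp add: bil_commute[of "\<alpha> p"])
    next
      assume a: "opp p < p" "E p = \<beta> (opp p)" "q < opp q" "E q = \<alpha> q"
      then have "p \<noteq> q" by auto
      then show ?thesis using a aby[of q "opp p"] by (simp add: bil_commute[of "\<beta> (opp p)"])
    next
      assume "opp p < p" "E p = \<beta> (opp p)" "opp q < q" "E q = \<beta> (opp q)"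
      then show ?thesis using bb[of "opp p" "opp q"] by (simp add: oe)
    next
      assume a: "opp p < p" "E p = \<beta> (opp p)" "opp q = q" "E q = \<gamma> q"
      then have "p \<noteq> q" by auto
      then show ?thesis using a ga(2)[of q "opp p"] by (simp add: bil_commute[of "\<beta> (opp p)"])
    next
      assume a: "opp p = p" "E p = \<gamma> p" "q < opp q" "E q = \<alpha> q"
      then have "p \<noteq> q" by auto
      then show ?thesis using a ga(1)[of p q] by simp
    next
      assume a: "opp p = p" "E p = \<gamma> p" "opp q < q" "E q = \<beta> (opp q)"
      then have "p \<noteq> q" by auto
      then show ?thesis using a ga(2)[of p "opp q"] by simp
    next
      assume a: "opp p = p" "E p = \<gamma> p" "opp q = q" "E q = \<gamma> q"
      then have "p = q" using midu by blast
      then show ?thesis using a g2 by simp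
    qed
    from this[OF tri tri] show ?thesis .
  qed
  define k where "k = (\<chi> r c. E (inv w c) $ r)"
  have kr: "\<forall>i j. k $ i $ j \<in> \<real>"
  proof (intro allI)
    fix i j
    have "cnj (E (inv w j) $ i) = E (inv w j) $ i" using Er[of "inv w j"] unfolding cnjv_def vec_eq_iff vec_lambda_beta by blast
    then show "k $ i $ j \<in> \<real>" by (simp add: k_def Reals_cnj_iff)
  qed
  have kw: "k *v axis (w p) 1 = E p" for p
    unfolding vec_eq_iff matrix_vector_axis by (simp add: k_def winv)
  have ko: "transpose k ** k = mat 1"
  proof -
    have "(transpose k ** k) $ c $ c' = mat 1 $ c $ c'" for c c'
    proof -
      have "(transpose k ** k) $ c $ c' = bil (E (inv w c)) (E (inv w c'))"
        by (simp add: matrix_matrix_mult_def transpose_def k_def bil_def)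
      moreover have "inv w c = inv w c' \<longleftrightarrow> c = c'" by (metis winv(1))
      ultimately show ?thesis by (simp add: EE mat_def)
    qed
    then show ?thesis by (simp add: vec_eq_iff)
  qed
  have dk: "det k \<noteq> 0" using arg_cong[OF ko, of det] by (auto simp: det_mul)
  have fl: "act k (iso_flag w) \<in> flags" unfolding iso_flag_def
    using dk dw by (intro act_flags std_flag_in_flags)
  have iso: "isotropic (act k (iso_flag w))"
    using iso_flag_isotropic[OF w] bil_orthogonal[OF ko] unfolding isotropic_def act_def by auto
  have "V = act k (iso_flag w)"
  proof (rule isotropic_flags_eqI[OF V fl iso])
    fix p :: 'n assume p: "2 * pos p \<le> ?n"
    have "act k (iso_flag w) p \<subseteq> V p"
      unfolding iso_flag_def act_act act_std_flag_span
    proof (rule vec.span_minimal[OF _ flagsD(2)[OF V(1)]], rule image_subsetI)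
      fix q assume "q \<in> {..p}"
      then have q: "q \<le> p" by simp
      then have "pos q \<le> pos p" by (simp add: pos_le)
      then have "2 * pos q \<le> ?n" using p by linarith
      then have qo: "q < opp q" by (simp add: half)
      have "(k ** iso_mat w) *v axis q 1 = k *v (iso_mat w *v axis q 1)" by (simp only: matrix_vector_mul_assoc)
      also have "\<dots> = E q + \<i> *s E (opp q)"
        using qo by (simp add: iso_mat_column matrix_vector_right_distrib vector_scalar_commute kw)
      also have "\<dots> = \<alpha> q + \<i> *s \<beta> q"
      proof -
        have "\<not> opp q < q" using qo by auto
        then show ?thesis using qo by (simp add: E_def)
      qed
      also have "\<dots> = (2 * \<eta>) *s x q" by (rule ab)
      also have "\<dots> \<in> V p"
        using xV[of q] monoD[OF flagsD(1)[OF V(1)] q] by (intro vec.subspace_scale[OF flagsD(2)[OF V(1)]]) blast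
      finally show "(k ** iso_mat w) *v axis q 1 \<in> V p" .
    qed
    then show "V p = act k (iso_flag w) p"
      by (intro vec.subspace_dim_equal[symmetric] flagsD(2)[OF V(1)] flagsD(2)[OF fl])
         (simp_all add: flagsD(3)[OF V(1)] flagsD(3)[OF fl])
  qed
  then show ?thesis using that kr ko by blast
qed

section \<open>The dimension of the base cycle\<close>

text \<open>
  Diagonal matrices with such entries fix all coordinate flags, and they provide orthogonal matrices of determinant \<open>- 1\<close>.
\<close>

definition sign_fun :: "('n \<Rightarrow> complex) \<Rightarrow> bool" where
  "sign_fun e \<longleftrightarrow> (\<forall>i. e i = 1 \<or> e i = - 1)"

lemma diag_sign:
  fixes e :: "'n::{finite,linorder} \<Rightarrow> complex"
  assumes e: "sign_fun e"
  shows "diag e ** diag e = mat 1" "det (diag e) \<noteq> 0" "transpose (diag e) = diag e"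
    "\<forall>i j. diag e $ i $ j \<in> \<real>" "e i * e i = 1"
proof -
  have ee: "e i * e i = 1" for i using e by (metis mult_minus_left mult_1 minus_minus sign_fun_def)
  then show "e i * e i = 1" .
  have "(diag e ** diag e) $ i $ j = mat 1 $ i $ j" for i j
    unfolding diag_mult_left by (simp add: diag_def mat_def ee)
  then show sq: "diag e ** diag e = mat 1" by (simp add: vec_eq_iff)
  then have "det (diag e) * det (diag e) = 1" by (metis det_mul det_I)
  then show "det (diag e) \<noteq> 0" by auto
  show "transpose (diag e) = diag e" by (simp add: transpose_def diag_def vec_eq_iff)
  have "e i \<in> \<real>" for i using e unfolding sign_fun_def by (metis Reals_1 Reals_minus)
  then show "\<forall>i j. diag e $ i $ j \<in> \<real>" by (simp add: diag_def)
qed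

lemma diag_coord_flag:
  fixes w :: "'n::{finite,linorder} \<Rightarrow> 'n"
  assumes e: "sign_fun e"
  shows "act (diag e) (coord_flag w) = coord_flag w"
proof
  fix i
  have "(diag e *v x) \<in> coords J" if "x \<in> coords J" for x and J :: "'n set"
  proof -
    have "(diag e *v x) $ j = e j * x $ j" for j
      unfolding diag_def matrix_vector_mult_def by (simp add: if_distrib if_distribR cong: if_cong)
    then show ?thesis using that by (simp add: coords_def)
  qed
  then show "act (diag e) (coord_flag w) i = coord_flag w i"
    unfolding act_def coord_flag_eq
    by (intro invariant_subspace_image diag_sign(2)[OF e] subspace_coords)
qed

lemma unipotent_conj_diag:
  fixes b :: "('n::{finite,linorder}) cmat"
  assumes e: "sign_fun e" and b: "b \<in> unipotent"
  shows "diag e ** b ** diag e \<in> unipotent"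
proof -
  have "(diag e ** b ** diag e) $ i $ j = e i * b $ i $ j * e j" for i j
    by (simp only: diag_mult_right diag_mult_left)
  then show ?thesis using b diag_sign(5)[OF e] by (simp add: unipotent_def upper_tri_def)
qed

lemma signed_iso_flag_cell:
  fixes w :: "'n::{finite,linorder} \<Rightarrow> 'n"
  assumes e: "sign_fun e" and w: "bij w" and good: "\<And>p. p < opp p \<Longrightarrow> w (opp p) < w p"
  shows "act (diag e) (iso_flag w) \<in> orbit Borel (coord_flag w)"
proof -
  obtain b where b: "b \<in> unipotent" "iso_flag w = act b (coord_flag w)"
    using iso_flag_cell(2)[OF w good] by blast
  have "act (diag e ** b ** diag e) (coord_flag w) = act (diag e) (act b (act (diag e) (coord_flag w)))"
    by (simp only: act_act matrix_mul_assoc)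
  also have "\<dots> = act (diag e) (iso_flag w)" by (simp only: diag_coord_flag[OF e] b(2))
  finally have "act (diag e) (iso_flag w) = act (diag e ** b ** diag e) (coord_flag w)" ..
  moreover have "diag e ** b ** diag e \<in> Borel" using unipotent_conj_diag[OF e b(1)] unipotent_Borel by blast
  ultimately show ?thesis unfolding orbit_def by blast
qed

text \<open>
  If the orthogonal matrix that maps \<open>iso_flag w\<close> to \<open>V\<close> has determinant \<open>- 1\<close>, a coordinate reflection corrects it without
  leaving the Bruhat cell. In this way both orientations of isotropic flags in even dimension are covered.
\<close>

lemma signed_iso_flag_in_orbit:
  fixes V :: "('n::{finite,linorder}) flag" and w :: "'n \<Rightarrow> 'n"
  assumes V: "V \<in> flags" "isotropic V" and w: "bij w" and good: "\<And>p. p < opp p \<Longrightarrow> w (opp p) < w p"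
  obtains e where "sign_fun e" "act (diag e) (iso_flag w) \<in> orbit SO_R V"
proof -
  obtain k :: "'n cmat" where k: "\<forall>i j. k $ i $ j \<in> \<real>" "transpose k ** k = mat 1" "V = act k (iso_flag w)"
    using isotropic_transitive[OF V w iso_flag_cell(1)[OF w good]] by blast
  have "det k * det k = 1" using arg_cong[OF k(2), of det] by (simp add: det_mul)
  then have dk: "det k = 1 \<or> det k = - 1" by (simp add: square_eq_1_iff)
  \<comment> \<open>The identity or the reflection in the first coordinate.\<close>
  define e :: "'n \<Rightarrow> complex" where "e i = (if i = Min UNIV then det k else 1)" for i
  have e: "sign_fun e" using dk by (auto simp: sign_fun_def e_def)
  let ?l = "k ** diag e"
  have det: "det (diag e) = det k" by (simp add: det_diag e_def)
  have "transpose ?l ** ?l = diag e ** (transpose k ** k) ** diag e"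
    by (simp add: matrix_transpose_mul diag_sign(3)[OF e] matrix_mul_assoc)
  then have "transpose ?l ** ?l = mat 1" by (simp add: k(2) diag_sign(1)[OF e])
  moreover have "det ?l = 1" using \<open>det k * det k = 1\<close> by (simp add: det_mul det)
  moreover have "\<forall>i j. ?l $ i $ j \<in> \<real>" using real_matrix_mult[OF k(1) diag_sign(4)[OF e]] by blast
  ultimately have l: "?l \<in> SO_R" by (simp add: SO_R_iff)
  have "V = act ?l (act (diag e) (iso_flag w))"
    by (simp add: k(3) act_act matrix_mul_assoc[symmetric] diag_sign(1)[OF e])
  moreover have "transpose ?l ** ?l = mat 1" using l by (simp add: SO_R_iff)
  ultimately have "act (transpose ?l) V = act (diag e) (iso_flag w)" by (metis act_act act_one)
  then have "act (diag e) (iso_flag w) \<in> orbit SO_R V"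
    using SO_R_transpose[OF l] unfolding orbit_def by (metis imageI)
  then show ?thesis using that e by blast
qed

lemma orbitI: "h \<in> H \<Longrightarrow> act h X \<in> orbit H X"
  by (simp add: orbit_def)

lemma orbitE: "Y \<in> orbit H X \<Longrightarrow> (\<And>h. h \<in> H \<Longrightarrow> Y = act h X \<Longrightarrow> P) \<Longrightarrow> P"
  unfolding orbit_def by (erule imageE) blast

lemma orbit_SO_R_subset:
  fixes X Y :: "('n::{finite,linorder}) flag"
  assumes "Y \<in> orbit SO_R X"
  shows "orbit SO_R Y \<subseteq> orbit SO_R X"
proof
  fix Z assume Z: "Z \<in> orbit SO_R Y"
  obtain k where k: "k \<in> SO_R" "Y = act k X" using assms by (rule orbitE)
  obtain l where l: "l \<in> SO_R" "Z = act l Y" using Z by (rule orbitE)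
  have "Z = act (l ** k) X" by (simp only: l(2) k(2) act_act)
  then show "Z \<in> orbit SO_R X" using orbitI[OF SO_R_mult[OF l(1) k(1)]] by (simp only:)
qed

lemma orbit_SO_R_eq:
  fixes V V' :: "('n::{finite,linorder}) flag"
  assumes "V' \<in> orbit SO_R V"
  shows "orbit SO_R V' = orbit SO_R V"
proof (rule subset_antisym[OF orbit_SO_R_subset[OF assms] orbit_SO_R_subset])
  obtain k where k: "k \<in> SO_R" "V' = act k V" using assms by (rule orbitE)
  have "V = act (transpose k) V'" unfolding k(2) act_act using k(1) by (simp add: SO_R_iff)
  then show "V \<in> orbit SO_R V'" using orbitI[OF SO_R_transpose[OF k(1)], of V'] by (simp only:)
qed

text \<open>
  The stabilizer of the model flag in \<open>so_R\<close> is \<open>block\<close>, the infinitesimal rotations in the planes spanned by a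
  coordinate vector and its opposite. The subspace \<open>off_block\<close> is a complement, and it maps isomorphically to the tangent
  space of the orbit.
\<close>

definition off_block :: "('n::{finite,linorder}) cmat set" where
  "off_block = {A \<in> so_R. \<forall>p. A $ (opp p) $ p = 0}"

definition block :: "('n::{finite,linorder}) cmat set" where
  "block = {A \<in> so_R. \<forall>i j. i \<noteq> opp j \<longrightarrow> A $ i $ j = 0}"

lemma so_R_skew: "A \<in> so_R \<Longrightarrow> A $ i $ j = - (A $ j $ i)" for A :: "'n::finite cmat"
proof -
  assume A: "A \<in> so_R"
  have "A $ i $ j = transpose A $ j $ i" by (simp add: transpose_def)
  also have "\<dots> = - (A $ j $ i)" using A by (simp add: so_R_def)
  finally show "A $ i $ j = - (A $ j $ i)" .
qed

lemma so_R_I: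
  fixes A :: "'n::finite cmat"
  assumes "\<And>i j. A $ i $ j \<in> \<real>" "\<And>i j. A $ i $ j = - (A $ j $ i)"
  shows "A \<in> so_R"
proof -
  have "transpose A = - A"
    unfolding vec_eq_iff transpose_def vec_lambda_beta vector_uminus_component using assms(2) by blast
  then show ?thesis using assms(1) by (simp add: so_R_def)
qed

text \<open>
  The columns of \<open>iso_mat opp\<close> in the lower half are eigenvectors of the rotation in their plane. In the upper half, the plane is
  contained in the span of the columns up to the given one.
\<close>

lemma block_stab:
  fixes A :: "('n::{finite,linorder}) cmat"
  assumes A: "A \<in> block"
  shows "A \<in> stab (iso_flag opp)"
proof -
  have so: "A \<in> so_R" and z: "\<And>i j. i \<noteq> opp j \<Longrightarrow> A $ i $ j = 0" using A by (auto simp: block_def)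
  let ?M = "iso_mat opp :: 'n cmat"
  have sub: "vec.subspace (iso_flag opp i)" for i :: 'n
    unfolding iso_flag_def act_std_flag_span by (rule vec.subspace_span)
  have Ae: "A *v axis j 1 = A $ (opp j) $ j *s axis (opp j) 1" for j
  proof -
    have "(A *v axis j 1) $ i = (A $ (opp j) $ j *s axis (opp j) 1) $ i" for i
      unfolding matrix_vector_axis using z[of i j] by (cases "i = opp j") (simp_all add: axis_def)
    then show ?thesis unfolding vec_eq_iff by blast
  qed
  have sk: "A $ p $ (opp p) = - (A $ (opp p) $ p)" for p by (rule so_R_skew[OF so])
  have col: "?M *v axis q 1 \<in> iso_flag opp i" if "q \<le> i" for q i
    unfolding iso_flag_def act_std_flag_span using that by (intro vec.span_base) auto
  have Acol: "A *v (?M *v axis p 1) \<in> iso_flag opp p" for p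
  proof -
    let ?a = "A $ (opp p) $ p"
    consider "p < opp p" | "opp p = p" | "opp p < p" by (metis linorder_neqE)
    then show ?thesis
    proof cases
      case 1
      have "A *v (?M *v axis p 1) = A *v axis (opp p) 1 + \<i> *s (A *v axis p 1)"
        using 1 by (simp add: iso_mat_column matrix_vector_right_distrib vector_scalar_commute)
      also have "\<dots> = (\<i> * ?a) *s (?M *v axis p 1)"
        using 1 by (simp add: iso_mat_column Ae sk[of p] vec_eq_iff algebra_simps)
      finally show ?thesis by (simp add: vec.subspace_scale[OF sub] col)
    next
      case 2
      have "?a = 0" using sk[of p] 2 by simp
      then have "A *v (?M *v axis p 1) = 0" using 2 by (simp add: iso_mat_column Ae)
      then show ?thesis using vec.subspace_0[OF sub] by simp
    next
      case 3
      then have np: "\<not> p < opp p" by simp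
      let ?q = "opp p"
      have "?M *v axis p 1 = axis ?q 1" using np by (simp add: iso_mat_column)
      then have "A *v (?M *v axis p 1) = A $ p $ ?q *s axis p 1" using Ae[of ?q] by simp
      moreover have "axis p 1 = ?M *v axis ?q 1 - \<i> *s (?M *v axis p 1)"
        using 3 np by (simp add: iso_mat_column)
      moreover have "?M *v axis ?q 1 - \<i> *s (?M *v axis p 1) \<in> iso_flag opp p"
        using 3 by (intro vec.subspace_diff vec.subspace_scale sub col) simp_all
      ultimately show ?thesis by (simp add: vec.subspace_scale[OF sub])
    qed
  qed
  have "A *v x \<in> iso_flag opp i" if "x \<in> iso_flag opp i" for i x
  proof -
    have "x \<in> vec.span ((\<lambda>q. ?M *v axis q 1) ` {..i})" using that unfolding iso_flag_def act_std_flag_span .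
    then have "A *v x \<in> (\<lambda>y. A *v y) ` vec.span ((\<lambda>q. ?M *v axis q 1) ` {..i})" by (rule imageI)
    also have "\<dots> = vec.span ((\<lambda>y. A *v y) ` (\<lambda>q. ?M *v axis q 1) ` {..i})"
      by (rule vec.linear_span_image[symmetric, OF matrix_vector_mul_linear_gen])
    also have "\<dots> \<subseteq> iso_flag opp i"
    proof (rule vec.span_minimal[OF _ sub], unfold image_image, rule image_subsetI)
      fix q assume "q \<in> {..i}"
      then have "q \<le> i" by simp
      have fl: "(iso_flag opp :: 'n flag) \<in> flags"
      proof -
        have "det ?M \<noteq> 0" by (rule iso_flag_cell(1)[OF bij_opp]) simp
        then show ?thesis unfolding iso_flag_def by (intro act_flags std_flag_in_flags)
      qed
      show "A *v (?M *v axis q 1) \<in> iso_flag opp i"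
        using Acol[of q] monoD[OF flagsD(1)[OF fl] \<open>q \<le> i\<close>] by blast
    qed
    finally show ?thesis .
  qed
  then show ?thesis by (simp add: stab_def)
qed

text \<open>
  The columns of \<open>iso_mat opp\<close> in the lower half are Hermitian orthogonal, so a skew Hermitian matrix that stabilizes the flag
  has them as eigenvectors. Such a column is supported on two coordinates; in every other row the eigenvalue equation separates into
  its real and imaginary parts, and the corresponding entries of \<open>A\<close> vanish. The entries in the two rows themselves vanish
  by skewness and by the definition of \<open>off_block\<close>.
\<close>

lemma off_block_stab:
  fixes A :: "('n::{finite,linorder}) cmat"
  assumes A: "A \<in> off_block" and st: "A \<in> stab (iso_flag opp)"
  shows "A = 0"
proof -
  have so: "A \<in> so_R" and z: "\<And>p. A $ (opp p) $ p = 0" using A by (auto simp: off_block_def)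
  let ?M = "iso_mat opp :: 'n cmat"
  let ?u = "\<lambda>p :: 'n. ?M *v axis p 1"
  have u: "?u p = axis (opp p) 1 + \<i> *s axis p 1" if "p < opp p" for p using that by (simp add: iso_mat_column)
  have col: "?u q \<in> iso_flag opp i" if "q \<le> i" for q i
    unfolding iso_flag_def act_std_flag_span using that by (intro vec.span_base) auto
  have opp_half: "q < opp q" if "q \<le> p" "p < opp p" for p q :: 'n
  proof -
    have "opp p \<le> opp q" using that(1) opp_less[of q p] by (metis not_le)
    then show ?thesis using that by (meson le_less_trans less_le_trans)
  qed
  have huu: "herm (?u p) (?u q) = (if p = q then 2 else 0)" if "p < opp p" "q < opp q" for p q
  proof -
    have c: "cnjv (axis i 1) = axis i 1" for i :: 'n by (simp add: cnjv_def axis_def vec_eq_iff)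
    have ne: "opp p \<noteq> q" "p \<noteq> opp q"
      using that by (metis less_asym opp_opp)+
    have oe: "opp p = opp q \<longleftrightarrow> p = q" by (metis opp_opp)
    show ?thesis
      unfolding u[OF that(1)] u[OF that(2)] herm_bil cnjv_simps c by (simp add: bil_linear bil_axis ne oe)
  qed
  have expand: "\<exists>a. a \<in> coords {..p} \<and> y = (\<Sum>q\<in>{..p}. a $ q *s ?u q)" if y: "y \<in> iso_flag opp p" for p y
  proof -
    obtain a where a: "a \<in> coords {..p}" "y = ?M *v a" using y by (auto simp: iso_flag_def act_def std_flag_eq)
    have "y $ i = (\<Sum>q\<in>UNIV. (a $ q *s ?u q) $ i)" for i
      unfolding a(2) vector_smult_component matrix_vector_axis by (simp add: matrix_vector_mult_def mult.commute)
    also have "(\<Sum>q\<in>UNIV. (a $ q *s ?u q) $ i) = (\<Sum>q\<in>{..p}. (a $ q *s ?u q) $ i)" for i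
      using a(1) by (intro sum.mono_neutral_right) (auto simp: coords_def)
    finally have "y = (\<Sum>q\<in>{..p}. a $ q *s ?u q)" by (simp add: vec_eq_iff)
    then show ?thesis using a(1) by blast
  qed
  have herm_sum: "herm (\<Sum>q\<in>S. c q *s v q) x = (\<Sum>q\<in>S. c q * herm (v q) x)" if "finite S" for S c v and x :: "(complex, 'n) vec"
    using that by (induction S rule: finite_induct) (simp_all add: herm_linear)
  have eigen: "\<exists>c. A *v ?u p = c *s ?u p" if p: "p < opp p" for p
  proof -
    have Ast: "A *v y \<in> iso_flag opp q" if "y \<in> iso_flag opp q" for q y using st that by (simp add: stab_def)
    obtain a where a: "A *v ?u p = (\<Sum>q\<in>{..p}. a $ q *s ?u q)"
      using expand[OF Ast[OF col[OF order_refl]]] by blast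
    have "a $ q = 0" if q: "q < p" for q
    proof -
      have qh: "q < opp q" by (rule opp_half[OF less_imp_le[OF q] p])
      obtain b where b: "A *v ?u q = (\<Sum>m\<in>{..q}. b $ m *s ?u m)"
        using expand[OF Ast[OF col[OF order_refl]]] by blast
      have "herm (A *v ?u q) (?u p) = (\<Sum>m\<in>{..q}. b $ m * herm (?u m) (?u p))"
        unfolding b by (rule herm_sum) simp
      also have "\<dots> = 0"
      proof (intro sum.neutral ballI)
        fix m assume "m \<in> {..q}"
        then have "m \<le> q" "m \<noteq> p" using q by auto
        then show "b $ m * herm (?u m) (?u p) = 0" using huu[OF opp_half[OF _ qh] p, of m] by simp
      qed
      finally have "herm (?u p) (A *v ?u q) = 0" using herm_commute[of "?u p" "A *v ?u q"] by simp
      then have "herm (A *v ?u p) (?u q) = 0" using herm_so_R[OF so, of "?u p" "?u q"] by simp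
      moreover have "herm (A *v ?u p) (?u q) = (\<Sum>m\<in>{..p}. a $ m * herm (?u m) (?u q))"
        unfolding a by (rule herm_sum) simp
      moreover have "\<dots> = (\<Sum>m\<in>{..p}. if m = q then 2 * a $ q else 0)"
        using huu[OF opp_half[OF _ p] qh] by (intro sum.cong) auto
      moreover have "\<dots> = 2 * a $ q" using q by simp
      ultimately show ?thesis by simp
    qed
    then have "(\<Sum>q\<in>{..p}. a $ q *s ?u q) = (\<Sum>q\<in>{..p}. if q = p then a $ p *s ?u p else 0)"
      by (intro sum.cong) (auto simp: order.order_iff_strict)
    then have "A *v ?u p = a $ p *s ?u p" using a by simp
    then show ?thesis by blast
  qed
  have real: "Im (A $ i $ j) = 0" for i j using so by (simp add: so_R_def complex_is_Real_iff)
  have diag0: "A $ i $ i = 0" for i using so_R_skew[OF so, of i i] by simp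
  have z': "A $ p $ (opp p) = 0" for p using z[of "opp p"] by simp
  have cols: "A $ r $ p = 0 \<and> A $ r $ (opp p) = 0" if p: "p < opp p" for p r
  proof (cases "r = p \<or> r = opp p")
    case True
    then show ?thesis using diag0 z z' by auto
  next
    case False
    obtain c where "A *v ?u p = c *s ?u p" using eigen[OF p] by blast
    then have "(A *v ?u p) $ r = c * ?u p $ r" by simp
    moreover have "?u p $ r = 0" unfolding u[OF p] using False by (simp add: axis_def)
    moreover have "(A *v ?u p) $ r = A $ r $ (opp p) + \<i> * A $ r $ p"
      unfolding u[OF p] by (simp add: matrix_vector_right_distrib vector_scalar_commute matrix_vector_axis)
    ultimately have "A $ r $ (opp p) + \<i> * A $ r $ p = 0" by simp
    then show ?thesis using real[of r p] real[of r "opp p"] by (simp add: complex_eq_iff)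
  qed
  have col0: "A $ r $ j = 0" if "opp j \<noteq> j" for r j
  proof -
    consider "j < opp j" | "opp j < opp (opp j)" using \<open>opp j \<noteq> j\<close> by (metis linorder_neqE opp_opp)
    then show ?thesis using cols[of j r] cols[of "opp j" r] by cases auto
  qed
  have "A $ r $ j = 0" for r j
  proof (cases "opp j = j")
    case False
    then show ?thesis by (rule col0)
  next
    case True
    show ?thesis
    proof (cases "opp r = r")
      case False
      then have "A $ j $ r = 0" by (rule col0)
      then show ?thesis using so_R_skew[OF so, of r j] by simp
    next
      case True
      then have "2 * pos r = 2 * pos j"
        using \<open>opp j = j\<close> pos_opp[of r] pos_opp[of j] pos_range[of r] pos_range[of j] by simp
      then have "r = j" by (simp add: pos_eq)
      then show ?thesis using diag0 by simp
    qed
  qed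
  then show ?thesis by (simp add: vec_eq_iff)
qed

lemma stab_conj_diag:
  fixes X :: "('n::{finite,linorder}) cmat" and e :: "'n \<Rightarrow> complex"
  assumes e: "sign_fun e" and X: "X \<in> stab (act (diag e) Q)"
  shows "diag e ** X ** diag e \<in> stab Q"
  unfolding stab_def
proof (intro CollectI allI ballI)
  fix i x assume "x \<in> Q i"
  then have "diag e *v x \<in> act (diag e) Q i" by (simp add: act_def)
  then have "X *v (diag e *v x) \<in> act (diag e) Q i" using X by (simp add: stab_def)
  then obtain y where y: "y \<in> Q i" "X *v (diag e *v x) = diag e *v y" by (auto simp: act_def)
  have "(diag e ** X ** diag e) *v x = diag e *v (X *v (diag e *v x))"
    by (simp only: matrix_vector_mul_assoc matrix_mul_assoc)
  also have "\<dots> = diag e *v (diag e *v y)" by (simp only: y(2))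
  also have "\<dots> = (diag e ** diag e) *v y" by (simp only: matrix_vector_mul_assoc)
  also have "\<dots> = y" by (simp add: diag_sign(1)[OF e])
  finally show "(diag e ** X ** diag e) *v x \<in> Q i" using y(1) by simp
qed

lemma conj_diag_entries: "(diag e ** X ** diag e) $ i $ j = e i * X $ i $ j * e j" for X :: "'n::finite cmat"
  by (simp only: diag_mult_right diag_mult_left)

lemma so_R_conj_diag:
  fixes X :: "('n::{finite,linorder}) cmat"
  assumes e: "sign_fun e" and X: "X \<in> so_R"
  shows "diag e ** X ** diag e \<in> so_R"
proof (rule so_R_I)
  fix i j
  show "(diag e ** X ** diag e) $ i $ j \<in> \<real>"
  proof -
    have "e i \<in> \<real>" for i using e unfolding sign_fun_def by (metis Reals_1 Reals_minus)
    moreover have "X $ i $ j \<in> \<real>" using X by (simp add: so_R_def)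
    ultimately show ?thesis unfolding conj_diag_entries by (intro Reals_mult)
  qed
  show "(diag e ** X ** diag e) $ i $ j = - ((diag e ** X ** diag e) $ j $ i)"
    unfolding conj_diag_entries so_R_skew[OF X, of i j] by (simp add: mult.commute mult.left_commute)
qed

text \<open>
  The entries below the diagonal are free, except for the \<open>\<lfloor>n/2\<rfloor>\<close> ones on the antidiagonal, which vanish.
\<close>

lemma dim_off_block:
  "dim (off_block :: ('n::{finite,linorder}) cmat set) + CARD('n) div 2 = card {(i, j :: 'n). j < i}"
proof -
  define P where "P = {(i, j :: 'n). j < i \<and> i \<noteq> opp j}"
  define R where "R = {x :: real^('n \<times> 'n). \<forall>p. p \<notin> P \<longrightarrow> x $ p = 0}"
  define \<phi> :: "real^('n \<times> 'n) \<Rightarrow> 'n cmat" where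
    "\<phi> x = (\<chi> i j. of_real (if j < i then x $ (i, j) else if i < j then - x $ (j, i) else 0))" for x
  have lin: "linear \<phi>"
    by (rule linearI) (simp_all add: \<phi>_def vec_eq_iff scaleR_conv_of_real[where 'a=complex])
  have R: "subspace R" by (simp add: R_def subspace_def)
  have inj: "inj_on \<phi> (span R)"
  proof (rule inj_onI)
    fix x y assume "x \<in> span R" "y \<in> span R" and eq: "\<phi> x = \<phi> y"
    then have xy: "x \<in> R" "y \<in> R" using R by (simp_all only: span_eq_iff[THEN iffD2])
    have "x $ (i, j) = y $ (i, j)" for i j
    proof (cases "j < i")
      case True
      have "\<phi> x $ i $ j = \<phi> y $ i $ j" using eq by simp
      then show ?thesis using True by (simp add: \<phi>_def)
    next
      case False
      then have "(i, j) \<notin> P" by (simp add: P_def)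
      then show ?thesis using xy by (simp add: R_def)
    qed
    then show "x = y" by (simp add: vec_eq_iff)
  qed
  have "\<phi> ` R = off_block"
  proof (intro equalityI subsetI)
    fix A assume "A \<in> \<phi> ` R"
    then obtain x where x: "x \<in> R" "A = \<phi> x" by blast
    have "A \<in> so_R"
    proof (rule so_R_I)
      fix i j :: 'n
      show "A $ i $ j \<in> \<real>" by (simp add: x(2) \<phi>_def)
      consider "i < j" | "i = j" | "j < i" by (rule linorder_cases)
      then show "A $ i $ j = - (A $ j $ i)" by cases (auto simp: x(2) \<phi>_def dest: less_asym)
    qed
    moreover have "A $ (opp p) $ p = 0" for p
    proof -
      have "(opp p, p) \<notin> P" "(p, opp p) \<notin> P" by (simp_all add: P_def)
      then show ?thesis using x(1) by (simp add: x(2) \<phi>_def R_def)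
    qed
    ultimately show "A \<in> off_block" by (simp add: off_block_def)
  next
    fix A :: "'n cmat" assume A: "A \<in> off_block"
    then have so: "A \<in> so_R" and z: "\<And>p. A $ (opp p) $ p = 0" by (auto simp: off_block_def)
    have re: "of_real (Re (A $ i $ j)) = A $ i $ j" for i j using so by (simp add: so_R_def)
    define x :: "real^('n \<times> 'n)" where "x = (\<chi> p. if p \<in> P then Re (A $ fst p $ snd p) else 0)"
    have x: "x $ (i, j) = Re (A $ i $ j)" if "j < i" for i j
      using that z[of j] by (cases "i = opp j") (simp_all add: x_def P_def)
    have "\<phi> x $ i $ j = A $ i $ j" for i j
    proof -
      consider "i < j" | "i = j" | "j < i" by (rule linorder_cases)
      then show ?thesis
      proof cases
        case 1
        then have "\<not> j < i" by simp
        then show ?thesis using 1 x[OF 1] re[of j i] so_R_skew[OF so, of i j] by (simp add: \<phi>_def)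
      next
        case 2
        then show ?thesis using so_R_skew[OF so, of i i] by (simp add: \<phi>_def)
      next
        case 3
        then show ?thesis using x[OF 3] re[of i j] by (simp add: \<phi>_def)
      qed
    qed
    then have "\<phi> x = A" by (simp add: vec_eq_iff)
    moreover have "x \<in> R" by (simp add: R_def x_def)
    ultimately show "A \<in> \<phi> ` R" by blast
  qed
  then have "dim (off_block :: 'n cmat set) = dim R" using dim_image_eq[OF lin inj] by simp
  also have "dim R = card P"
    using dim_substandard_cart[where 'a=real and 'n="'n \<times> 'n", of P] unfolding R_def dim_vec_eq .
  finally have dim: "dim (off_block :: 'n cmat set) = card P" .
  have "{(i, j :: 'n). j < i} = P \<union> (\<lambda>j. (opp j, j)) ` {j. j < opp j}" by (auto simp: P_def)
  moreover have "P \<inter> (\<lambda>j. (opp j, j)) ` {j. j < opp j} = {}" by (auto simp: P_def)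
  moreover have "card ((\<lambda>j :: 'n. (opp j, j)) ` {j. j < opp j}) = CARD('n) div 2"
    by (subst card_image) (auto simp: inj_on_def card_less_opp)
  ultimately have "card {(i, j :: 'n). j < i} = card P + CARD('n) div 2"
    using card_Un_disjoint[of P "(\<lambda>j. (opp j, j)) ` {j. j < opp j}"] by simp
  then show ?thesis using dim by simp
qed

text \<open>
  The orbit contains the model flag of \<open>opp\<close> up to coordinate reflections; any \<open>w\<close> with \<open>w (opp p) < w p\<close> would do in place of
  \<open>opp\<close>. Its tangent space there is the isomorphic image of \<open>off_block\<close>, of real dimension \<open>2 d\<close>.
\<close>

lemma cycle_dim:
  fixes V :: "('n::{finite,linorder}) flag"
  assumes V: "V \<in> flags" and sub: "complex_submanifold d (orbit SO_R V)"
  shows "2 * d + CARD('n) div 2 = card {(i, j :: 'n). j < i}"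
proof -
  have good: "opp (opp p) < opp p" if "p < opp p" for p :: 'n using that by simp
  obtain e :: "'n \<Rightarrow> complex" where e: "sign_fun e" "act (diag e) (iso_flag opp) \<in> orbit SO_R V"
    using signed_iso_flag_in_orbit[OF V cycle_isotropic[OF V sub] bij_opp good] by blast
  let ?V = "act (diag e) (iso_flag opp)"
  have sub': "complex_submanifold d (orbit SO_R ?V)" using sub by (simp only: orbit_SO_R_eq[OF e(2)])
  obtain W :: "(complex^('n \<times> 'n)) set" and \<Lambda> :: "complex^('n \<times> 'n) \<Rightarrow> 'n cmat" and \<Theta> :: "'n cmat \<Rightarrow> 'n cmat"
    where W: "vec.subspace W" "vec.dim W = d" and Ll: "linear \<Lambda>" and L0: "\<forall>v\<in>W. \<Lambda> v = 0 \<longrightarrow> v = 0"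
    and Tl: "linear \<Theta>" and T0: "\<forall>A. \<Theta> A = 0 \<longleftrightarrow> A \<in> stab ?V" and TL: "\<Theta> ` so_R = \<Lambda> ` W"
    using cycle_tangent[OF refl sub'] by (elim exE conjE) (rule that; assumption)
  have st: "A \<in> stab ?V \<longleftrightarrow> diag e ** A ** diag e \<in> stab (iso_flag opp)" for A
  proof
    show "A \<in> stab ?V \<Longrightarrow> diag e ** A ** diag e \<in> stab (iso_flag opp)" by (rule stab_conj_diag[OF e(1)])
    assume a: "diag e ** A ** diag e \<in> stab (iso_flag opp)"
    have "iso_flag opp = act (diag e) ?V" by (simp add: act_act diag_sign(1)[OF e(1)])
    then have "diag e ** A ** diag e \<in> stab (act (diag e) ?V)" using a by simp
    then have "diag e ** (diag e ** A ** diag e) ** diag e \<in> stab ?V" by (rule stab_conj_diag[OF e(1)])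
    moreover have "diag e ** (diag e ** A ** diag e) ** diag e = (diag e ** diag e) ** A ** (diag e ** diag e)"
      by (simp only: matrix_mul_assoc)
    ultimately show "A \<in> stab ?V" by (simp add: diag_sign(1)[OF e(1)])
  qed
  have "dim (\<Lambda> ` W) = dim W"
  proof (rule dim_image_eq[OF Ll])
    have sp: "span W = W" using real_subspace[OF W(1)] by (simp only: span_eq_iff)
    have "inj_on \<Lambda> W"
    proof (rule inj_onI)
      fix x y assume xy: "x \<in> W" "y \<in> W" "\<Lambda> x = \<Lambda> y"
      then have "\<Lambda> (x - y) = 0" by (simp add: linear_diff[OF Ll])
      then have "x - y = 0" using L0 vec.subspace_diff[OF W(1) xy(1,2)] by blast
      then show "x = y" by simp
    qed
    then show "inj_on \<Lambda> (span W)" by (simp only: sp)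
  qed
  moreover have "\<Theta> ` so_R = \<Theta> ` off_block"
  proof (intro equalityI image_subsetI)
    fix A :: "'n cmat" assume A: "A \<in> so_R"
    define B :: "'n cmat" where "B = (\<chi> i j. if i = opp j then A $ i $ j else 0)"
    have oi: "i = opp j \<longleftrightarrow> j = opp i" for i j :: 'n by (metis opp_opp)
    have B: "B \<in> so_R"
    proof (rule so_R_I)
      fix i j
      show "B $ i $ j \<in> \<real>" using A by (simp add: B_def so_R_def)
      show "B $ i $ j = - (B $ j $ i)"
        using so_R_skew[OF A, of i j] oi[of i j] by (cases "i = opp j") (simp_all add: B_def)
    qed
    have "diag e ** B ** diag e \<in> block"
      unfolding block_def using so_R_conj_diag[OF e(1) B] conj_diag_entries[of e B] by (auto simp: B_def)
    then have "\<Theta> B = 0" using T0 st block_stab by blast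
    then have "\<Theta> A = \<Theta> (A - B)" by (simp add: linear_diff[OF Tl])
    moreover have "A - B \<in> off_block"
    proof -
      have "- B \<in> so_R" using so_R_scaleR[OF B, of "-1"] by simp
      then have "A - B \<in> so_R" using A B by (simp add: so_R_def transpose_diff)
      moreover have "(A - B) $ (opp p) $ p = 0" for p by (simp add: B_def)
      ultimately show ?thesis by (simp add: off_block_def)
    qed
    ultimately show "\<Theta> A \<in> \<Theta> ` off_block" by blast
  next
    fix A :: "'n cmat" assume "A \<in> off_block"
    then show "\<Theta> A \<in> \<Theta> ` so_R" by (simp add: off_block_def)
  qed
  moreover have "dim (\<Theta> ` off_block) = dim (off_block :: 'n cmat set)"
  proof (rule dim_image_eq[OF Tl])
    have so: "subspace (so_R :: 'n cmat set)"
      unfolding subspace_def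
    proof (intro conjI ballI allI)
      show "(0 :: 'n cmat) \<in> so_R" by (rule so_R_I) simp_all
      show "x + y \<in> so_R" if "x \<in> so_R" "y \<in> so_R" for x y :: "'n cmat"
        using that by (simp add: so_R_def transpose_add)
      show "c *\<^sub>R x \<in> so_R" if "x \<in> so_R" for c and x :: "'n cmat" by (rule so_R_scaleR[OF that])
    qed
    then have S: "subspace (off_block :: 'n cmat set)" by (simp add: subspace_def off_block_def)
    then have sp: "span off_block = (off_block :: 'n cmat set)" by (simp only: span_eq_iff)
    show "inj_on \<Theta> (span off_block)"
      unfolding sp
    proof (rule inj_onI)
      fix x y :: "'n cmat" assume xy: "x \<in> off_block" "y \<in> off_block" "\<Theta> x = \<Theta> y"
      let ?A = "x - y"
      have A: "?A \<in> off_block" by (rule subspace_diff[OF S xy(1,2)])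
      have "\<Theta> ?A = 0" using xy(3) by (simp add: linear_diff[OF Tl])
      then have "diag e ** ?A ** diag e \<in> stab (iso_flag opp)" using T0 st by blast
      moreover have "diag e ** ?A ** diag e \<in> off_block"
        using A so_R_conj_diag[OF e(1), of ?A] unfolding off_block_def by (simp add: conj_diag_entries)
      ultimately have z: "diag e ** ?A ** diag e = 0" by (intro off_block_stab)
      have "diag e ** (diag e ** ?A ** diag e) ** diag e = (diag e ** diag e) ** ?A ** (diag e ** diag e)"
        by (simp only: matrix_mul_assoc)
      then have "?A = 0" by (simp add: z diag_sign(1)[OF e(1)])
      then show "x = y" by simp
    qed
  qed
  ultimately have "dim W = dim (off_block :: 'n cmat set)" using TL by simp
  then show ?thesis using dim_off_block[where 'n='n] real_dim_eq[OF W(1)] W(2) by simp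
qed

section \<open>Schubert varieties that meet the base cycle\<close>

lemma codim_arith:
  fixes n d N l :: nat
  assumes "2 * N = n * (n - 1)" "2 * d + n div 2 = N"
  shows "l + d = N \<longleftrightarrow> l = n\<^sup>2 div 4"
proof -
  have "N = n\<^sup>2 div 4 + d"
  proof (cases "even n")
    case True
    then obtain m where n: "n = 2 * m" by blast
    have "n\<^sup>2 div 4 = m * m" by (simp add: n power2_eq_square)
    moreover have "N = m * (2 * m - 1)" using assms(1) by (simp add: n)
    then have "N + m = 2 * (m * m)" by (cases m) (simp_all add: algebra_simps)
    ultimately show ?thesis using assms(2) by (simp add: n)
  next
    case False
    then obtain m where n: "n = 2 * m + 1" by (rule oddE)
    have "n\<^sup>2 = 4 * (m * m + m) + 1" by (simp add: n power2_eq_square algebra_simps)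
    then have "n\<^sup>2 div 4 = m * m + m" by simp
    moreover have "N = 2 * (m * m) + m" using assms(1) by (simp add: n algebra_simps)
    ultimately show ?thesis using assms(2) by (simp add: n)
  qed
  then show ?thesis by auto
qed

text \<open>
  For \<open>1 \<le> t\<close>, the intersections of \<open>V\<^sub>t\<close> and \<open>V\<^bsub>n-t\<^esub>\<close> with \<open>\<langle>e\<^sub>1, \<dots>, e\<^sub>x\<rangle>\<close> are orthogonal in a space of dimension \<open>x\<close>.
\<close>

lemma isotropic_rank_le:
  fixes V :: "('n::{finite,linorder}) flag" and w :: "'n \<Rightarrow> 'n"
  assumes w: "bij w" and V: "V \<in> schubert w" "isotropic V" and t: "t \<le> CARD('n) div 2"
  shows "rk w t {..x} + rk w (CARD('n) - t) {..x} \<le> card {..x}"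
proof (cases "t = 0")
  case True
  have "\<not> pos a \<le> 0" for a :: 'n using pos_range(1)[of a] by linarith
  then have "{a. pos a \<le> 0 \<and> w a \<in> {..x}} = {}" by blast
  then have "rk w 0 {..x} = 0" by (simp only: rk_def card.empty)
  then show ?thesis using True rk_top[OF order_refl w, of "{..x}"] by simp
next
  case False
  then have t1: "1 \<le> t" "t \<le> CARD('n)" "1 \<le> CARD('n) - t" "CARD('n) - t \<le> CARD('n)" using t by auto
  obtain i :: 'n where i: "pos i = t" using ex_pos[OF t1(1,2)] by blast
  obtain j :: 'n where j: "pos j = CARD('n) - t" using ex_pos[OF t1(3,4)] by blast
  have Vf: "V \<in> flags" by (rule schubert_dim_ge(1)[OF w V(1)])
  have "vec.dim (V i \<inter> coords {..x}) + vec.dim (V j \<inter> coords {..x}) \<le> card {..x}"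
  proof (rule bil_orthogonal_dim_le)
    show "vec.subspace (V i \<inter> coords {..x})" "vec.subspace (V j \<inter> coords {..x})"
      by (intro vec.subspace_inter flagsD(2)[OF Vf] subspace_coords)+
    have "pos i + pos j \<le> CARD('n)" using i j t1 by simp
    then show "bil y z = 0" if "y \<in> V i \<inter> coords {..x}" "z \<in> V j \<inter> coords {..x}" for y z
      using V(2) that unfolding isotropic_def by blast
  qed auto
  then show ?thesis
    using schubert_dim_ge(2)[OF w V(1), of i x] schubert_dim_ge(2)[OF w V(1), of j x] i j by simp
qed

theorem corollary9:
  fixes D C :: "('n::{finite,linorder}) flag set"
  assumes "CARD('n) \<ge> 2"
    and "open_orbit D"
    and "base_cycle D C"
  shows "card {S. (\<exists>w. w permutes UNIV \<and> S = schubert w) \<and>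
            cdim S + cdim C = cdim (flags :: 'n flag set) \<and> S \<inter> C \<noteq> {}}
       = (\<Prod>j\<in>{j::nat. 2 * j < CARD('n) - 1}. CARD('n) - 1 - 2 * j)"
proof -
  obtain V d where V: "V \<in> D" "C = orbit SO_R V" and CD: "C \<subseteq> D" and sub: "complex_submanifold d C"
    using assms(3) unfolding base_cycle_def by blast
  have "V \<in> C" unfolding V(2) using orbitI[OF SO_R_one, of V] by simp
  then have Cne: "C \<noteq> {}" and Vf: "V \<in> flags" using sub unfolding complex_submanifold_def by blast+
  have cC: "cdim C = d" by (rule cdim_submanifold[OF sub Cne])
  have dC: "2 * d + CARD('n) div 2 = card {(i, j :: 'n). j < i}"
    by (rule cycle_dim[OF Vf]) (use sub V(2) in simp)
  have codim: "l + cdim C = cdim (flags :: 'n flag set) \<longleftrightarrow> l = (CARD('n))\<^sup>2 div 4" for l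
    unfolding cC cdim_flags by (rule codim_arith[OF card_strict_pairs dC])
  have iso: "isotropic V'" if "V' \<in> C" for V'
  proof -
    have V': "V' \<in> orbit SO_R V" using that V(2) by simp
    have "V' \<in> flags" using sub that unfolding complex_submanifold_def by blast
    moreover have "complex_submanifold d (orbit SO_R V')" using sub V(2) orbit_SO_R_eq[OF V'] by simp
    ultimately show ?thesis by (rule cycle_isotropic)
  qed
  have meets: "(cdim (schubert w) + cdim C = cdim (flags :: 'n flag set) \<and> schubert w \<inter> C \<noteq> {}) \<longleftrightarrow> special (word w)"
    if w: "bij w" for w :: "'n \<Rightarrow> 'n"
  proof
    assume a: "cdim (schubert w) + cdim C = cdim (flags :: 'n flag set) \<and> schubert w \<inter> C \<noteq> {}"
    then have inv: "ninv w = (CARD('n))\<^sup>2 div 4" using codim cdim_schubert[OF w] by simp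
    obtain V' where V': "V' \<in> schubert w" "V' \<in> C" using a by blast
    show "special (word w)"
      using ninv_quarter_square_iff[OF w isotropic_rank_le[OF w V'(1) iso[OF V'(2)]]] inv by simp
  next
    assume sp: "special (word w)"
    have good: "w (opp p) < w p" if "p < opp p" for p by (rule special_word_less[OF sp that])
    have "invs (word w) = (length (word w))\<^sup>2 div 4"
      by (rule invs_special[OF sp distinct_word[OF bij_is_inj[OF w]]])
    then have "ninv w = (CARD('n))\<^sup>2 div 4" by (simp add: invs_word) (simp add: word_def index_list)
    then have "cdim (schubert w) + cdim C = cdim (flags :: 'n flag set)" by (simp add: codim cdim_schubert[OF w])
    moreover obtain e where e: "sign_fun e" "act (diag e) (iso_flag w) \<in> orbit SO_R V"
      using signed_iso_flag_in_orbit[OF Vf iso[OF \<open>V \<in> C\<close>] w good] by blast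
    then have "act (diag e) (iso_flag w) \<in> schubert w \<inter> C"
      using signed_iso_flag_cell[OF e(1) w good] cell_subset_schubert[OF w] V(2) by blast
    ultimately show "cdim (schubert w) + cdim C = cdim (flags :: 'n flag set) \<and> schubert w \<inter> C \<noteq> {}" by blast
  qed
  have "{S. (\<exists>w. w permutes UNIV \<and> S = schubert w) \<and>
      cdim S + cdim C = cdim (flags :: 'n flag set) \<and> S \<inter> C \<noteq> {}} =
      schubert ` {w :: 'n \<Rightarrow> 'n. w permutes UNIV \<and> special (word w)}"
    using meets permutes_bij by blast
  moreover have "inj_on schubert {w :: 'n \<Rightarrow> 'n. w permutes UNIV \<and> special (word w)}"
    using schubert_inject permutes_bij by (intro inj_onI) blast
  ultimately show ?thesis by (simp add: card_image card_special_perms)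
qed

end
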